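(* Let $0\le u_0\in L^1(\mathbb{R}^N)\cap L^\infty(\mathbb{R}^N)$ with $u_0=0$ in $\mathcal{H}$, let $u$ be the solution of the nonlocal problem with initial datum $u_0$, let $\phi$ be the solution of the stationary problem, and let $M^*=\int_{\mathbb{R}^N}u_0(x)\phi(x)\,dx$. Then $$t^{N/2}u(x,t)\to\frac{M^*}{(4\pi\alpha)^{N/2}}\,\phi(x)\quad\text{as } t\to\infty,\ \text{uniformly in compact subsets of } \mathbb{R}^N.$$
   Context: Setting: $N\ge 3$; $\mathcal{H}\subset\mathbb{R}^N$ is a bounded open set with smooth boundary (not necessarily connected), $0\in\mathcal{H}$, and $\Omega=\mathbb{R}^N\setminus\mathcal{H}$. The kernel $J:\mathbb{R}^N\to[0,\infty)$ is smooth, radially symmetric, compactly supported in the unit ball centered at the origin, with $J(0)>0$ and $\int_{\mathbb{R}^N}J=1$. Put $\alpha=\frac1{2N}\int_{\mathbb{R}^N}|z|^2J(z)\,dz$. Nonlocal problem: $\partial_t u(x,t)=\int_{\mathbb{R}^N}J(x-y)(u(y,t)-u(x,t))\,dy$ in $\Omega\times(0,\infty)$, $u=0$ in $\mathcal{H}\times(0,\infty)$, $u(\cdot,0)=u_0$. A solution is a function $u\in C([0,\infty);L^1(\mathbb{R}^N))$ such that for all $t>0$, $u(\cdot,t)=u_0+\int_0^t(J*u(\cdot,s)-u(\cdot,s))\,ds$ a.e. in $\Omega$ and $u(\cdot,t)=0$ a.e. in $\mathcal{H}$; it exists and is unique. Uniform convergence is understood in the $L^\infty$ (a.e.) sense.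 Stationary problem: $\phi\in L^1_{\rm loc}(\mathbb{R}^N)$ is the unique solution of $J*\phi=\phi$ in $\Omega$, $\phi=0$ in $\mathcal{H}$, $\phi(x)\to1$ as $|x|\to\infty$. *)

theory Defs
  imports "HOL-Analysis.Analysis"
begin

text \<open>Here \<open>\<real>\<^sup>N\<close> is an arbitrary Euclidean space \<open>'a\<close> with \<open>N = DIM('a)\<close>.  Elements of Lebesgue
  spaces are represented by functions, and every condition on them is invariant under changes on
  null sets.\<close>

subsection \<open>Smooth functions and smooth boundaries\<close>

text \<open>\<open>k_times_cont_diff_on k S f\<close> is meant for open \<open>S\<close>; on a finite-dimensional domain it says that
  all iterated directional derivatives up to order \<open>k\<close> exist as Frechet derivatives and are
  continuous, i.e. that \<open>f\<close> is of class \<open>C^k\<close>.\<close>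

primrec k_times_cont_diff_on ::
    "nat \<Rightarrow> 'a::real_normed_vector set \<Rightarrow> ('a \<Rightarrow> 'b::real_normed_vector) \<Rightarrow> bool" where
  "k_times_cont_diff_on 0 S f \<longleftrightarrow> continuous_on S f"
| "k_times_cont_diff_on (Suc k) S f \<longleftrightarrow>
     (\<forall>x\<in>S. f differentiable (at x)) \<and>
     (\<forall>v. k_times_cont_diff_on k S (\<lambda>x. frechet_derivative f (at x) v))"

definition smooth_on :: "'a::real_normed_vector set \<Rightarrow> ('a \<Rightarrow> 'b::real_normed_vector) \<Rightarrow> bool" where
  "smooth_on S f \<longleftrightarrow> (\<forall>k. k_times_cont_diff_on k S f)"

text \<open>Near each boundary point the set is the sublevel set of a smooth function without critical
  points (so it lies locally on one side of its boundary).\<close>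

definition smooth_boundary :: "'a::euclidean_space set \<Rightarrow> bool" where
  "smooth_boundary U \<longleftrightarrow>
     (\<forall>p\<in>frontier U. \<exists>V (\<rho> :: 'a \<Rightarrow> real).
        open V \<and> p \<in> V \<and> smooth_on V \<rho> \<and>
        (\<forall>x\<in>V. frechet_derivative \<rho> (at x) \<noteq> (\<lambda>_. 0)) \<and>
        U \<inter> V = {x \<in> V. \<rho> x < 0})"

subsection \<open>Function spaces and convolution\<close>

definition locally_integrable :: "('a::euclidean_space \<Rightarrow> real) \<Rightarrow> bool" where
  "locally_integrable f \<longleftrightarrow> (\<forall>K. compact K \<longrightarrow> set_integrable lebesgue K f)"

definition essentially_bounded :: "('a::euclidean_space \<Rightarrow> real) \<Rightarrow> bool" where
  "essentially_bounded f \<longleftrightarrow>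
     f \<in> borel_measurable lebesgue \<and> (\<exists>C. AE x in lebesgue. \<bar>f x\<bar> \<le> C)"

definition convolution ::
    "('a::euclidean_space \<Rightarrow> real) \<Rightarrow> ('a \<Rightarrow> real) \<Rightarrow> 'a \<Rightarrow> real" where
  "convolution J f x = (LINT y|lebesgue. J (x - y) * f y)"

text \<open>Only meaningful for integrable \<open>f\<close> and \<open>g\<close>.\<close>

definition L1_dist :: "('a::euclidean_space \<Rightarrow> real) \<Rightarrow> ('a \<Rightarrow> real) \<Rightarrow> real" where
  "L1_dist f g = (LINT x|lebesgue. \<bar>f x - g x\<bar>)"

definition L1_continuous_on :: "real set \<Rightarrow> (real \<Rightarrow> 'a::euclidean_space \<Rightarrow> real) \<Rightarrow> bool" where
  "L1_continuous_on T u \<longleftrightarrow>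
     (\<forall>t\<in>T. integrable lebesgue (u t)) \<and>
     (\<forall>t\<in>T. ((\<lambda>s. L1_dist (u s) (u t)) \<longlongrightarrow> 0) (at t within T))"

text \<open>The integral over \<open>[a, b]\<close> of a curve with values in \<open>L^1\<close>.  The library does not provide
  \<open>L^1\<close> as a normed space type, so this spells out \<^const>\<open>has_integral\<close> for the \<open>L^1\<close> norm.  It is applied
  to continuous curves only, for which it agrees with the Riemann and the Bochner integral.\<close>

definition has_L1_integral ::
    "(real \<Rightarrow> 'a::euclidean_space \<Rightarrow> real) \<Rightarrow> ('a \<Rightarrow> real) \<Rightarrow> real \<Rightarrow> real \<Rightarrow> bool" where
  "has_L1_integral f F a b \<longleftrightarrow>
     (\<forall>s\<in>{a..b}. integrable lebesgue (f s)) \<and> integrable lebesgue F \<and>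
     (\<forall>e>0. \<exists>\<gamma>. gauge \<gamma> \<and>
        (\<forall>D. D tagged_division_of {a..b} \<and> \<gamma> fine D \<longrightarrow>
           L1_dist (\<lambda>x. \<Sum>(s, k)\<in>D. measure lborel k * f s x) F < e))"

text \<open>The \<open>L^\<infinity>\<close> (almost everywhere) variant of \<^const>\<open>uniform_limit\<close>.\<close>

definition ae_uniform_limit ::
    "'a::euclidean_space set \<Rightarrow> ('t \<Rightarrow> 'a \<Rightarrow> real) \<Rightarrow> ('a \<Rightarrow> real) \<Rightarrow> 't filter \<Rightarrow> bool" where
  "ae_uniform_limit K f l \<F> \<longleftrightarrow>
     (\<forall>e>0. \<forall>\<^sub>F t in \<F>. AE x in lebesgue. x \<in> K \<longrightarrow> dist (f t x) (l x) < e)"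

subsection \<open>The evolution problem and the stationary problem\<close>

text \<open>\<open>\<H>\<close> is the hole, and \<open>\<Omega>\<close> is its complement.\<close>

definition nonlocal_solution ::
    "('a::euclidean_space \<Rightarrow> real) \<Rightarrow> 'a set \<Rightarrow> ('a \<Rightarrow> real) \<Rightarrow> (real \<Rightarrow> 'a \<Rightarrow> real) \<Rightarrow> bool" where
  "nonlocal_solution J \<H> u\<^sub>0 u \<longleftrightarrow>
     L1_continuous_on {0..} u \<and>
     (\<forall>t>0.
        (\<exists>F. has_L1_integral (\<lambda>s x. convolution J (u s) x - u s x) F 0 t \<and>
             (AE x in lebesgue. x \<in> - \<H> \<longrightarrow> u t x = u\<^sub>0 x + F x)) \<and>
        (AE x in lebesgue. x \<in> \<H> \<longrightarrow> u t x = 0))"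

text \<open>As \<open>\<phi>\<close> is only determined almost everywhere, its limit at infinity is the essential one.\<close>

definition stationary_solution ::
    "('a::euclidean_space \<Rightarrow> real) \<Rightarrow> 'a set \<Rightarrow> ('a \<Rightarrow> real) \<Rightarrow> bool" where
  "stationary_solution J \<H> \<phi> \<longleftrightarrow>
     locally_integrable \<phi> \<and>
     (AE x in lebesgue. x \<in> - \<H> \<longrightarrow> convolution J \<phi> x = \<phi> x) \<and>
     (AE x in lebesgue. x \<in> \<H> \<longrightarrow> \<phi> x = 0) \<and>
     (\<forall>e>0. \<exists>R. AE x in lebesgue. norm x \<ge> R \<longrightarrow> \<bar>\<phi> x - 1\<bar> < e)"

definition diffusivity :: "('a::euclidean_space \<Rightarrow> real) \<Rightarrow> real" where
  "diffusivity J = 1 / (2 * real DIM('a)) * (LINT z|lebesgue. (norm z)\<^sup>2 * J z)"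

end

theory Submission
  imports Defs "HOL-Probability.Characteristic_Functions" "HOL-Real_Asymp.Real_Asymp"
begin

text \<open>
  Let \<open>B f = J * f\<close> be the averaging operator of the free random walk with jump density \<open>J\<close>, and let
  \<open>A f = 1\<^sub>\<Omega> (J * (1\<^sub>\<Omega> f))\<close> be the one of the walk killed in the hole.  The evolution equation says
  \<open>u' = A u - u\<close>, so that \<open>u(t)\<close> is the average of \<open>A\<^sup>n u\<^sub>0\<close> over a Poisson distributed time \<open>n\<close> of mean
  \<open>t\<close>.  Since \<open>u\<close> is only determined almost everywhere, everything is tested against bounded functions
  \<open>g \<ge> 0\<close> supported in a fixed ball: the claim is equivalent to
  \<open>t\<^sup>N\<^sup>/\<^sup>2 \<langle>u(t), g\<rangle> \<rightarrow> c \<langle>u\<^sub>0, \<phi>\<rangle> \<langle>\<phi>, g\<rangle>\<close>, \<open>c = (4 \<pi> \<alpha>)\<^sup>-\<^sup>N\<^sup>/\<^sup>2\<close>, with an error that is small compared with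
  the integral of \<open>g\<close>, and a Poisson average (\<open>poisson_abelian\<close>) reduces this to the discrete statement
  \<open>n\<^sup>N\<^sup>/\<^sup>2 \<langle>u\<^sub>0, A\<^sup>n g\<rangle> \<rightarrow> c \<langle>u\<^sub>0, \<phi>\<rangle> \<langle>\<phi>, g\<rangle>\<close> (\<open>killed_local_limit\<close>).

  The discrete statement has a probabilistic reason: for the walk to go from \<open>x\<close> to \<open>y\<close> in \<open>n\<close> steps
  without entering the hole, it must avoid the hole for a long time after leaving \<open>x\<close> and for a long
  time before reaching \<open>y\<close>, and in between it is far away and does not notice the hole.  The first two
  events have probabilities close to \<open>\<phi>(x)\<close> and \<open>\<phi>(y)\<close>, and the free walk contributes its density
  \<open>c n\<^sup>-\<^sup>N\<^sup>/\<^sup>2\<close>.  Three facts make this precise.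

  First, the local limit theorem for the free walk (\<open>local_limit_theorem\<close>), uniform in space.  By Fourier
  inversion it is an \<open>L\<^sup>1\<close> convergence of rescaled characteristic functions.  It also yields the bound
  \<open>|B\<^sup>n f| \<le> C n\<^sup>-\<^sup>N\<^sup>/\<^sup>2 \<parallel>f\<parallel>\<^sub>1\<close> (\<open>free_sup_bound\<close>).

  Second, the survival probabilities \<open>A\<^sup>n 1\<close> converge to \<open>\<phi>\<close> uniformly (\<open>survival_tendsto_\<phi>\<close>): as
  \<open>A \<phi> = \<phi>\<close>, their difference is \<open>A\<^sup>n (1 - \<phi>)\<close>, which is bounded by \<open>B\<^sup>n |1 - \<phi>|\<close>, and \<open>1 - \<phi>\<close> is small
  outside a ball while \<open>B\<^sup>n\<close> flattens what is inside it.

  Third, replacing \<open>A\<^sup>m\<close> by \<open>B\<^sup>m\<close> after \<open>T\<close> killed steps costs little (\<open>killed_vs_free\<close>): the difference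
  is nonnegative, so its \<open>L\<^sup>1\<close> norm is the mass that is killed after time \<open>T\<close>, and this is a difference of
  survival probabilities.  Paired with a function of size \<open>n\<^sup>-\<^sup>N\<^sup>/\<^sup>2\<close> this is an admissible error.
\<close>

section \<open>Gaussian integrals in Euclidean space\<close>

lemma lborel_integral_affine:
  fixes f :: "'a::euclidean_space \<Rightarrow> 'b::{banach, second_countable_topology}"
  assumes "c \<noteq> 0" and [measurable]: "f \<in> borel_measurable borel"
  shows "integral\<^sup>L lborel f = \<bar>c\<bar> ^ DIM('a) *\<^sub>R (LINT x|lborel. f (t + c *\<^sub>R x))"
  by (subst lborel_affine[OF \<open>c \<noteq> 0\<close>, of t]) (simp add: integral_density integral_distr)

lemma lborel_integrable_affine_iff:
  fixes f :: "'a::euclidean_space \<Rightarrow> 'b::{banach, second_countable_topology}"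
  assumes "c \<noteq> 0" and [measurable]: "f \<in> borel_measurable borel"
  shows "integrable lborel (\<lambda>x. f (t + c *\<^sub>R x)) \<longleftrightarrow> integrable lborel f"
proof -
  have "integrable lborel f \<longleftrightarrow> integrable lborel (\<lambda>x. \<bar>c\<bar> ^ DIM('a) *\<^sub>R f (t + c *\<^sub>R x))"
    by (subst lborel_affine[OF \<open>c \<noteq> 0\<close>, of t]) (simp add: integrable_density integrable_distr_eq)
  also have "\<dots> \<longleftrightarrow> integrable lborel (\<lambda>x. f (t + c *\<^sub>R x))"
    using \<open>c \<noteq> 0\<close> integrable_scaleR_right[of "inverse (\<bar>c\<bar> ^ DIM('a))" lborel "\<lambda>x. \<bar>c\<bar> ^ DIM('a) *\<^sub>R f (t + c *\<^sub>R x)"]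
    by auto
  finally show ?thesis ..
qed

lemma lborel_integral_reflect:
  fixes f :: "'a::euclidean_space \<Rightarrow> real"
  assumes [measurable]: "f \<in> borel_measurable borel"
  shows "(LINT x|lborel. f (t - x)) = integral\<^sup>L lborel f"
  using lborel_integral_affine[of "-1" f t] by simp

lemma lborel_integrable_reflect_iff:
  fixes f :: "'a::euclidean_space \<Rightarrow> real"
  assumes [measurable]: "f \<in> borel_measurable borel"
  shows "integrable lborel (\<lambda>x. f (t - x)) \<longleftrightarrow> integrable lborel f"
  using lborel_integrable_affine_iff[of "-1" f t] by simp

lemma lborel_integral_translate:
  fixes f :: "'a::euclidean_space \<Rightarrow> real"
  assumes [measurable]: "f \<in> borel_measurable borel"
  shows "(LINT x|lborel. f (x - t)) = integral\<^sup>L lborel f"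
  using lborel_integral_affine[of 1 f "-t"] by simp

lemma lborel_integrable_translate_iff:
  fixes f :: "'a::euclidean_space \<Rightarrow> real"
  assumes [measurable]: "f \<in> borel_measurable borel"
  shows "integrable lborel (\<lambda>x. f (x - t)) \<longleftrightarrow> integrable lborel f"
  using lborel_integrable_affine_iff[of 1 f "-t"] by simp

text \<open>Tonelli in coordinates: this is how one-dimensional Gaussian integrals are lifted to \<open>\<real>\<^sup>N\<close>.\<close>

lemma lborel_prod_coordinates:
  fixes f :: "'a::euclidean_space \<Rightarrow> real \<Rightarrow> complex"
  assumes f: "\<And>b. b \<in> Basis \<Longrightarrow> integrable lborel (f b)"
  shows "integrable lborel (\<lambda>x. \<Prod>b\<in>Basis. f b (x \<bullet> b))"
    and "(LINT x|lborel. (\<Prod>b\<in>Basis. f b (x \<bullet> b))) = (\<Prod>b\<in>Basis. integral\<^sup>L lborel (f b))"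
proof -
  interpret product_sigma_finite "\<lambda>b::'a. lborel :: real measure" ..
  have [measurable]: "f b \<in> borel_measurable borel" if "b \<in> Basis" for b
    using borel_measurable_integrable[OF f[OF that]] by simp
  have coord: "(\<Sum>b'\<in>Basis. g b' *\<^sub>R b') \<bullet> b = g b" if "b \<in> Basis" for g b
    using that by simp
  have m: "(\<lambda>g. \<Sum>b\<in>Basis. g b *\<^sub>R b) \<in> (\<Pi>\<^sub>M b\<in>Basis. lborel) \<rightarrow>\<^sub>M (borel :: 'a measure)"
    by measurable
  have m2: "(\<lambda>x. \<Prod>b\<in>Basis. f b (x \<bullet> b)) \<in> borel_measurable (borel :: 'a measure)"
    by (intro borel_measurable_prod) measurable
  show "integrable lborel (\<lambda>x. \<Prod>b\<in>Basis. f b (x \<bullet> b))"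
    apply (subst lborel_eq)
    apply (subst integrable_distr_eq[OF m m2])
    using product_integrable_prod[of Basis f] f by (simp add: coord cong: prod.cong)
  show "(LINT x|lborel. (\<Prod>b\<in>Basis. f b (x \<bullet> b))) = (\<Prod>b\<in>Basis. integral\<^sup>L lborel (f b))"
    apply (subst lborel_eq)
    apply (subst integral_distr[OF m m2])
    using product_integral_prod[of Basis f] f by (simp add: coord cong: prod.cong)
qed

text \<open>The characteristic function of the standard normal distribution, rescaled.\<close>

lemma gaussian_character_1d:
  fixes a s :: real
  assumes "a > 0"
  shows "integrable lborel (\<lambda>x. complex_of_real (exp (- a * x\<^sup>2)) * iexp (s * x))"
    and "(CLINT x|lborel. complex_of_real (exp (- a * x\<^sup>2)) * iexp (s * x))
          = complex_of_real (sqrt (pi / a) * exp (- s\<^sup>2 / (4 * a)))"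
proof -
  define c where "c = 1 / sqrt (2 * a)"
  have c: "c > 0" "c\<^sup>2 = 1 / (2 * a)" using assms by (auto simp: c_def power_divide)
  have base: "(CLINT x|lborel. complex_of_real (std_normal_density x) * iexp (r * x)) = exp (- (r\<^sup>2) / 2)" for r
  proof -
    have "char std_normal_distribution r = (CLINT x|lborel. std_normal_density x *\<^sub>R iexp (r * x))"
      unfolding char_def by (subst integral_density) auto
    then show ?thesis by (simp add: char_std_normal_distribution scaleR_conv_of_real)
  qed
  have baseint: "integrable lborel (\<lambda>x. complex_of_real (std_normal_density x) * iexp (r * x))" for r
  proof (rule Bochner_Integration.integrable_bound)
    show "integrable lborel std_normal_density" by simp
  qed (auto simp: norm_mult)
  have dens: "std_normal_density x = (1 / sqrt (2 * pi)) * exp (- a * (c * x)\<^sup>2)" for x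
    using assms c by (simp add: std_normal_density_def power_mult_distrib)
  have eq: "complex_of_real (exp (- a * (0 + c * x)\<^sup>2)) * iexp (s * (0 + c * x)) =
      sqrt (2 * pi) * (complex_of_real (std_normal_density x) * iexp ((s * c) * x))" for x
    by (subst dens) (simp add: mult_ac flip: of_real_mult)
  show "integrable lborel (\<lambda>x. complex_of_real (exp (- a * x\<^sup>2)) * iexp (s * x))"
    apply (subst lborel_integrable_real_affine_iff[symmetric, of c _ 0])
    using c apply simp
    unfolding eq by (intro integrable_mult_right baseint)
  have "(CLINT x|lborel. complex_of_real (exp (- a * x\<^sup>2)) * iexp (s * x)) =
      \<bar>c\<bar> *\<^sub>R (CLINT x|lborel. sqrt (2 * pi) * (complex_of_real (std_normal_density x) * iexp ((s * c) * x)))"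
    apply (subst lborel_integral_real_affine[of c _ 0])
    using c apply simp
    unfolding eq ..
  also have "\<dots> = complex_of_real (c * (sqrt (2 * pi) * exp (- ((s * c)\<^sup>2) / 2)))"
    unfolding integral_mult_right_zero base using c by (simp add: scaleR_conv_of_real)
  also have "c * (sqrt (2 * pi) * exp (- ((s * c)\<^sup>2) / 2)) = sqrt (pi / a) * exp (- s\<^sup>2 / (4 * a))"
  proof -
    have "c * sqrt (2 * pi) = sqrt (pi / a)"
      using assms by (simp add: c_def real_sqrt_mult real_sqrt_divide)
    moreover have "- ((s * c)\<^sup>2) / 2 = - s\<^sup>2 / (4 * a)"
      using c by (simp add: power_mult_distrib)
    ultimately show ?thesis by (metis mult.assoc)
  qed
  finally show "(CLINT x|lborel. complex_of_real (exp (- a * x\<^sup>2)) * iexp (s * x))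
          = complex_of_real (sqrt (pi / a) * exp (- s\<^sup>2 / (4 * a)))" .
qed

lemma norm_eq_sum_coords: "(norm (x::'a::euclidean_space))\<^sup>2 = (\<Sum>b\<in>Basis. (x \<bullet> b)\<^sup>2)"
  unfolding power2_norm_eq_inner by (subst euclidean_inner) (simp add: power2_eq_square)

lemma gaussian_character:
  fixes z :: "'a::euclidean_space"
  assumes "a > 0"
  shows "integrable lborel (\<lambda>x::'a. exp (- a * (norm x)\<^sup>2) * cos (x \<bullet> z))"
    and "(LINT x|lborel. exp (- a * (norm x)\<^sup>2) * cos (x \<bullet> z))
          = (pi / a) powr (real DIM('a) / 2) * exp (- (norm z)\<^sup>2 / (4 * a))"
proof -
  define f where "f b x = complex_of_real (exp (- a * x\<^sup>2)) * iexp ((z \<bullet> b) * x)" for b :: 'a and x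
  have 1: "integrable lborel (f b)"
    "integral\<^sup>L lborel (f b) = complex_of_real (sqrt (pi / a) * exp (- (z \<bullet> b)\<^sup>2 / (4 * a)))" for b
    unfolding f_def by (rule gaussian_character_1d[OF assms])+
  have fprod: "(\<Prod>b\<in>Basis. f b (x \<bullet> b)) = complex_of_real (exp (- a * (norm x)\<^sup>2)) * iexp (x \<bullet> z)" for x
  proof -
    have "(\<Prod>b\<in>Basis. exp (- a * (x \<bullet> b)\<^sup>2)) = exp (- a * (norm x)\<^sup>2)"
      by (simp add: exp_sum[symmetric] norm_eq_sum_coords sum_distrib_left)
    moreover have "(\<Prod>b\<in>Basis. iexp ((z \<bullet> b) * (x \<bullet> b))) = iexp (x \<bullet> z)"
      by (simp add: exp_sum[symmetric] euclidean_inner[of x z] sum_distrib_left mult.commute)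
    ultimately show ?thesis
      unfolding f_def prod.distrib by (simp only: of_real_prod[symmetric])
  qed
  have re: "Re (complex_of_real (exp (- a * (norm x)\<^sup>2)) * iexp (x \<bullet> z)) = exp (- a * (norm x)\<^sup>2) * cos (x \<bullet> z)" for x :: 'a
    by (simp flip: cis_conv_exp)
  note I = lborel_prod_coordinates[of f, OF 1(1), unfolded fprod]
  show "integrable lborel (\<lambda>x::'a. exp (- a * (norm x)\<^sup>2) * cos (x \<bullet> z))"
    using integrable_Re[OF I(1)] unfolding re by simp
  have "(LINT x|lborel. exp (- a * (norm x)\<^sup>2) * cos (x \<bullet> z)) = Re (\<Prod>b\<in>Basis. integral\<^sup>L lborel (f b))"
    unfolding I(2)[symmetric] re[symmetric] by (rule integral_Re[OF I(1)])
  also have "(\<Prod>b\<in>Basis. integral\<^sup>L lborel (f b)) =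
      complex_of_real ((sqrt (pi / a)) ^ DIM('a) * exp (- (norm z)\<^sup>2 / (4 * a)))"
  proof -
    have "(\<Prod>b\<in>Basis. sqrt (pi / a) * exp (- (z \<bullet> b)\<^sup>2 / (4 * a))) = (sqrt (pi / a)) ^ DIM('a) * exp (- (norm z)\<^sup>2 / (4 * a))"
      unfolding prod.distrib
      by (simp add: exp_sum[symmetric] norm_eq_sum_coords sum_divide_distrib sum_negf)
    then show ?thesis
      unfolding 1(2) by (simp only: of_real_prod[symmetric])
  qed
  also have "(sqrt (pi / a)) ^ DIM('a) = (pi / a) powr (real DIM('a) / 2)"
    using assms by (simp add: powr_half_sqrt[symmetric] powr_powr flip: powr_realpow)
  finally show "(LINT x|lborel. exp (- a * (norm x)\<^sup>2) * cos (x \<bullet> z))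
          = (pi / a) powr (real DIM('a) / 2) * exp (- (norm z)\<^sup>2 / (4 * a))" by simp
qed

lemma gaussian_integral:
  assumes "a > 0"
  shows "integrable lborel (\<lambda>x::'a::euclidean_space. exp (- a * (norm x)\<^sup>2))"
    and "(LINT x|lborel. exp (- a * (norm (x::'a))\<^sup>2)) = (pi / a) powr (real DIM('a) / 2)"
  using gaussian_character[OF assms, of "0::'a"] by simp_all

section \<open>Pairings and convolutions\<close>

text \<open>Bounded functions are used pointwise, not up to null sets, so that iterates of the jump operators
  are defined at every point.\<close>

definition bounded_borel :: "('a::euclidean_space \<Rightarrow> real) \<Rightarrow> bool" where
  "bounded_borel f \<longleftrightarrow> f \<in> borel_measurable borel \<and> (\<exists>C. \<forall>x. \<bar>f x\<bar> \<le> C)"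

lemma bounded_borelI: "f \<in> borel_measurable borel \<Longrightarrow> (\<And>x. \<bar>f x\<bar> \<le> C) \<Longrightarrow> bounded_borel f"
  by (auto simp: bounded_borel_def)

lemma bounded_borel_meas[measurable_dest]: "bounded_borel f \<Longrightarrow> f \<in> borel_measurable borel"
  by (auto simp: bounded_borel_def)

lemma bounded_borelE:
  assumes "bounded_borel f"
  obtains C where "C \<ge> 0" "\<And>x. \<bar>f x\<bar> \<le> C"
  using assms unfolding bounded_borel_def by (meson abs_ge_zero order_trans)

lemma bounded_borel_mult: "bounded_borel f \<Longrightarrow> bounded_borel g \<Longrightarrow> bounded_borel (\<lambda>x. f x * g x)"
proof -
  assume f: "bounded_borel f" and g: "bounded_borel g"
  obtain C where "C \<ge> 0" "\<And>x. \<bar>f x\<bar> \<le> C" using f by (rule bounded_borelE) blast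
  moreover obtain D where "D \<ge> 0" "\<And>x. \<bar>g x\<bar> \<le> D" using g by (rule bounded_borelE) blast
  ultimately show ?thesis
    using f g by (intro bounded_borelI[where C="C * D"])
      (auto simp: abs_mult dest: bounded_borel_meas intro!: mult_mono borel_measurable_times)
qed

lemma bounded_borel_diff: "bounded_borel f \<Longrightarrow> bounded_borel g \<Longrightarrow> bounded_borel (\<lambda>x. f x - g x)"
  unfolding bounded_borel_def
  by (auto intro!: exI[where x="_ + _"] order_trans[OF abs_triangle_ineq4] add_mono)

lemma bounded_borel_const: "bounded_borel (\<lambda>x. c)"
  by (rule bounded_borelI[where C="\<bar>c\<bar>"]) auto

lemma bounded_borel_indicator: "S \<in> sets borel \<Longrightarrow> bounded_borel (indicator S)"
  by (rule bounded_borelI[where C=1]) (auto simp: indicator_def)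

lemma integrable_borel_meas[measurable_dest]: "integrable lborel f \<Longrightarrow> f \<in> borel_measurable borel"
  by (drule borel_measurable_integrable) simp

lemma integrable_mult_bounded:
  fixes f :: "'a::euclidean_space \<Rightarrow> real"
  assumes f: "integrable lborel f" and g: "bounded_borel g"
  shows "integrable lborel (\<lambda>x. f x * g x)"
proof -
  obtain C where C: "C \<ge> 0" "\<And>x. \<bar>g x\<bar> \<le> C" using g by (rule bounded_borelE) blast
  have [measurable]: "f \<in> borel_measurable borel" "g \<in> borel_measurable borel"
    using f g by (auto dest: bounded_borel_meas integrable_borel_meas)
  show ?thesis
    by (rule Bochner_Integration.integrable_bound[OF integrable_mult_left[OF integrable_abs[OF f], of C]])
       (auto simp: abs_mult C intro!: mult_left_mono)
qed

lemma integral_mult_bounded_le: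
  fixes f :: "'a::euclidean_space \<Rightarrow> real"
  assumes f: "integrable lborel f" and g: "g \<in> borel_measurable borel" "AE x in lborel. \<bar>g x\<bar> \<le> C"
  shows "\<bar>LINT x|lborel. f x * g x\<bar> \<le> C * (LINT x|lborel. \<bar>f x\<bar>)"
proof -
  have [measurable]: "f \<in> borel_measurable borel" "g \<in> borel_measurable borel"
    using f g by (auto dest: integrable_borel_meas)
  have le: "AE x in lborel. \<bar>f x * g x\<bar> \<le> \<bar>f x\<bar> * C"
    using g(2) by eventually_elim (auto simp: abs_mult intro!: mult_left_mono)
  have i: "integrable lborel (\<lambda>x. \<bar>f x\<bar> * C)"
    using f by (intro integrable_mult_left integrable_abs)
  have "\<bar>LINT x|lborel. f x * g x\<bar> \<le> (LINT x|lborel. \<bar>f x * g x\<bar>)"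
    by (rule integral_abs_bound)
  also have "\<dots> \<le> (LINT x|lborel. \<bar>f x\<bar> * C)"
  proof (rule integral_mono_AE)
    show "integrable lborel (\<lambda>x. \<bar>f x * g x\<bar>)"
      by (rule Bochner_Integration.integrable_bound[OF i]) (use le in \<open>auto elim!: eventually_mono\<close>)
  qed (use i le in auto)
  finally show ?thesis by (simp add: mult.commute)
qed

text \<open>Pairing a convolution with a bounded function is the only form in which Fubini is needed below: it
  gives the symmetry of the jump operators, the convolution semigroup and the multiplicativity of the
  Fourier transform.\<close>

lemma convolution_fubini:
  fixes f k h :: "'a::euclidean_space \<Rightarrow> real"
  assumes f: "integrable lborel f" and k: "integrable lborel k" and h: "bounded_borel h"
  shows "integrable (lborel \<Otimes>\<^sub>M lborel) (\<lambda>(y, x). f y * (k (x - y) * h x))"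
    and convolution_integrable: "integrable lborel (\<lambda>x. h x * (LINT y|lborel. k (x - y) * f y))"
    and convolution_swap: "(LINT x|lborel. h x * (LINT y|lborel. k (x - y) * f y)) =
      (LINT y|lborel. f y * (LINT x|lborel. k (x - y) * h x))"
proof -
  obtain C where C: "C \<ge> 0" "\<And>x. \<bar>h x\<bar> \<le> C" using h by (rule bounded_borelE) blast
  have [measurable]: "f \<in> borel_measurable borel" "k \<in> borel_measurable borel" "h \<in> borel_measurable borel"
    using f k h by (auto dest: bounded_borel_meas integrable_borel_meas)
  have kh: "integrable lborel (\<lambda>x. k (x - y) * h x)" for y
    by (rule integrable_mult_bounded[OF _ h]) (simp add: lborel_integrable_translate_iff k)
  have bd: "\<bar>LINT x|lborel. \<bar>k (x - y) * h x\<bar>\<bar> \<le> C * (LINT x|lborel. \<bar>k x\<bar>)" for y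
  proof -
    have "(LINT x|lborel. \<bar>k (x - y) * h x\<bar>) = (LINT x|lborel. \<bar>k (x - y)\<bar> * \<bar>h x\<bar>)"
      by (simp add: abs_mult)
    also have "\<bar>\<dots>\<bar> \<le> C * (LINT x|lborel. \<bar>\<bar>k (x - y)\<bar>\<bar>)"
      by (rule integral_mult_bounded_le) (use k C in \<open>auto simp: lborel_integrable_translate_iff\<close>)
    finally show ?thesis
      using lborel_integral_translate[of "\<lambda>x. \<bar>k x\<bar>" y] by simp
  qed
  show P: "integrable (lborel \<Otimes>\<^sub>M lborel) (\<lambda>(y, x). f y * (k (x - y) * h x))"
  proof (rule lborel_pair.Fubini_integrable)
    show "(\<lambda>(y, x). f y * (k (x - y) * h x)) \<in> borel_measurable (lborel \<Otimes>\<^sub>M lborel)"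
      by measurable
    have "bounded_borel (\<lambda>y. LINT x|lborel. \<bar>k (x - y) * h x\<bar>)"
      by (rule bounded_borelI[OF _ bd]) measurable
    from integrable_mult_bounded[OF integrable_abs[OF f] this]
    show "integrable lborel (\<lambda>y. LINT x|lborel. norm (case (y, x) of (y, x) \<Rightarrow> f y * (k (x - y) * h x)))"
      by (simp add: abs_mult)
    show "AE y in lborel. integrable lborel (\<lambda>x. case (y, x) of (y, x) \<Rightarrow> f y * (k (x - y) * h x))"
      using kh by (auto intro!: AE_I2)
  qed
  have eq: "h x * (LINT y|lborel. k (x - y) * f y) = (LINT y|lborel. f y * (k (x - y) * h x))" for x
    by (simp add: mult_ac flip: integral_mult_right_zero)
  show "integrable lborel (\<lambda>x. h x * (LINT y|lborel. k (x - y) * f y))"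
    using lborel_pair.integrable_snd[OF P] unfolding eq .
  show "(LINT x|lborel. h x * (LINT y|lborel. k (x - y) * f y)) =
      (LINT y|lborel. f y * (LINT x|lborel. k (x - y) * h x))"
    unfolding eq using lborel_pair.Fubini_integral[OF P] by simp
qed

section \<open>The jump operators\<close>

locale jump_kernel =
  fixes J :: "'a::euclidean_space \<Rightarrow> real"
  assumes J_cont: "continuous_on UNIV J"
    and J_nonneg: "J x \<ge> 0"
    and J_radial: "norm x = norm y \<Longrightarrow> J x = J y"
    and J_support: "norm x > 1 \<Longrightarrow> J x = 0"
    and J_zero: "J 0 > 0"
    and J_mass: "(LINT x|lborel. J x) = 1"
begin

lemma J_meas[measurable]: "J \<in> borel_measurable borel"
  using J_cont by (rule borel_measurable_continuous_onI)

lemma J_even: "J (- x) = J x"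
  by (rule J_radial) simp

lemma J_minus_commute: "J (x - y) = J (y - x)"
  by (rule J_radial) (simp add: norm_minus_commute)

lemma J_integrable: "integrable lborel J"
  using J_mass not_integrable_integral_eq by fastforce

definition Jmax :: real where "Jmax = (SUP x. J x)"

lemma J_le_Jmax: "J x \<le> Jmax"
proof -
  have "compact (J ` cball 0 1)"
    using J_cont by (intro compact_continuous_image) (auto intro: continuous_on_subset)
  then obtain C where C: "\<And>x. norm x \<le> 1 \<Longrightarrow> \<bar>J x\<bar> \<le> C"
    by (metis bounded_iff compact_imp_bounded imageI mem_cball_0 real_norm_def)
  have "J x \<le> max C 0" for x
    using C[of x] J_support[of x] by (cases "norm x \<le> 1") auto
  then have "bdd_above (range J)" by (auto intro!: bdd_aboveI2)
  then show ?thesis unfolding Jmax_def by (rule cSUP_upper[rotated]) auto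
qed

lemma Jmax_pos: "Jmax > 0"
  using J_le_Jmax[of 0] J_zero by simp

lemma J_bounded_borel: "bounded_borel (\<lambda>y. J (x - y))" "bounded_borel J"
  by (rule bounded_borelI[where C=Jmax]; use J_le_Jmax J_nonneg in simp)+

definition avg :: "('a \<Rightarrow> real) \<Rightarrow> 'a \<Rightarrow> real" where
  "avg f x = (LINT y|lborel. J (x - y) * f y)"

text \<open>The operator \<open>A\<close> of the walk killed outside \<open>S\<close>.  The indicator is put on both sides, which makes
  the operator symmetric; \<open>S = UNIV\<close> gives the free operator.\<close>

definition step :: "'a set \<Rightarrow> ('a \<Rightarrow> real) \<Rightarrow> 'a \<Rightarrow> real" where
  "step S f x = indicator S x * avg (\<lambda>y. indicator S y * f y) x"

lemma step_UNIV: "step UNIV = avg"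
  by (intro ext) (simp add: step_def)

lemma J_translate_integrable: "integrable lborel (\<lambda>y. J (x - y))"
  by (simp add: lborel_integrable_reflect_iff J_integrable)

lemma J_translate_mass: "(LINT y|lborel. J (x - y)) = 1"
  by (simp add: lborel_integral_reflect J_mass)

text \<open>The functions whose averages are given by a convergent integral at every point.  Both bounded and
  integrable functions qualify, and averaging is additive on them.\<close>

definition averageable :: "('a \<Rightarrow> real) \<Rightarrow> bool" where
  "averageable f \<longleftrightarrow> f \<in> borel_measurable borel \<and> (\<forall>x. integrable lborel (\<lambda>y. J (x - y) * f y))"

lemma averageable_bounded: "bounded_borel f \<Longrightarrow> averageable f"
  unfolding averageable_def
  by (auto intro!: integrable_mult_bounded J_translate_integrable dest: bounded_borel_meas)

lemma averageable_integrable: "integrable lborel f \<Longrightarrow> averageable f"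
  unfolding averageable_def
  using integrable_mult_bounded[OF _ J_bounded_borel(1)]
  by (auto simp: mult.commute dest: integrable_borel_meas)

lemma averageable_indicator:
  assumes "S \<in> sets borel" "averageable f" shows "averageable (\<lambda>y. indicator S y * f y)"
proof -
  have [measurable]: "f \<in> borel_measurable borel" "S \<in> sets borel" using assms by (auto simp: averageable_def)
  show ?thesis
    unfolding averageable_def
  proof (intro conjI allI)
    fix x
    have "integrable lborel (\<lambda>y. J (x - y) * f y)" using assms by (auto simp: averageable_def)
    then show "integrable lborel (\<lambda>y. J (x - y) * (indicator S y * f y))"
      by (rule Bochner_Integration.integrable_bound) (auto simp: indicator_def)
  qed measurable
qed

lemma avg_nonneg: "(\<And>x. f x \<ge> 0) \<Longrightarrow> avg f x \<ge> 0"
  unfolding avg_def by (intro Bochner_Integration.integral_nonneg) (auto simp: J_nonneg)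

lemma avg_diff: "averageable f \<Longrightarrow> averageable g \<Longrightarrow> avg (\<lambda>x. f x - g x) x = avg f x - avg g x"
  unfolding avg_def averageable_def by (simp add: right_diff_distrib)

lemma avg_const: "avg (\<lambda>x. c) x = c"
  unfolding avg_def by (simp add: J_translate_mass)

lemma avg_meas:
  assumes [measurable]: "f \<in> borel_measurable borel"
  shows "avg f \<in> borel_measurable borel"
  unfolding avg_def by measurable

lemma avg_bound:
  assumes "f \<in> borel_measurable borel" "AE x in lborel. \<bar>f x\<bar> \<le> C" shows "\<bar>avg f x\<bar> \<le> C"
  using integral_mult_bounded_le[OF J_translate_integrable[of x] assms]
  by (simp add: avg_def J_nonneg J_translate_mass)

lemma avg_bounded_borel: "bounded_borel f \<Longrightarrow> bounded_borel (avg f)"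
proof -
  assume f: "bounded_borel f"
  then obtain C where "C \<ge> 0" "\<And>x. \<bar>f x\<bar> \<le> C" by (rule bounded_borelE) blast
  then show ?thesis
    using f by (intro bounded_borelI[where C=C] avg_meas avg_bound) (auto dest: bounded_borel_meas)
qed

lemma avg_integrable: "integrable lborel f \<Longrightarrow> integrable lborel (avg f)"
  unfolding avg_def using convolution_integrable[OF _ J_integrable bounded_borel_const[of 1]] by simp

lemma avg_symmetric:
  assumes "integrable lborel f" "bounded_borel g"
  shows "(LINT x|lborel. avg f x * g x) = (LINT x|lborel. f x * avg g x)"
  using convolution_swap[OF assms(1) J_integrable assms(2)]
  by (simp add: avg_def mult.commute J_minus_commute)

lemma step_meas: "S \<in> sets borel \<Longrightarrow> f \<in> borel_measurable borel \<Longrightarrow> step S f \<in> borel_measurable borel"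
  unfolding step_def by (intro borel_measurable_times avg_meas) auto

lemma step_bounded_borel: "S \<in> sets borel \<Longrightarrow> bounded_borel f \<Longrightarrow> bounded_borel (step S f)"
  unfolding step_def by (intro bounded_borel_mult bounded_borel_indicator avg_bounded_borel)

lemma integrable_indicator_times:
  "S \<in> sets borel \<Longrightarrow> integrable lborel f \<Longrightarrow> integrable lborel (\<lambda>x. indicator S x * f x :: real)"
  using integrable_mult_bounded[OF _ bounded_borel_indicator] by (simp add: mult.commute)

lemma step_integrable: "S \<in> sets borel \<Longrightarrow> integrable lborel f \<Longrightarrow> integrable lborel (step S f)"
  unfolding step_def by (intro integrable_indicator_times avg_integrable)

lemma step_symmetric:
  assumes S: "S \<in> sets borel" and "integrable lborel f" "bounded_borel g"
  shows "(LINT x|lborel. step S f x * g x) = (LINT x|lborel. f x * step S g x)"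
proof -
  let ?f = "\<lambda>x. indicator S x * f x" and ?g = "\<lambda>x. indicator S x * g x"
  have "(LINT x|lborel. step S f x * g x) = (LINT x|lborel. avg ?f x * ?g x)"
    by (intro Bochner_Integration.integral_cong) (auto simp: step_def)
  also have "\<dots> = (LINT x|lborel. ?f x * avg ?g x)"
    by (intro avg_symmetric integrable_indicator_times bounded_borel_mult bounded_borel_indicator assms)
  also have "\<dots> = (LINT x|lborel. f x * step S g x)"
    by (intro Bochner_Integration.integral_cong) (auto simp: step_def)
  finally show ?thesis .
qed

lemma step_nonneg: "(\<And>x. f x \<ge> 0) \<Longrightarrow> step S f x \<ge> 0"
  unfolding step_def by (auto intro!: mult_nonneg_nonneg avg_nonneg)

lemma step_diff:
  assumes "S \<in> sets borel" "averageable f" "averageable g"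
  shows "step S (\<lambda>x. f x - g x) x = step S f x - step S g x"
  using avg_diff[OF averageable_indicator[OF assms(1,2)] averageable_indicator[OF assms(1,3)], of x]
  by (simp add: step_def right_diff_distrib)

lemma step_bound:
  assumes "S \<in> sets borel" "f \<in> borel_measurable borel" "AE x in lborel. \<bar>f x\<bar> \<le> C"
  shows "\<bar>step S f x\<bar> \<le> C"
proof -
  have "\<bar>avg (\<lambda>y. indicator S y * f y) x\<bar> \<le> C"
  proof (rule avg_bound)
    show "AE x in lborel. \<bar>indicator S x * f x\<bar> \<le> C"
      using assms(3) by eventually_elim (auto simp: indicator_def)
  qed (use assms in measurable)
  then show ?thesis by (auto simp: step_def indicator_def)
qed

lemma iter_bounded_borel: "S \<in> sets borel \<Longrightarrow> bounded_borel f \<Longrightarrow> bounded_borel ((step S ^^ n) f)"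
  by (induction n) (auto intro: step_bounded_borel)

lemma iter_integrable: "S \<in> sets borel \<Longrightarrow> integrable lborel f \<Longrightarrow> integrable lborel ((step S ^^ n) f)"
  by (induction n) (auto intro: step_integrable)

lemma iter_nonneg: "(\<And>x. f x \<ge> 0) \<Longrightarrow> (step S ^^ n) f x \<ge> 0"
  by (induction n arbitrary: x) (auto intro: step_nonneg)

lemma iter_symmetric:
  assumes "S \<in> sets borel" and "integrable lborel f" "bounded_borel g"
  shows "(LINT x|lborel. (step S ^^ n) f x * g x) = (LINT x|lborel. f x * (step S ^^ n) g x)"
  using assms(3)
proof (induction n arbitrary: g)
  case (Suc n)
  have "(LINT x|lborel. step S ((step S ^^ n) f) x * g x) = (LINT x|lborel. (step S ^^ n) f x * step S g x)"
    by (intro step_symmetric iter_integrable assms(1,2) Suc.prems)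
  then show ?case
    using Suc step_bounded_borel[OF assms(1)] by (simp add: funpow_swap1)
qed (simp)

end

section \<open>Fourier inversion\<close>

text \<open>A continuous function that is positive somewhere is positive on a ball, which is not a null set.\<close>

lemma integral_positive_of_continuous:
  fixes g :: "'a::euclidean_space \<Rightarrow> real"
  assumes g: "integrable lborel g" "\<And>x. g x \<ge> 0" "continuous_on UNIV g" "g z > 0"
  shows "(LINT x|lborel. g x) > 0"
proof -
  have "open {x. g x > 0}" using g(3) by (intro open_Collect_less) auto
  with g(4) obtain r where r: "r > 0" "ball z r \<subseteq> {x. g x > 0}"
    by (metis mem_Collect_eq openE)
  have "(LINT x|lborel. g x) \<noteq> 0"
  proof
    assume "(LINT x|lborel. g x) = 0"
    then have "AE x in lborel. g x = 0"
      using integral_nonneg_eq_0_iff_AE[OF g(1)] g(2) by simp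
    then have "AE x in lborel. x \<notin> ball z r"
      by eventually_elim (use r in auto)
    then have "emeasure lborel (ball z r) = 0"
      by (subst (asm) AE_iff_measurable[where N="ball z r"]) auto
    then show False using content_ball_pos[OF r(1), of z] by (simp add: measure_def)
  qed
  moreover have "(LINT x|lborel. g x) \<ge> 0" by (intro Bochner_Integration.integral_nonneg g)
  ultimately show ?thesis by simp
qed

lemma cos_Taylor_bound: "\<bar>1 - cos u - u\<^sup>2 / 2\<bar> \<le> u ^ 4 / 24" for u :: real
proof -
  obtain t where t: "cos u = (\<Sum>m<4. cos_coeff m * u ^ m) + (cos (t + 1/2 * real 4 * pi) / fact 4) * u ^ 4"
    using Maclaurin_cos_expansion[of u 4] by blast
  have "(\<Sum>m<4. cos_coeff m * u ^ m) = 1 - u\<^sup>2 / 2"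
  proof -
    have "{..<4::nat} = {0, 1, 2, 3}" by auto
    then show ?thesis by (simp add: cos_coeff_def fact_numeral)
  qed
  with t have "1 - cos u - u\<^sup>2 / 2 = - cos (t + 1/2 * real 4 * pi) * (u ^ 4 / 24)"
    by (simp add: fact_numeral field_simps)
  then have "\<bar>1 - cos u - u\<^sup>2 / 2\<bar> = \<bar>cos (t + 1/2 * real 4 * pi)\<bar> * \<bar>u ^ 4 / 24\<bar>"
    by (simp only: abs_mult abs_minus_cancel)
  also have "\<dots> \<le> 1 * \<bar>u ^ 4 / 24\<bar>" by (intro mult_right_mono) auto
  finally show ?thesis by simp
qed

text \<open>The upper half comes from \<open>exp v \<ge> 1 + v\<close> and \<open>1 / (1 + v) \<le> 1 - v + v\<^sup>2\<close>.\<close>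

lemma exp_Taylor_bound: "\<bar>exp (- v) - 1 + v\<bar> \<le> v\<^sup>2" if "v \<ge> 0" for v :: real
proof -
  have "exp (- v) \<le> 1 / (1 + v)"
    using exp_ge_add_one_self[of v] that by (simp add: exp_minus field_simps)
  also have "\<dots> \<le> 1 - v + v\<^sup>2"
    using that by (simp add: field_simps power2_eq_square)
  finally show ?thesis using exp_ge_add_one_self[of "-v"] by (auto simp: abs_le_iff)
qed

context jump_kernel
begin

lemma avg_continuous:
  assumes f: "integrable lborel f"
  shows "continuous_on UNIV (avg f)"
proof (subst continuous_on_sequentially, safe)
  fix s :: "nat \<Rightarrow> 'a" and x assume s: "s \<longlonglongrightarrow> x"
  have [measurable]: "f \<in> borel_measurable borel" using f by (rule integrable_borel_meas)
  have "(\<lambda>n. LINT y|lborel. J (s n - y) * f y) \<longlonglongrightarrow> (LINT y|lborel. J (x - y) * f y)"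
  proof (rule integral_dominated_convergence[where w="\<lambda>y. Jmax * \<bar>f y\<bar>"])
    show "AE y in lborel. (\<lambda>n. J (s n - y) * f y) \<longlonglongrightarrow> J (x - y) * f y"
    proof (intro AE_I2 tendsto_mult_right)
      fix y
      have "isCont J (x - y)" using J_cont by (simp add: continuous_on_eq_continuous_at)
      then show "(\<lambda>n. J (s n - y)) \<longlonglongrightarrow> J (x - y)"
        by (rule isCont_tendsto_compose) (intro tendsto_intros s)
    qed
  qed (use f J_le_Jmax J_nonneg in \<open>auto simp: abs_mult intro!: mult_right_mono integrable_mult_right\<close>)
  then show "(avg f \<circ> s) \<longlonglongrightarrow> avg f x" by (simp add: avg_def o_def)
qed

text \<open>The density of the free walk after \<open>n + 1\<close> steps.\<close>

definition kpow :: "nat \<Rightarrow> 'a \<Rightarrow> real" where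
  "kpow n = (avg ^^ n) J"

lemma kpow_0: "kpow 0 = J" and kpow_Suc: "kpow (Suc n) = avg (kpow n)"
  by (simp_all add: kpow_def)

lemma kpow_integrable: "integrable lborel (kpow n)"
  unfolding kpow_def step_UNIV[symmetric] by (intro iter_integrable J_integrable) auto

lemma kpow_bounded_borel: "bounded_borel (kpow n)"
  unfolding kpow_def step_UNIV[symmetric] by (intro iter_bounded_borel J_bounded_borel) auto

lemma kpow_nonneg: "kpow n x \<ge> 0"
  unfolding kpow_def step_UNIV[symmetric] by (intro iter_nonneg J_nonneg)

lemma kpow_continuous: "continuous_on UNIV (kpow n)"
  by (cases n) (auto simp: kpow_0 kpow_Suc J_cont intro!: avg_continuous kpow_integrable)

lemma kpow_meas[measurable]: "kpow n \<in> borel_measurable borel"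
  using kpow_bounded_borel by (rule bounded_borel_meas)

lemma avg_iterate_kernel:
  assumes f: "integrable lborel f"
  shows "(avg ^^ Suc n) f x = (LINT y|lborel. kpow n (x - y) * f y)"
proof (induction n arbitrary: x)
  case (Suc n)
  have [measurable]: "f \<in> borel_measurable borel" using f by (rule integrable_borel_meas)
  have "(avg ^^ Suc (Suc n)) f x = (LINT z|lborel. J (x - z) * (LINT y|lborel. kpow n (z - y) * f y))"
  proof -
    have "(avg ^^ Suc n) f = (\<lambda>z. LINT y|lborel. kpow n (z - y) * f y)" using Suc by auto
    then have "(avg ^^ Suc (Suc n)) f x = avg (\<lambda>z. LINT y|lborel. kpow n (z - y) * f y) x"
      by (metis comp_apply funpow.simps(2))
    then show ?thesis by (simp only: avg_def)
  qed
  also have "\<dots> = (LINT y|lborel. f y * (LINT z|lborel. kpow n (z - y) * J (x - z)))"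
    by (intro convolution_swap f kpow_integrable J_bounded_borel)
  also have "\<dots> = (LINT y|lborel. kpow (Suc n) (x - y) * f y)"
  proof (intro Bochner_Integration.integral_cong refl)
    fix y
    have "(LINT z|lborel. kpow n (z - y) * J (x - z)) = (LINT z|lborel. kpow n z * J (x - y - z))"
      using lborel_integral_translate[of "\<lambda>z. kpow n z * J (x - y - z)" y] by (simp add: algebra_simps)
    then show "f y * (LINT z|lborel. kpow n (z - y) * J (x - z)) = kpow (Suc n) (x - y) * f y"
      by (simp add: kpow_Suc avg_def mult.commute)
  qed
  finally show ?case .
qed (simp add: kpow_0 avg_def)

text \<open>The characteristic function of \<open>J\<close>; it is real because \<open>J\<close> is even.\<close>

definition Jhat :: "'a \<Rightarrow> real" where
  "Jhat \<xi> = (LINT x|lborel. J x * cos (\<xi> \<bullet> x))"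

lemma cos_bounded_borel: "bounded_borel (\<lambda>x::'a. cos (\<xi> \<bullet> (x - z)))"
  by (rule bounded_borelI[where C=1]) auto

lemma J_cos_integrable: "integrable lborel (\<lambda>x. J x * cos (\<xi> \<bullet> (x - z)))"
  by (rule integrable_mult_bounded[OF J_integrable cos_bounded_borel])

lemma Jhat_abs_le_1: "\<bar>Jhat \<xi>\<bar> \<le> 1"
  unfolding Jhat_def
  using integral_mult_bounded_le[OF J_integrable, of "\<lambda>x. cos (\<xi> \<bullet> x)" 1] by (simp add: J_nonneg J_mass)

lemma J_cos_translate: "(LINT x|lborel. J x * cos (\<xi> \<bullet> (x - z))) = Jhat \<xi> * cos (\<xi> \<bullet> z)"
proof -
  have c: "integrable lborel (\<lambda>x. J x * cos (\<xi> \<bullet> x))" using J_cos_integrable[of \<xi> 0] by simp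
  have s: "integrable lborel (\<lambda>x. J x * sin (\<xi> \<bullet> x))"
    by (rule integrable_mult_bounded[OF J_integrable]) (rule bounded_borelI[where C=1], auto)
  have odd: "(LINT x|lborel. J x * sin (\<xi> \<bullet> x)) = 0"
    using lborel_integral_reflect[of "\<lambda>x. J x * sin (\<xi> \<bullet> x)" 0] by (simp add: J_even)
  have "(LINT x|lborel. J x * cos (\<xi> \<bullet> (x - z)))
      = (LINT x|lborel. (J x * cos (\<xi> \<bullet> x)) * cos (\<xi> \<bullet> z) + (J x * sin (\<xi> \<bullet> x)) * sin (\<xi> \<bullet> z))"
    by (simp add: inner_diff_right cos_diff algebra_simps)
  also have "\<dots> = Jhat \<xi> * cos (\<xi> \<bullet> z)"
    using c s by (simp add: Jhat_def odd)
  finally show ?thesis .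
qed

text \<open>Fourier transform of the translated convolution powers.  Carrying the translation along keeps the
  induction real-valued: the sine part drops out because \<open>J\<close> is even, one step at a time.\<close>

lemma kpow_cos_translate: "(LINT x|lborel. kpow n x * cos (\<xi> \<bullet> (x - z))) = Jhat \<xi> ^ Suc n * cos (\<xi> \<bullet> z)"
proof (induction n)
  case (Suc n)
  have "(LINT x|lborel. kpow (Suc n) x * cos (\<xi> \<bullet> (x - z))) =
      (LINT x|lborel. cos (\<xi> \<bullet> (x - z)) * (LINT y|lborel. J (x - y) * kpow n y))"
    by (simp add: kpow_Suc avg_def mult.commute)
  also have "\<dots> = (LINT y|lborel. kpow n y * (LINT x|lborel. J (x - y) * cos (\<xi> \<bullet> (x - z))))"
    by (intro convolution_swap kpow_integrable J_integrable cos_bounded_borel)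
  also have "\<dots> = (LINT y|lborel. kpow n y * (Jhat \<xi> * cos (\<xi> \<bullet> (y - z))))"
  proof (intro Bochner_Integration.integral_cong refl)
    fix y
    have "(LINT x|lborel. J (x - y) * cos (\<xi> \<bullet> (x - z))) = (LINT x|lborel. J x * cos (\<xi> \<bullet> (x - (z - y))))"
      using lborel_integral_translate[of "\<lambda>x. J x * cos (\<xi> \<bullet> (x - (z - y)))" y] by (simp add: algebra_simps)
    also have "\<dots> = Jhat \<xi> * cos (\<xi> \<bullet> (y - z))"
      by (subst J_cos_translate) (metis cos_minus inner_minus_right minus_diff_eq)
    finally show "kpow n y * (LINT x|lborel. J (x - y) * cos (\<xi> \<bullet> (x - z))) = kpow n y * (Jhat \<xi> * cos (\<xi> \<bullet> (y - z)))"
      by simp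
  qed
  also have "\<dots> = Jhat \<xi> * (LINT y|lborel. kpow n y * cos (\<xi> \<bullet> (y - z)))"
    by (simp add: mult_ac flip: integral_mult_right_zero)
  finally show ?case using Suc by simp
qed (simp add: kpow_0 J_cos_translate)

lemma Jhat_continuous: "continuous_on UNIV Jhat"
proof (subst continuous_on_sequentially, safe)
  fix s :: "nat \<Rightarrow> 'a" and x assume s: "s \<longlonglongrightarrow> x"
  have "(\<lambda>n. LINT y|lborel. J y * cos (s n \<bullet> y)) \<longlonglongrightarrow> (LINT y|lborel. J y * cos (x \<bullet> y))"
    by (rule integral_dominated_convergence[where w=J])
       (auto simp: abs_mult J_nonneg J_integrable intro!: AE_I2 tendsto_intros s mult_left_le)
  then show "(Jhat \<circ> s) \<longlonglongrightarrow> Jhat x" by (simp add: Jhat_def[abs_def] o_def)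
qed

lemma Jhat_meas[measurable]: "Jhat \<in> borel_measurable borel"
  using Jhat_continuous by (rule borel_measurable_continuous_onI)

text \<open>Fourier inversion with a Gaussian factor: Fubini turns the left-hand side into a mollification of
  the density at \<open>z\<close>.\<close>

lemma regularized_inversion:
  assumes "a > 0"
  shows "(LINT \<xi>|lborel. exp (- a * (norm \<xi>)\<^sup>2) * (Jhat \<xi> ^ Suc n * cos (\<xi> \<bullet> z)))
      = (pi / a) powr (real DIM('a) / 2) * (LINT x|lborel. kpow n x * exp (- (norm (x - z))\<^sup>2 / (4 * a)))"
proof -
  let ?g = "\<lambda>\<xi>::'a. exp (- a * (norm \<xi>)\<^sup>2)"
  have g: "integrable lborel ?g" by (rule gaussian_integral[OF assms])
  have kc: "integrable lborel (\<lambda>x. kpow n x * cos (\<xi> \<bullet> (x - z)))" for \<xi>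
    by (rule integrable_mult_bounded[OF kpow_integrable cos_bounded_borel])
  have P: "integrable (lborel \<Otimes>\<^sub>M lborel) (\<lambda>(\<xi>, x). ?g \<xi> * (kpow n x * cos (\<xi> \<bullet> (x - z))))"
  proof (rule lborel_pair.Fubini_integrable)
    have bd: "\<bar>LINT x|lborel. \<bar>kpow n x * cos (\<xi> \<bullet> (x - z))\<bar>\<bar> \<le> (LINT x|lborel. kpow n x)" for \<xi>
    proof -
      have "(LINT x|lborel. \<bar>kpow n x * cos (\<xi> \<bullet> (x - z))\<bar>) \<le> (LINT x|lborel. kpow n x)"
        by (intro integral_mono integrable_abs kc kpow_integrable)
           (auto simp: abs_mult kpow_nonneg intro!: mult_left_le)
      moreover have "(LINT x|lborel. \<bar>kpow n x * cos (\<xi> \<bullet> (x - z))\<bar>) \<ge> 0" by simp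
      ultimately show ?thesis by linarith
    qed
    have "bounded_borel (\<lambda>\<xi>. LINT x|lborel. \<bar>kpow n x * cos (\<xi> \<bullet> (x - z))\<bar>)"
      by (rule bounded_borelI[OF _ bd]) measurable
    from integrable_mult_bounded[OF g this]
    show "integrable lborel (\<lambda>\<xi>. LINT x|lborel. norm (case (\<xi>, x) of (\<xi>, x) \<Rightarrow> ?g \<xi> * (kpow n x * cos (\<xi> \<bullet> (x - z)))))"
      by (simp add: abs_mult)
    show "AE \<xi> in lborel. integrable lborel (\<lambda>x. case (\<xi>, x) of (\<xi>, x) \<Rightarrow> ?g \<xi> * (kpow n x * cos (\<xi> \<bullet> (x - z))))"
      using kc by (auto intro!: AE_I2)
  qed measurable
  have "(LINT \<xi>|lborel. ?g \<xi> * (Jhat \<xi> ^ Suc n * cos (\<xi> \<bullet> z))) =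
      (LINT \<xi>|lborel. LINT x|lborel. ?g \<xi> * (kpow n x * cos (\<xi> \<bullet> (x - z))))"
    using kpow_cos_translate[of n _ z] by simp
  also have "\<dots> = (LINT x|lborel. LINT \<xi>|lborel. ?g \<xi> * (kpow n x * cos (\<xi> \<bullet> (x - z))))"
    using lborel_pair.Fubini_integral[OF P] by simp
  also have "\<dots> = (LINT x|lborel. kpow n x * (LINT \<xi>|lborel. ?g \<xi> * cos (\<xi> \<bullet> (x - z))))"
    by (simp add: mult_ac flip: integral_mult_right_zero)
  also have "\<dots> = (LINT x|lborel. (pi / a) powr (real DIM('a) / 2) * (kpow n x * exp (- (norm (x - z))\<^sup>2 / (4 * a))))"
    by (subst gaussian_character(2)[OF assms]) (simp add: mult_ac)
  finally show ?thesis by simp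
qed

text \<open>After the substitution \<open>x = z + 2 s w\<close> the mollification becomes an average of \<open>kpow n (z + 2 s w)\<close>
  against a fixed Gaussian, so that it converges by continuity of the density.\<close>

lemma gaussian_mollifier_limit:
  fixes s :: "nat \<Rightarrow> real"
  assumes s: "\<And>i. s i > 0" "s \<longlonglongrightarrow> 0"
  shows "(\<lambda>i. (LINT \<xi>|lborel. exp (- (s i)\<^sup>2 * (norm \<xi>)\<^sup>2) * (Jhat \<xi> ^ Suc n * cos (\<xi> \<bullet> z))))
           \<longlonglongrightarrow> (2 * pi) ^ DIM('a) * kpow n z"
proof -
  let ?P = "pi powr (real DIM('a) / 2)"
  have pi2: "?P * ?P = pi ^ DIM('a)" by (simp flip: powr_add powr_realpow)
  have eq: "(LINT \<xi>|lborel. exp (- (s i)\<^sup>2 * (norm \<xi>)\<^sup>2) * (Jhat \<xi> ^ Suc n * cos (\<xi> \<bullet> z)))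
     = 2 ^ DIM('a) * ?P * (LINT w|lborel. kpow n (z + (2 * s i) *\<^sub>R w) * exp (- (norm w)\<^sup>2))" for i
  proof -
    have e: "- (norm (z + (2 * s i) *\<^sub>R w - z))\<^sup>2 / (4 * (s i)\<^sup>2) = - (norm w)\<^sup>2" for w :: 'a
      using s(1)[of i] by (simp add: power_mult_distrib)
    have "(LINT x|lborel. kpow n x * exp (- (norm (x - z))\<^sup>2 / (4 * (s i)\<^sup>2)))
      = \<bar>2 * s i\<bar> ^ DIM('a) *\<^sub>R (LINT w|lborel. kpow n (z + (2 * s i) *\<^sub>R w) * exp (- (norm w)\<^sup>2))"
      using lborel_integral_affine[of "2 * s i" "\<lambda>x. kpow n x * exp (- (norm (x - z))\<^sup>2 / (4 * (s i)\<^sup>2))" z] s(1)[of i]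
      unfolding e by simp
    moreover have "(pi / (s i)\<^sup>2) powr (real DIM('a) / 2) * \<bar>2 * s i\<bar> ^ DIM('a) = 2 ^ DIM('a) * ?P"
    proof -
      have "((s i)\<^sup>2) powr (real DIM('a) / 2) = (s i) ^ DIM('a)"
        using powr_powr[of "s i" 2 "real DIM('a) / 2"] powr_realpow[of "s i" "DIM('a)"] s(1)[of i]
        by (simp add: powr_numeral)
      then show ?thesis using s(1)[of i] by (simp add: powr_divide power_mult_distrib)
    qed
    ultimately show ?thesis
      using regularized_inversion[of "(s i)\<^sup>2" n z] s(1)[of i] by (simp add: mult.assoc[symmetric])
  qed
  obtain C where C: "\<And>x. \<bar>kpow n x\<bar> \<le> C" using bounded_borelE[OF kpow_bounded_borel] by blast
  have "(\<lambda>i. LINT w|lborel. kpow n (z + (2 * s i) *\<^sub>R w) * exp (- (norm w)\<^sup>2)) \<longlonglongrightarrow> (LINT w|lborel. kpow n z * exp (- (norm (w::'a))\<^sup>2))"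
  proof (rule integral_dominated_convergence[where w="\<lambda>w. C * exp (- (norm w)\<^sup>2)"])
    show "integrable lborel (\<lambda>w::'a. C * exp (- (norm w)\<^sup>2))"
      using gaussian_integral(1)[of 1, where 'a='a] by simp
    show "AE w in lborel. (\<lambda>i. kpow n (z + (2 * s i) *\<^sub>R w) * exp (- (norm w)\<^sup>2)) \<longlonglongrightarrow> kpow n z * exp (- (norm w)\<^sup>2)"
    proof (intro AE_I2 tendsto_mult_right)
      fix w
      have "isCont (kpow n) z" using kpow_continuous by (simp add: continuous_on_eq_continuous_at)
      moreover have "(\<lambda>i. z + (2 * s i) *\<^sub>R w) \<longlonglongrightarrow> z + (2 * 0) *\<^sub>R w"
        by (intro tendsto_intros s)
      ultimately show "(\<lambda>i. kpow n (z + (2 * s i) *\<^sub>R w)) \<longlonglongrightarrow> kpow n z"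
        using isCont_tendsto_compose by fastforce
    qed
  qed (use C in \<open>auto simp: abs_mult intro!: mult_right_mono\<close>)
  also have "(LINT w|lborel. kpow n z * exp (- (norm (w::'a))\<^sup>2)) = kpow n z * ?P"
    using gaussian_integral(2)[of 1, where 'a='a] by simp
  finally have "(\<lambda>i. 2 ^ DIM('a) * ?P * (LINT w|lborel. kpow n (z + (2 * s i) *\<^sub>R w) * exp (- (norm w)\<^sup>2)))
     \<longlonglongrightarrow> 2 ^ DIM('a) * ?P * (kpow n z * ?P)"
    by (intro tendsto_intros)
  moreover have "2 ^ DIM('a) * ?P * (kpow n z * ?P) = (2 * pi) ^ DIM('a) * kpow n z"
    by (simp add: power_mult_distrib pi2[symmetric])
  ultimately show ?thesis unfolding eq by simp
qed

lemma gaussian_factor_limit: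
  fixes s :: "nat \<Rightarrow> real"
  assumes "s \<longlonglongrightarrow> 0"
  shows "(\<lambda>i. exp (- (s i)\<^sup>2 * a) * b) \<longlonglongrightarrow> (b :: real)"
proof -
  have "(\<lambda>i. exp (- (s i)\<^sup>2 * a) * b) \<longlonglongrightarrow> exp (- 0\<^sup>2 * a) * b" by (intro tendsto_intros assms)
  then show ?thesis by simp
qed

text \<open>The regularized integrals of the nonnegative function \<open>Jhat\<^sup>2\<close> increase to a finite limit.  Starting
  from two steps avoids any decay estimate for \<open>Jhat\<close>.\<close>

lemma Jhat_square_integrable: "integrable lborel (\<lambda>\<xi>. Jhat \<xi> ^ 2)"
proof (rule integral_monotone_convergence_nonneg(1))
  define s where "s i = 1 / real (Suc i)" for i
  have s: "s i > 0" "s \<longlonglongrightarrow> 0" for i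
    unfolding s_def by (simp, rule LIMSEQ_Suc[OF lim_1_over_n])
  let ?f = "\<lambda>i \<xi>. exp (- (s i)\<^sup>2 * (norm \<xi>)\<^sup>2) * Jhat \<xi> ^ 2"
  show "integrable lborel (?f i)" for i
  proof (rule integrable_mult_bounded)
    show "integrable lborel (\<lambda>\<xi>::'a. exp (- (s i)\<^sup>2 * (norm \<xi>)\<^sup>2))"
      by (rule gaussian_integral) (use s(1)[of i] in simp)
    show "bounded_borel (\<lambda>\<xi>. Jhat \<xi> ^ 2)"
      by (rule bounded_borelI[where C=1]) (use Jhat_abs_le_1 in \<open>auto simp: abs_square_le_1\<close>)
  qed
  show "AE \<xi> in lborel. mono (\<lambda>i. ?f i \<xi>)"
  proof (intro AE_I2 monoI mult_right_mono)
    fix \<xi> :: 'a and i j :: nat assume "i \<le> j"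
    then have "s j \<le> s i" by (simp add: s_def frac_le)
    then have "(s j)\<^sup>2 \<le> (s i)\<^sup>2" using s(1)[of j] by (intro power_mono) auto
    then show "exp (- (s i)\<^sup>2 * (norm \<xi>)\<^sup>2) \<le> exp (- (s j)\<^sup>2 * (norm \<xi>)\<^sup>2)"
      by (simp add: mult_right_mono)
  qed simp
  show "AE \<xi> in lborel. (\<lambda>i. ?f i \<xi>) \<longlonglongrightarrow> Jhat \<xi> ^ 2"
    by (intro AE_I2 gaussian_factor_limit s)
  show "(\<lambda>i. integral\<^sup>L lborel (?f i)) \<longlonglongrightarrow> (2 * pi) ^ DIM('a) * kpow 1 0"
    using gaussian_mollifier_limit[of s 1 0] s
    by (simp only: inner_zero_right cos_zero mult_1_right One_nat_def numeral_2_eq_2)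
  show "AE \<xi> in lborel. 0 \<le> ?f i \<xi>" for i by (intro AE_I2) simp
qed measurable

lemma Jhat_power_integrable:
  assumes "n \<ge> 1" shows "integrable lborel (\<lambda>\<xi>. Jhat \<xi> ^ Suc n)"
proof (rule Bochner_Integration.integrable_bound[OF Jhat_square_integrable])
  show "AE \<xi> in lborel. norm (Jhat \<xi> ^ Suc n) \<le> norm (Jhat \<xi> ^ 2)"
  proof (intro AE_I2)
    fix \<xi>
    have "\<bar>Jhat \<xi>\<bar> ^ Suc n \<le> \<bar>Jhat \<xi>\<bar> ^ 2"
      using assms Jhat_abs_le_1 by (intro power_decreasing) auto
    then show "norm (Jhat \<xi> ^ Suc n) \<le> norm (Jhat \<xi> ^ 2)" by (simp only: real_norm_def power_abs)
  qed
qed measurable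

lemma fourier_inversion:
  assumes n: "n \<ge> 1"
  shows "(LINT \<xi>|lborel. Jhat \<xi> ^ Suc n * cos (\<xi> \<bullet> z)) = (2 * pi) ^ DIM('a) * kpow n z"
proof -
  define s where "s i = 1 / real (Suc i)" for i
  have s: "s i > 0" "s \<longlonglongrightarrow> 0" for i
    unfolding s_def by (simp, rule LIMSEQ_Suc[OF lim_1_over_n])
  have "(\<lambda>i. (LINT \<xi>|lborel. exp (- (s i)\<^sup>2 * (norm \<xi>)\<^sup>2) * (Jhat \<xi> ^ Suc n * cos (\<xi> \<bullet> z))))
           \<longlonglongrightarrow> (LINT \<xi>|lborel. Jhat \<xi> ^ Suc n * cos (\<xi> \<bullet> z))"
  proof (rule integral_dominated_convergence[where w="\<lambda>\<xi>. \<bar>Jhat \<xi> ^ Suc n\<bar>"])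
    show "integrable lborel (\<lambda>\<xi>. \<bar>Jhat \<xi> ^ Suc n\<bar>)" by (intro integrable_abs Jhat_power_integrable n)
    show "AE \<xi> in lborel. (\<lambda>i. exp (- (s i)\<^sup>2 * (norm \<xi>)\<^sup>2) * (Jhat \<xi> ^ Suc n * cos (\<xi> \<bullet> z))) \<longlonglongrightarrow> Jhat \<xi> ^ Suc n * cos (\<xi> \<bullet> z)"
      by (intro AE_I2 gaussian_factor_limit s)
    show "AE \<xi> in lborel. norm (exp (- (s i)\<^sup>2 * (norm \<xi>)\<^sup>2) * (Jhat \<xi> ^ Suc n * cos (\<xi> \<bullet> z))) \<le> \<bar>Jhat \<xi> ^ Suc n\<bar>" for i
    proof (intro AE_I2)
      fix \<xi> :: 'a
      have "exp (- (s i)\<^sup>2 * (norm \<xi>)\<^sup>2) * (\<bar>Jhat \<xi> ^ Suc n\<bar> * \<bar>cos (\<xi> \<bullet> z)\<bar>) \<le> 1 * (\<bar>Jhat \<xi> ^ Suc n\<bar> * 1)"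
        by (intro mult_mono) auto
      then show "norm (exp (- (s i)\<^sup>2 * (norm \<xi>)\<^sup>2) * (Jhat \<xi> ^ Suc n * cos (\<xi> \<bullet> z))) \<le> \<bar>Jhat \<xi> ^ Suc n\<bar>"
        by (simp only: real_norm_def abs_mult abs_exp_cancel mult_1 mult_1_right)
    qed
  qed measurable
  moreover have "(\<lambda>i. (LINT \<xi>|lborel. exp (- (s i)\<^sup>2 * (norm \<xi>)\<^sup>2) * (Jhat \<xi> ^ Suc n * cos (\<xi> \<bullet> z))))
           \<longlonglongrightarrow> (2 * pi) ^ DIM('a) * kpow n z"
    using s by (rule gaussian_mollifier_limit)
  ultimately show ?thesis by (rule LIMSEQ_unique)
qed

end

section \<open>The characteristic function of the kernel\<close>

text \<open>Exchanging two coordinates maps boxes to boxes of the same volume.\<close>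

lemma lborel_distr_swap_coordinates:
  fixes b b' :: "'a::euclidean_space"
  assumes b: "b \<in> Basis" "b' \<in> Basis"
  defines "\<sigma> \<equiv> Transposition.transpose b b'"
  shows "lborel = distr lborel borel (\<lambda>x::'a. \<Sum>j\<in>Basis. (x \<bullet> \<sigma> j) *\<^sub>R j)"
proof (rule lborel_eqI)
  let ?T = "\<lambda>x::'a. \<Sum>j\<in>Basis. (x \<bullet> \<sigma> j) *\<^sub>R j"
  have \<sigma>: "\<sigma> j \<in> Basis" "\<sigma> (\<sigma> j) = j" if "j \<in> Basis" for j
    using that b by (auto simp: \<sigma>_def Transposition.transpose_def)
  have bij: "bij_betw \<sigma> Basis Basis"
    by (rule bij_betw_byWitness[where f'=\<sigma>]) (use \<sigma> in auto)
  have T: "?T x \<bullet> j = x \<bullet> \<sigma> j" if "j \<in> Basis" for x j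
    using that by simp
  fix l u :: 'a assume le: "\<And>b. b \<in> Basis \<Longrightarrow> l \<bullet> b \<le> u \<bullet> b"
  have [measurable]: "?T \<in> borel \<rightarrow>\<^sub>M borel" by measurable
  have "?T -` box l u = box (?T l) (?T u)"
    using \<sigma> by (auto simp: mem_box T) (metis \<sigma>)+
  then have "emeasure (distr lborel borel ?T) (box l u) = emeasure lborel (box (?T l) (?T u))"
    by (simp add: emeasure_distr)
  also have "\<dots> = (\<Prod>j\<in>Basis. (?T u - ?T l) \<bullet> j)"
    using le \<sigma> by (subst emeasure_lborel_box_eq) (auto simp: inner_diff_left T simp del: inner_sum_left_Basis)
  also have "(\<Prod>j\<in>Basis. (?T u - ?T l) \<bullet> j) = (\<Prod>j\<in>Basis. (u - l) \<bullet> \<sigma> j)"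
    by (intro prod.cong refl) (simp only: inner_diff_left T)
  also have "\<dots> = (\<Prod>j\<in>Basis. (u - l) \<bullet> j)"
    by (rule prod.reindex_bij_betw[OF bij])
  finally show "emeasure (distr lborel borel ?T) (box l u) = (\<Prod>j\<in>Basis. (u - l) \<bullet> j)" .
qed simp

lemma lborel_distr_reflect_coordinate:
  fixes b :: "'a::euclidean_space"
  assumes b: "b \<in> Basis"
  shows "lborel = distr lborel borel (\<lambda>x::'a. \<Sum>j\<in>Basis. ((if j = b then - 1 else 1) * (x \<bullet> j)) *\<^sub>R j)"
proof -
  have "(\<Prod>j\<in>Basis. \<bar>if j = b then - 1 else 1 :: real\<bar>) = 1"
    by (intro prod.neutral) auto
  then show ?thesis
    using lborel_affine_euclidean[of "\<lambda>j. if j = b then - 1 else 1" "0::'a"] by (simp add: density_1)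
qed

context jump_kernel
begin

lemma J_times_integrable:
  assumes [measurable]: "h \<in> borel_measurable borel" and h: "\<And>x. norm x \<le> 1 \<Longrightarrow> \<bar>h x\<bar> \<le> C"
  shows "integrable lborel (\<lambda>x. J x * h x)"
proof (rule Bochner_Integration.integrable_bound[OF integrable_mult_left[OF J_integrable, of C]])
  show "AE x in lborel. norm (J x * h x) \<le> norm (J x * C)"
  proof (intro AE_I2)
    fix x
    show "norm (J x * h x) \<le> norm (J x * C)"
    proof (cases "norm x \<le> 1")
      case True
      from h[OF this] show ?thesis by (auto simp: abs_mult intro!: mult_left_mono)
    qed (simp add: J_support)
  qed
qed measurable

text \<open>Moments of a radial density are invariant under isometries that permute the coordinates and change
  their signs; these suffice to see that its second moments are isotropic.\<close>

lemma coordinate_isometry_invariance: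
  fixes \<epsilon> :: "'a \<Rightarrow> real" and \<sigma> :: "'a \<Rightarrow> 'a"
  defines "T x \<equiv> (\<Sum>j\<in>Basis. (\<epsilon> j * (x \<bullet> \<sigma> j)) *\<^sub>R j)"
  assumes L: "lborel = distr lborel borel T" and \<sigma>: "bij_betw \<sigma> Basis Basis" and \<epsilon>: "\<And>j. (\<epsilon> j)\<^sup>2 = 1"
    and [measurable]: "h \<in> borel_measurable borel"
  shows "(LINT x|lborel. J x * h (T x)) = (LINT x|lborel. J x * h x)"
proof -
  have [measurable]: "T \<in> borel \<rightarrow>\<^sub>M borel" unfolding T_def[abs_def] by measurable
  have "(norm (T x))\<^sup>2 = (norm x)\<^sup>2" for x
  proof -
    have "(norm (T x))\<^sup>2 = (\<Sum>j\<in>Basis. (x \<bullet> \<sigma> j)\<^sup>2)"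
      by (simp add: norm_eq_sum_coords T_def power_mult_distrib \<epsilon>)
    also have "\<dots> = (\<Sum>j\<in>Basis. (x \<bullet> j)\<^sup>2)" by (rule sum.reindex_bij_betw[OF \<sigma>])
    finally show ?thesis by (simp add: norm_eq_sum_coords)
  qed
  then have "J (T x) = J x" for x by (intro J_radial) (simp add: power2_eq_iff_nonneg)
  then have "(LINT x|lborel. J x * h (T x)) = (LINT x|lborel. J (T x) * h (T x))" by simp
  also have "\<dots> = (LINT x|distr lborel borel T. J x * h x)"
    by (subst integral_distr) auto
  finally show ?thesis using L by simp
qed

text \<open>The diffusivity, as an integral over \<open>lborel\<close>.\<close>

definition \<alpha> :: real where
  "\<alpha> = 1 / (2 * real DIM('a)) * (LINT z|lborel. (norm z)\<^sup>2 * J z)"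

lemma mixed_moment_bound: "norm x \<le> 1 \<Longrightarrow> b \<in> Basis \<Longrightarrow> b' \<in> Basis \<Longrightarrow> \<bar>(x \<bullet> b) * (x \<bullet> b')\<bar> \<le> 1"
  for x :: 'a
  using Basis_le_norm[of b x] Basis_le_norm[of b' x] by (auto simp: abs_mult intro!: mult_le_one)

text \<open>Reflecting the coordinate \<open>b\<close> changes the sign of the integral.\<close>

lemma mixed_moment_zero:
  assumes "b \<in> Basis" "b' \<in> Basis" "b \<noteq> b'"
  shows "(LINT x|lborel. J x * ((x \<bullet> b) * (x \<bullet> b'))) = 0"
proof -
  have "(LINT x|lborel. J x * ((x \<bullet> b) * (x \<bullet> b'))) = (LINT x|lborel. J x * - ((x \<bullet> b) * (x \<bullet> b')))"
    using coordinate_isometry_invariance[of "\<lambda>j. if j = b then - 1 else 1" "\<lambda>j. j" "\<lambda>x. (x \<bullet> b) * (x \<bullet> b')"]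
      lborel_distr_reflect_coordinate[OF assms(1)] assms by (simp add: bij_betw_def)
  then show ?thesis by simp
qed

lemma diagonal_moment_eq:
  assumes "b \<in> Basis" "b' \<in> Basis"
  shows "(LINT x|lborel. J x * (x \<bullet> b)\<^sup>2) = (LINT x|lborel. J x * (x \<bullet> b')\<^sup>2)"
proof -
  have \<sigma>: "Transposition.transpose b b' j \<in> Basis" if "j \<in> Basis" for j
    using that assms by (auto simp: Transposition.transpose_def)
  have "bij_betw (Transposition.transpose b b') Basis Basis"
    by (rule bij_betw_byWitness[where f'="Transposition.transpose b b'"]) (use \<sigma> in auto)
  then show ?thesis
    using coordinate_isometry_invariance[of "\<lambda>_. 1" "Transposition.transpose b b'" "\<lambda>x. (x \<bullet> b')\<^sup>2"]
      lborel_distr_swap_coordinates[OF assms] assms by simp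
qed

text \<open>Isotropy: all directions share the second moment of the coordinate directions.\<close>

lemma directional_second_moment: "(LINT x|lborel. J x * (\<xi> \<bullet> x)\<^sup>2) = 2 * \<alpha> * (norm \<xi>)\<^sup>2"
proof -
  define m where "m b b' = (LINT x|lborel. J x * ((x \<bullet> b) * (x \<bullet> b')))" for b b' :: 'a
  have int: "integrable lborel (\<lambda>x. J x * ((x \<bullet> b) * (x \<bullet> b')))" if "b \<in> Basis" "b' \<in> Basis" for b b' :: 'a
    by (rule J_times_integrable[where C=1]) (use mixed_moment_bound that in auto)
  obtain b0 :: 'a where b0: "b0 \<in> Basis" using nonempty_Basis by blast
  have m: "m b b' = (if b = b' then m b0 b0 else 0)" if "b \<in> Basis" "b' \<in> Basis" for b b'
    using that mixed_moment_zero[of b b'] diagonal_moment_eq[OF b0, of b] by (simp add: m_def power2_eq_square)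
  have "2 * real DIM('a) * \<alpha> = (LINT x|lborel. (\<Sum>b\<in>Basis. J x * ((x \<bullet> b) * (x \<bullet> b))))"
    by (simp add: \<alpha>_def norm_eq_sum_coords sum_distrib_left mult.commute power2_eq_square[of "_ \<bullet> _"])
  also have "\<dots> = (\<Sum>b\<in>Basis. m b b)"
    unfolding m_def by (rule Bochner_Integration.integral_sum) (use int in auto)
  also have "\<dots> = real DIM('a) * m b0 b0" by (simp add: m)
  finally have m0: "m b0 b0 = 2 * \<alpha>" by simp
  have "(\<xi> \<bullet> x)\<^sup>2 = (\<Sum>b\<in>Basis. \<Sum>b'\<in>Basis. ((\<xi> \<bullet> b) * (\<xi> \<bullet> b')) * ((x \<bullet> b) * (x \<bullet> b')))" for x
    unfolding power2_eq_square euclidean_inner[of \<xi> x] sum_product by (simp add: mult_ac)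
  then have "(LINT x|lborel. J x * (\<xi> \<bullet> x)\<^sup>2) =
     (LINT x|lborel. (\<Sum>b\<in>Basis. \<Sum>b'\<in>Basis. ((\<xi> \<bullet> b) * (\<xi> \<bullet> b')) * (J x * ((x \<bullet> b) * (x \<bullet> b')))))"
    by (simp add: sum_distrib_left mult_ac)
  also have "\<dots> = (\<Sum>b\<in>Basis. \<Sum>b'\<in>Basis. ((\<xi> \<bullet> b) * (\<xi> \<bullet> b')) * m b b')"
    unfolding m_def
    by (subst Bochner_Integration.integral_sum, use int in \<open>auto intro!: Bochner_Integration.integrable_sum integrable_mult_right\<close>)+
  also have "\<dots> = (\<Sum>b\<in>Basis. \<Sum>b'\<in>Basis. if b = b' then (\<xi> \<bullet> b)\<^sup>2 * (2 * \<alpha>) else 0)"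
    by (intro sum.cong refl) (auto simp: m m0 power2_eq_square)
  also have "\<dots> = 2 * \<alpha> * (norm \<xi>)\<^sup>2"
    by (simp add: norm_eq_sum_coords sum_distrib_left mult.commute)
  finally show ?thesis .
qed

lemma \<alpha>_pos: "\<alpha> > 0"
proof -
  have "open {x. J x > 0}" using J_cont by (intro open_Collect_less) auto
  then obtain r where r: "r > 0" "ball 0 r \<subseteq> {x. J x > 0}" using J_zero by (metis mem_Collect_eq openE)
  obtain b :: 'a where b: "b \<in> Basis" using nonempty_Basis by blast
  have "(LINT z|lborel. J z * (norm z)\<^sup>2) > 0"
  proof (rule integral_positive_of_continuous)
    show "integrable lborel (\<lambda>z. J z * (norm z)\<^sup>2)"
      by (rule J_times_integrable[where C=1]) (auto simp: abs_square_le_1)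
    show "J ((r/2) *\<^sub>R b) * (norm ((r/2) *\<^sub>R b))\<^sup>2 > 0"
      using r b by (auto intro!: mult_pos_pos simp: subset_iff)
  qed (auto simp: J_nonneg intro!: continuous_intros J_cont)
  then show ?thesis by (simp add: \<alpha>_def mult.commute)
qed

lemma Jhat_Taylor: "\<bar>1 - Jhat \<xi> - \<alpha> * (norm \<xi>)\<^sup>2\<bar> \<le> norm \<xi> ^ 4 / 24"
proof -
  have ix: "\<bar>\<xi> \<bullet> x\<bar> \<le> norm \<xi>" if "norm x \<le> 1" for x
    using Cauchy_Schwarz_ineq2[of \<xi> x] mult_left_mono[OF that norm_ge_zero[of \<xi>]] by simp
  have c: "integrable lborel (\<lambda>x. J x * cos (\<xi> \<bullet> x))" using J_cos_integrable[of \<xi> 0] by simp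
  have q: "integrable lborel (\<lambda>x. J x * (\<xi> \<bullet> x)\<^sup>2)"
    by (rule J_times_integrable[where C="(norm \<xi>)\<^sup>2"]) (use ix in \<open>auto simp: abs_le_square_iff[symmetric]\<close>)
  have "1 - Jhat \<xi> - \<alpha> * (norm \<xi>)\<^sup>2 = (LINT x|lborel. J x - J x * cos (\<xi> \<bullet> x) - J x * (\<xi> \<bullet> x)\<^sup>2 / 2)"
    using c q J_integrable by (simp add: J_mass Jhat_def directional_second_moment)
  also have "\<bar>\<dots>\<bar> \<le> (LINT x|lborel. \<bar>J x - J x * cos (\<xi> \<bullet> x) - J x * (\<xi> \<bullet> x)\<^sup>2 / 2\<bar>)"
    by (rule integral_abs_bound)
  also have "\<dots> \<le> (LINT x|lborel. J x * (norm \<xi> ^ 4 / 24))"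
  proof (intro integral_mono integrable_abs)
    fix x
    show "\<bar>J x - J x * cos (\<xi> \<bullet> x) - J x * (\<xi> \<bullet> x)\<^sup>2 / 2\<bar> \<le> J x * (norm \<xi> ^ 4 / 24)"
    proof (cases "norm x \<le> 1")
      case True
      have "\<bar>J x - J x * cos (\<xi> \<bullet> x) - J x * (\<xi> \<bullet> x)\<^sup>2 / 2\<bar> = J x * \<bar>1 - cos (\<xi> \<bullet> x) - (\<xi> \<bullet> x)\<^sup>2 / 2\<bar>"
        using J_nonneg[of x] by (subst abs_of_nonneg[OF J_nonneg, symmetric], unfold abs_mult[symmetric]) (simp add: algebra_simps)
      also have "\<dots> \<le> J x * ((\<xi> \<bullet> x) ^ 4 / 24)"
        by (intro mult_left_mono cos_Taylor_bound J_nonneg)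
      also have "(\<xi> \<bullet> x) ^ 4 \<le> norm \<xi> ^ 4"
        using power_mono[OF ix[OF True] abs_ge_zero, of 4] by (simp add: power_even_abs)
      then have "J x * ((\<xi> \<bullet> x) ^ 4 / 24) \<le> J x * (norm \<xi> ^ 4 / 24)"
        by (intro mult_left_mono J_nonneg) auto
      finally show ?thesis .
    qed (simp add: J_support)
  qed (use c q J_integrable in auto)
  finally show ?thesis by (simp add: J_mass)
qed

text \<open>The radius makes \<open>norm \<xi> ^ 4 / 24\<close> at most half of the quadratic term, and keeps \<open>Jhat \<xi>\<close>
  nonnegative so that the bound holds for the absolute value.\<close>

lemma Jhat_gaussian_bound: "\<exists>r>0. \<forall>\<xi>. norm \<xi> \<le> r \<longrightarrow> \<bar>Jhat \<xi>\<bar> \<le> exp (- (\<alpha> / 2) * (norm \<xi>)\<^sup>2)"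
proof (intro exI[of _ "sqrt (min (12 * \<alpha>) (2 / (3 * \<alpha>)))"] conjI allI impI)
  show "sqrt (min (12 * \<alpha>) (2 / (3 * \<alpha>))) > 0" using \<alpha>_pos by simp
  fix \<xi> :: 'a assume "norm \<xi> \<le> sqrt (min (12 * \<alpha>) (2 / (3 * \<alpha>)))"
  then have "(norm \<xi>)\<^sup>2 \<le> (sqrt (min (12 * \<alpha>) (2 / (3 * \<alpha>))))\<^sup>2" by (intro power_mono) auto
  also have "\<dots> = min (12 * \<alpha>) (2 / (3 * \<alpha>))" using \<alpha>_pos by (intro real_sqrt_pow2) auto
  finally have le: "(norm \<xi>)\<^sup>2 \<le> 12 * \<alpha>" "(norm \<xi>)\<^sup>2 * (3 * \<alpha>) \<le> 2"
    using \<alpha>_pos by (auto simp: pos_le_divide_eq)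
  have "norm \<xi> ^ 4 = (norm \<xi>)\<^sup>2 * (norm \<xi>)\<^sup>2" by (simp add: power_mult_distrib flip: power_add)
  also have "\<dots> \<le> 12 * \<alpha> * (norm \<xi>)\<^sup>2" using le(1) by (intro mult_right_mono) auto
  finally have "norm \<xi> ^ 4 / 24 \<le> \<alpha> / 2 * (norm \<xi>)\<^sup>2" by simp
  with Jhat_Taylor[of \<xi>] have "\<bar>1 - Jhat \<xi> - \<alpha> * (norm \<xi>)\<^sup>2\<bar> \<le> \<alpha> / 2 * (norm \<xi>)\<^sup>2" by linarith
  moreover have "3 / 2 * (\<alpha> * (norm \<xi>)\<^sup>2) \<le> 1" using le(2) by (simp add: mult_ac)
  ultimately have "0 \<le> Jhat \<xi>" "Jhat \<xi> \<le> 1 - \<alpha> / 2 * (norm \<xi>)\<^sup>2"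
    unfolding abs_le_iff by (simp_all add: field_simps)
  moreover have "1 - \<alpha> / 2 * (norm \<xi>)\<^sup>2 \<le> exp (- (\<alpha> / 2) * (norm \<xi>)\<^sup>2)"
    using exp_ge_add_one_self[of "- (\<alpha> / 2) * (norm \<xi>)\<^sup>2"] by simp
  ultimately show "\<bar>Jhat \<xi>\<bar> \<le> exp (- (\<alpha> / 2) * (norm \<xi>)\<^sup>2)" by simp
qed

text \<open>Near the origin \<open>J\<close> is positive, and there \<open>cos (\<xi> \<bullet> x)\<close> is neither constantly 1 nor constantly
  \<open>-1\<close>.\<close>

lemma Jhat_abs_less_1:
  assumes "\<xi> \<noteq> 0" shows "\<bar>Jhat \<xi>\<bar> < 1"
proof -
  have c: "integrable lborel (\<lambda>x. J x * cos (\<xi> \<bullet> x))" using J_cos_integrable[of \<xi> 0] by simp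
  have "open {x. J x > 0}" using J_cont by (intro open_Collect_less) auto
  then obtain r where r: "r > 0" "ball 0 r \<subseteq> {x. J x > 0}" using J_zero by (metis mem_Collect_eq openE)
  \<comment> \<open>At \<open>s *\<^sub>R \<xi>\<close> the kernel is positive and the angle \<open>s * (norm \<xi>)\<^sup>2\<close> lies in the interval (0, 1].\<close>
  define s where "s = min (r / 2 / norm \<xi>) (1 / (norm \<xi>)\<^sup>2)"
  have s: "s > 0" using assms r(1) by (simp add: s_def)
  have "s * norm \<xi> \<le> r / 2 / norm \<xi> * norm \<xi>" by (intro mult_right_mono) (auto simp: s_def)
  then have s2: "s * norm \<xi> < r" using assms r(1) by simp
  have "s * (norm \<xi>)\<^sup>2 \<le> 1 / (norm \<xi>)\<^sup>2 * (norm \<xi>)\<^sup>2" by (intro mult_right_mono) (auto simp: s_def)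
  then have s3: "s * (norm \<xi>)\<^sup>2 \<le> 1" using assms by simp
  have "0 < (LINT x|lborel. J x - J x * cos (\<xi> \<bullet> x))"
  proof (rule integral_positive_of_continuous)
    have "J (s *\<^sub>R \<xi>) > 0" using r(2) s s2 by (auto simp: subset_iff)
    moreover have "cos (\<xi> \<bullet> (s *\<^sub>R \<xi>)) < 1"
      using cos_monotone_0_pi[of 0 "s * (norm \<xi>)\<^sup>2"] s s3 assms pi_gt3
      by (simp add: power2_norm_eq_inner)
    ultimately show "J (s *\<^sub>R \<xi>) - J (s *\<^sub>R \<xi>) * cos (\<xi> \<bullet> (s *\<^sub>R \<xi>)) > 0" by simp
    show "0 \<le> J x - J x * cos (\<xi> \<bullet> x)" for x
      using mult_left_mono[OF cos_le_one J_nonneg, of x "\<xi> \<bullet> x"] by simp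
  qed (use c J_integrable J_cont in \<open>auto intro!: continuous_intros\<close>)
  moreover have "0 < (LINT x|lborel. J x + J x * cos (\<xi> \<bullet> x))"
  proof (rule integral_positive_of_continuous)
    show "0 < J 0 + J 0 * cos (\<xi> \<bullet> 0)" using J_zero by simp
    show "0 \<le> J x + J x * cos (\<xi> \<bullet> x)" for x
      using mult_left_mono[OF cos_ge_minus_one J_nonneg, of x "\<xi> \<bullet> x"] by simp
  qed (use c J_integrable J_cont in \<open>auto intro!: continuous_intros\<close>)
  ultimately show ?thesis using c J_integrable by (simp add: J_mass Jhat_def[symmetric] abs_less_iff)
qed

text \<open>The Riemann-Lebesgue lemma by a half-period shift: translating by \<open>\<tau>\<close> with \<open>\<xi> \<bullet> \<tau> = \<pi>\<close> changes
  the sign of the cosine, so \<open>2 Jhat \<xi>\<close> is the integral of \<open>(J x - J (x - \<tau>)) cos (\<xi> \<bullet> x)\<close>, and \<open>\<tau>\<close>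
  is short when \<open>\<xi>\<close> is long.\<close>

lemma Jhat_half_beyond: "\<exists>R>0. \<forall>\<xi>. norm \<xi> \<ge> R \<longrightarrow> \<bar>Jhat \<xi>\<bar> \<le> 1 / 2"
proof -
  \<comment> \<open>Both \<open>J x\<close> and \<open>J (x - \<tau>)\<close> vanish for \<open>norm x > 2\<close>, so \<open>V\<close> is the volume of the domain of integration.\<close>
  define V where "V = measure lborel (cball (0::'a) 2)"
  have V: "V \<ge> 0" by (simp add: V_def)
  have "uniformly_continuous_on (cball 0 3) J"
    by (intro compact_uniformly_continuous continuous_on_subset[OF J_cont]) auto
  then obtain \<delta> where \<delta>: "\<delta> > 0" "\<And>x y. x \<in> cball 0 3 \<Longrightarrow> y \<in> cball 0 3 \<Longrightarrow> dist x y < \<delta> \<Longrightarrow> dist (J x) (J y) < 1 / (V + 1)"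
    unfolding uniformly_continuous_on_def using V by (metis add_nonneg_pos zero_less_divide_1_iff zero_less_one)
  define d where "d = min \<delta> 1"
  have d: "d > 0" "d \<le> 1" "d \<le> \<delta>" using \<delta> by (auto simp: d_def)
  show ?thesis
  proof (intro exI[of _ "2 * pi / d"] conjI allI impI)
    show "2 * pi / d > 0" using d by simp
    fix \<xi> :: 'a assume n: "2 * pi / d \<le> norm \<xi>"
    then have pos: "norm \<xi> > 0" using d by (metis divide_pos_pos less_le_trans mult_pos_pos pi_gt_zero zero_less_numeral)
    define \<tau> where "\<tau> = (pi / (norm \<xi>)\<^sup>2) *\<^sub>R \<xi>"
    have \<tau>1: "\<xi> \<bullet> \<tau> = pi" using pos by (simp add: \<tau>_def flip: power2_norm_eq_inner)
    have "norm \<tau> = pi / norm \<xi>" using pos by (simp add: \<tau>_def power2_eq_square)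
    also have "\<dots> < d"
    proof -
      have "2 * pi \<le> d * norm \<xi>" using n d by (simp add: pos_divide_le_eq mult.commute)
      then have "pi < d * norm \<xi>" using pi_gt_zero by linarith
      then show ?thesis using pos by (simp add: pos_divide_less_eq)
    qed
    finally have \<tau>2: "norm \<tau> < d" .
    have c: "integrable lborel (\<lambda>x. J x * cos (\<xi> \<bullet> x))" using J_cos_integrable[of \<xi> 0] by simp
    have c2: "integrable lborel (\<lambda>x. J (x - \<tau>) * cos (\<xi> \<bullet> (x - \<tau>)))"
      using c by (subst lborel_integrable_translate_iff[of "\<lambda>x. J x * cos (\<xi> \<bullet> x)"]) auto
    have "Jhat \<xi> = (LINT x|lborel. J (x - \<tau>) * cos (\<xi> \<bullet> (x - \<tau>)))"
      unfolding Jhat_def by (subst lborel_integral_translate[of "\<lambda>x. J x * cos (\<xi> \<bullet> x)"]) auto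
    then have "2 * Jhat \<xi> = (LINT x|lborel. J x * cos (\<xi> \<bullet> x) + J (x - \<tau>) * cos (\<xi> \<bullet> (x - \<tau>)))"
      using c c2 by (simp add: Jhat_def)
    also have "\<dots> = (LINT x|lborel. (J x - J (x - \<tau>)) * cos (\<xi> \<bullet> x))"
      by (simp add: inner_diff_right \<tau>1 cos_diff algebra_simps)
    also have "\<bar>\<dots>\<bar> \<le> (LINT x|lborel. \<bar>(J x - J (x - \<tau>)) * cos (\<xi> \<bullet> x)\<bar>)"
      by (rule integral_abs_bound)
    also have "\<dots> \<le> (LINT x|lborel. indicator (cball (0::'a) 2) x * (1 / (V + 1)))"
    proof (rule integral_mono_AE)
      have "integrable lborel (\<lambda>x. J x * cos (\<xi> \<bullet> x) + J (x - \<tau>) * cos (\<xi> \<bullet> (x - \<tau>)))" using c c2 by simp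
      then show "integrable lborel (\<lambda>x. \<bar>(J x - J (x - \<tau>)) * cos (\<xi> \<bullet> x)\<bar>)"
        by (intro integrable_abs) (simp add: inner_diff_right \<tau>1 cos_diff algebra_simps)
      show "integrable lborel (\<lambda>x::'a. indicator (cball (0::'a) 2) x * (1 / (V + 1)))"
        using emeasure_compact_finite[of "cball (0::'a) 2"]
        by (intro integrable_mult_left integrable_real_indicator) (auto simp: infinity_ennreal_def)
      show "AE x in lborel. \<bar>(J x - J (x - \<tau>)) * cos (\<xi> \<bullet> x)\<bar> \<le> indicator (cball (0::'a) 2) x * (1 / (V + 1))"
      proof (intro AE_I2)
        fix x :: 'a
        have "\<bar>(J x - J (x - \<tau>)) * cos (\<xi> \<bullet> x)\<bar> \<le> \<bar>J x - J (x - \<tau>)\<bar>"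
          by (auto simp: abs_mult intro!: mult_left_le)
        also have "\<dots> \<le> indicator (cball (0::'a) 2) x * (1 / (V + 1))"
        proof (cases "norm x \<le> 2")
          case True
          have "norm (x - \<tau>) \<le> 3" using norm_triangle_ineq4[of x \<tau>] True \<tau>2 d by simp
          then have "dist (J x) (J (x - \<tau>)) < 1 / (V + 1)"
            using True \<tau>2 d by (intro \<delta>(2)) (auto simp: dist_norm norm_minus_commute)
          then show ?thesis using True by (simp add: dist_real_def)
        next
          case False
          have "norm (x - \<tau>) > 1" using norm_triangle_ineq2[of x \<tau>] False \<tau>2 d by simp
          then show ?thesis using False by (simp add: J_support)
        qed
        finally show "\<bar>(J x - J (x - \<tau>)) * cos (\<xi> \<bullet> x)\<bar> \<le> indicator (cball (0::'a) 2) x * (1 / (V + 1))" .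
      qed
    qed
    also have "\<dots> = V / (V + 1)" by (simp add: V_def)
    also have "\<dots> \<le> 1" using V by simp
    finally show "\<bar>Jhat \<xi>\<bar> \<le> 1 / 2" by simp
  qed
qed

text \<open>This excludes periodicity of the walk: beyond a large ball by the Riemann-Lebesgue bound, and on
  the remaining compact shell by continuity.\<close>

lemma Jhat_bounded_away:
  assumes "r > 0"
  obtains q where "0 < q" "q < 1" "\<And>\<xi>. norm \<xi> \<ge> r \<Longrightarrow> \<bar>Jhat \<xi>\<bar> \<le> q"
proof -
  obtain R where R: "R > 0" "\<And>\<xi>. norm \<xi> \<ge> R \<Longrightarrow> \<bar>Jhat \<xi>\<bar> \<le> 1 / 2" using Jhat_half_beyond by blast
  define S where "S = cball (0::'a) R - ball 0 r"
  have "compact S" unfolding S_def by (intro compact_diff) auto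
  have "\<exists>q. q < 1 \<and> (\<forall>\<xi>\<in>S. \<bar>Jhat \<xi>\<bar> \<le> q)"
  proof (cases "S = {}")
    case False
    have "continuous_on S (\<lambda>\<xi>. \<bar>Jhat \<xi>\<bar>)"
      by (intro continuous_intros continuous_on_subset[OF Jhat_continuous]) auto
    from continuous_attains_sup[OF \<open>compact S\<close> False this]
    obtain x where "x \<in> S" "\<forall>\<xi>\<in>S. \<bar>Jhat \<xi>\<bar> \<le> \<bar>Jhat x\<bar>" by blast
    moreover have "\<bar>Jhat x\<bar> < 1" using \<open>x \<in> S\<close> assms by (intro Jhat_abs_less_1) (auto simp: S_def)
    ultimately show ?thesis by blast
  qed (auto intro: exI[of _ 0])
  then obtain q where q: "q < 1" "\<And>\<xi>. \<xi> \<in> S \<Longrightarrow> \<bar>Jhat \<xi>\<bar> \<le> q" by blast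
  show thesis
  proof (rule that[of "max q (1/2)"])
    fix \<xi> :: 'a assume "norm \<xi> \<ge> r"
    then show "\<bar>Jhat \<xi>\<bar> \<le> max q (1/2)"
      using R(2)[of \<xi>] q(2)[of \<xi>] by (cases "norm \<xi> \<ge> R") (auto simp: S_def le_max_iff_disj)
  qed (use q in auto)
qed

section \<open>The local limit theorem\<close>

text \<open>The characteristic function of the walk after \<open>m\<close> steps, in units of \<open>\<surd>m\<close>.\<close>

definition rescaled_char :: "nat \<Rightarrow> 'a \<Rightarrow> real" where
  "rescaled_char m \<eta> = Jhat ((1 / sqrt (real m)) *\<^sub>R \<eta>) ^ m"

text \<open>The \<open>L\<^sup>1\<close> distance between the rescaled characteristic function and its Gaussian limit.  It bounds
  the error of the local limit theorem simultaneously at all points.\<close>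

definition llt_error :: "nat \<Rightarrow> real" where
  "llt_error m = (LINT \<eta>|lborel. \<bar>rescaled_char m \<eta> - exp (- \<alpha> * (norm (\<eta>::'a))\<^sup>2)\<bar>)"

lemma rescaled_char_meas[measurable]: "rescaled_char m \<in> borel_measurable borel"
  unfolding rescaled_char_def[abs_def] by measurable

lemma sqrt_rescale:
  fixes f :: "'a \<Rightarrow> real"
  assumes "m > 0" "f \<in> borel_measurable borel"
  shows "sqrt (real m) ^ DIM('a) * integral\<^sup>L lborel f = (LINT \<eta>|lborel. f ((1 / sqrt (real m)) *\<^sub>R \<eta>))"
  using lborel_integral_affine[of "1 / sqrt (real m)" f 0] assms by (simp add: power_divide)

lemma rescaled_char_integrable:
  assumes "m \<ge> 2" shows "integrable lborel (rescaled_char m)"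
proof -
  from assms have "integrable lborel (\<lambda>\<xi>. Jhat \<xi> ^ m)"
    using Jhat_power_integrable[of "m - 1"] by simp
  then show ?thesis
    using lborel_integrable_affine_iff[of "1 / sqrt (real m)" "\<lambda>\<xi>. Jhat \<xi> ^ m" 0] assms
    by (simp add: rescaled_char_def[abs_def])
qed

text \<open>Both \<open>Jhat \<xi>\<close> and \<open>exp (- \<alpha> |\<xi>|\<^sup>2)\<close> equal \<open>1 - \<alpha> |\<xi>|\<^sup>2\<close> up to \<open>O(|\<xi>|\<^sup>4)\<close>, which is \<open>O(1 / m\<^sup>2)\<close> at
  \<open>\<xi> = \<eta> / \<surd>m\<close>; taking the \<open>m\<close>-th power of numbers in the unit interval costs a factor \<open>m\<close>.\<close>

lemma rescaled_char_limit: "(\<lambda>m. rescaled_char m \<eta>) \<longlonglongrightarrow> exp (- \<alpha> * (norm \<eta>)\<^sup>2)"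
proof -
  define c where "c = norm \<eta> ^ 4 / 24 + (\<alpha> * (norm \<eta>)\<^sup>2)\<^sup>2"
  have "\<bar>rescaled_char m \<eta> - exp (- \<alpha> * (norm \<eta>)\<^sup>2)\<bar> \<le> c / real m" if m: "m > 0" for m
  proof -
    define \<xi> where "\<xi> = (1 / sqrt (real m)) *\<^sub>R \<eta>"
    define v where "v = \<alpha> * (norm \<xi>)\<^sup>2"
    have n2: "(norm \<xi>)\<^sup>2 = (norm \<eta>)\<^sup>2 / m" using m by (simp add: \<xi>_def power_divide)
    have n4: "norm \<xi> ^ 4 = norm \<eta> ^ 4 / (real m)\<^sup>2"
      using arg_cong[OF n2, of "\<lambda>x. x\<^sup>2"] by (simp add: power_divide flip: power_mult)
    have v: "v \<ge> 0" using \<alpha>_pos by (simp add: v_def)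
    have v2: "v\<^sup>2 = (\<alpha> * (norm \<eta>)\<^sup>2)\<^sup>2 / (real m)\<^sup>2"
      by (simp add: v_def n2 power_mult_distrib power_divide)
    have mv: "real m * - v = - \<alpha> * (norm \<eta>)\<^sup>2" using m by (simp add: v_def n2)
    have e: "exp (- v) ^ m = exp (- \<alpha> * (norm \<eta>)\<^sup>2)"
      unfolding mv[symmetric] by (rule exp_of_nat_mult[symmetric])
    have "\<bar>Jhat \<xi> - exp (- v)\<bar> \<le> \<bar>1 - Jhat \<xi> - v\<bar> + \<bar>exp (- v) - 1 + v\<bar>" by simp
    also have "\<dots> \<le> norm \<xi> ^ 4 / 24 + v\<^sup>2"
      using Jhat_Taylor[of \<xi>] exp_Taylor_bound[OF v] by (intro add_mono) (simp_all add: v_def)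
    also have "\<dots> = c / (real m)\<^sup>2" by (simp add: c_def n4 v2 add_divide_distrib)
    finally have d: "\<bar>Jhat \<xi> - exp (- v)\<bar> \<le> c / (real m)\<^sup>2" .
    have "\<bar>rescaled_char m \<eta> - exp (- \<alpha> * (norm \<eta>)\<^sup>2)\<bar> = \<bar>Jhat \<xi> ^ m - exp (- v) ^ m\<bar>"
      by (simp add: rescaled_char_def \<xi>_def e)
    also have "\<dots> \<le> m * \<bar>Jhat \<xi> - exp (- v)\<bar>"
      using norm_power_diff[of "Jhat \<xi>" "exp (- v)" m] Jhat_abs_le_1 v by simp
    also have "\<dots> \<le> m * (c / (real m)\<^sup>2)" by (intro mult_left_mono d) simp
    also have "\<dots> = c / real m" using m by (simp add: power2_eq_square)
    finally show ?thesis .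
  qed
  then have "\<forall>\<^sub>F m in sequentially. norm (rescaled_char m \<eta> - exp (- \<alpha> * (norm \<eta>)\<^sup>2)) \<le> c / real m"
    by (intro eventually_mono[OF eventually_gt_at_top[of 0]]) simp
  then have "(\<lambda>m. rescaled_char m \<eta> - exp (- \<alpha> * (norm \<eta>)\<^sup>2)) \<longlonglongrightarrow> 0"
    by (rule Lim_null_comparison) (rule lim_const_over_n)
  then show ?thesis by (simp add: LIM_zero_iff)
qed

lemma geometric_beats_power:
  fixes q :: real assumes "0 < q" "q < 1"
  shows "(\<lambda>n. sqrt (real n) ^ k * q ^ (n - 2)) \<longlonglongrightarrow> 0"
proof -
  have "(\<lambda>n. real n powr (real k / 2) * q ^ n) \<longlonglongrightarrow> 0"
    using assms by real_asymp
  then have "(\<lambda>n. (real n powr (real k / 2) * q ^ n) * (1 / q\<^sup>2)) \<longlonglongrightarrow> 0"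
    by (rule tendsto_mult_left_zero)
  moreover have "\<forall>\<^sub>F n in sequentially. (real n powr (real k / 2) * q ^ n) * (1 / q\<^sup>2) = sqrt (real n) ^ k * q ^ (n - 2)"
    using eventually_ge_at_top[of 2]
  proof eventually_elim
    case (elim n)
    have "real n powr (real k / 2) = sqrt (real n) ^ k"
      using elim by (simp add: powr_half_sqrt[symmetric] powr_powr flip: powr_realpow)
    moreover have "q ^ n * (1 / q\<^sup>2) = q ^ (n - 2)"
      using elim assms by (simp add: power_diff)
    ultimately show ?case by (metis mult.assoc)
  qed
  ultimately show ?thesis by (rule Lim_transform_eventually)
qed

text \<open>On the ball of radius \<open>r \<surd>m\<close> the integrands have a common Gaussian majorant, so that dominated
  convergence applies.  Outside it, two of the \<open>m\<close> factors are used for integrability and the others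
  give the geometric factor \<open>q ^ (m - 2)\<close>, which beats the volume factor.\<close>

lemma llt_error_tendsto_0: "llt_error \<longlonglongrightarrow> 0"
proof -
  obtain r where r: "r > 0" "\<And>\<xi>. norm \<xi> \<le> r \<Longrightarrow> \<bar>Jhat \<xi>\<bar> \<le> exp (- (\<alpha> / 2) * (norm \<xi>)\<^sup>2)"
    using Jhat_gaussian_bound by blast
  obtain q where q: "0 < q" "q < 1" "\<And>\<xi>. norm \<xi> \<ge> r \<Longrightarrow> \<bar>Jhat \<xi>\<bar> \<le> q"
    using Jhat_bounded_away[OF r(1)] by blast
  define inner where "inner m \<eta> = indicator {\<eta>. norm \<eta> \<le> r * sqrt (real m)} \<eta> * rescaled_char m \<eta>" for m \<eta>
  define G where "G \<eta> = exp (- \<alpha> * (norm \<eta>)\<^sup>2)" for \<eta> :: 'a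
  have [measurable]: "inner m \<in> borel_measurable borel" for m unfolding inner_def[abs_def] by measurable
  have [measurable]: "G \<in> borel_measurable borel" unfolding G_def[abs_def] by measurable
  have G: "integrable lborel G" "integrable lborel (\<lambda>\<eta>::'a. exp (- (\<alpha> / 2) * (norm \<eta>)\<^sup>2))"
    unfolding G_def[abs_def] by (rule gaussian_integral(1); use \<alpha>_pos in simp)+
  have inner_bound: "\<bar>inner m \<eta>\<bar> \<le> exp (- (\<alpha> / 2) * (norm \<eta>)\<^sup>2)" if "m > 0" for m \<eta>
  proof (cases "norm \<eta> \<le> r * sqrt (real m)")
    case True
    let ?\<xi> = "(1 / sqrt (real m)) *\<^sub>R \<eta>"
    have "norm ?\<xi> \<le> r" using True that by (simp add: field_simps)
    from power_mono[OF r(2)[OF this] abs_ge_zero, of m]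
    have "\<bar>rescaled_char m \<eta>\<bar> \<le> exp (- (\<alpha> / 2) * (norm ?\<xi>)\<^sup>2) ^ m"
      by (simp only: rescaled_char_def power_abs)
    also have "\<dots> = exp (real m * (- (\<alpha> / 2) * (norm ?\<xi>)\<^sup>2))" by (rule exp_of_nat_mult[symmetric])
    also have "real m * (- (\<alpha> / 2) * (norm ?\<xi>)\<^sup>2) = - (\<alpha> / 2) * (norm \<eta>)\<^sup>2"
      using that by (simp add: power_divide)
    finally show ?thesis using True by (simp add: inner_def)
  qed (simp add: inner_def)
  have i1: "(\<lambda>m. LINT \<eta>|lborel. \<bar>inner (Suc m) \<eta> - G \<eta>\<bar>) \<longlonglongrightarrow> (LINT \<eta>|(lborel::'a measure). 0)"
  proof (rule integral_dominated_convergence[where w="\<lambda>\<eta>. 2 * exp (- (\<alpha> / 2) * (norm \<eta>)\<^sup>2)"])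
    show "integrable lborel (\<lambda>\<eta>::'a. 2 * exp (- (\<alpha> / 2) * (norm \<eta>)\<^sup>2))"
      using G(2) by (rule integrable_mult_right)
    show "AE \<eta> in lborel. (\<lambda>m. \<bar>inner (Suc m) \<eta> - G \<eta>\<bar>) \<longlonglongrightarrow> 0"
    proof (intro AE_I2 tendsto_rabs_zero)
      fix \<eta> :: 'a
      have "\<forall>\<^sub>F m in sequentially. norm \<eta> \<le> r * sqrt (real m)"
        using r(1) by real_asymp
      then have "\<forall>\<^sub>F m in sequentially. rescaled_char m \<eta> - G \<eta> = inner m \<eta> - G \<eta>"
        by eventually_elim (simp add: inner_def)
      moreover have "(\<lambda>m. rescaled_char m \<eta> - G \<eta>) \<longlonglongrightarrow> 0"
        using rescaled_char_limit[of \<eta>] by (simp add: G_def LIM_zero_iff)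
      ultimately have "(\<lambda>m. inner m \<eta> - G \<eta>) \<longlonglongrightarrow> 0" by (rule Lim_transform_eventually[rotated])
      then show "(\<lambda>m. inner (Suc m) \<eta> - G \<eta>) \<longlonglongrightarrow> 0" by (rule LIMSEQ_Suc)
    qed
    show "AE \<eta> in lborel. norm \<bar>inner (Suc m) \<eta> - G \<eta>\<bar> \<le> 2 * exp (- (\<alpha> / 2) * (norm \<eta>)\<^sup>2)" for m
    proof (intro AE_I2)
      fix \<eta> :: 'a
      have "\<alpha> * (norm \<eta>)\<^sup>2 \<ge> 0" using \<alpha>_pos by simp
      then have "\<bar>G \<eta>\<bar> \<le> exp (- (\<alpha> / 2) * (norm \<eta>)\<^sup>2)" by (simp add: G_def)
      with inner_bound[of "Suc m" \<eta>] show "norm \<bar>inner (Suc m) \<eta> - G \<eta>\<bar> \<le> 2 * exp (- (\<alpha> / 2) * (norm \<eta>)\<^sup>2)"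
        by simp
    qed
  qed measurable
  define S where "S = (LINT \<xi>|lborel. Jhat \<xi> ^ 2)"
  have inner_int: "integrable lborel (inner m)" if "m > 0" for m
    by (rule Bochner_Integration.integrable_bound[OF G(2)]) (use inner_bound[OF that] in auto)
  have tail: "(LINT \<eta>|lborel. \<bar>rescaled_char m \<eta> - inner m \<eta>\<bar>) \<le> (sqrt (real m) ^ DIM('a) * q ^ (m - 2)) * S" if m: "m \<ge> 2" for m
  proof -
    define h where "h \<xi> = indicator {\<xi>. norm \<xi> > r} \<xi> * \<bar>Jhat \<xi>\<bar> ^ m" for \<xi>
    have [measurable]: "h \<in> borel_measurable borel" unfolding h_def[abs_def] by measurable
    have eq: "\<bar>rescaled_char m \<eta> - inner m \<eta>\<bar> = h ((1 / sqrt (real m)) *\<^sub>R \<eta>)" for \<eta>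
    proof -
      have "norm ((1 / sqrt (real m)) *\<^sub>R \<eta>) > r \<longleftrightarrow> \<not> norm \<eta> \<le> r * sqrt (real m)"
        using m by (simp add: not_le pos_less_divide_eq)
      then show ?thesis
        by (cases "norm \<eta> \<le> r * sqrt (real m)")
           (simp_all add: inner_def rescaled_char_def h_def power_abs del: norm_scaleR)
    qed
    have le: "h \<xi> \<le> q ^ (m - 2) * Jhat \<xi> ^ 2" for \<xi>
    proof (cases "norm \<xi> > r")
      case True
      have "\<bar>Jhat \<xi>\<bar> ^ m = \<bar>Jhat \<xi>\<bar> ^ (m - 2) * Jhat \<xi> ^ 2"
        using power_add[of "\<bar>Jhat \<xi>\<bar>" "m - 2" 2] m by (simp only: power2_abs le_add_diff_inverse2)
      also have "\<dots> \<le> q ^ (m - 2) * Jhat \<xi> ^ 2"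
        using q(3)[of \<xi>] True by (intro mult_right_mono power_mono) auto
      finally show ?thesis using True by (simp add: h_def)
    qed (use q in \<open>simp add: h_def\<close>)
    have "integral\<^sup>L lborel h \<le> (LINT \<xi>|lborel. q ^ (m - 2) * Jhat \<xi> ^ 2)"
    proof (intro integral_mono le)
      show i: "integrable lborel (\<lambda>\<xi>. q ^ (m - 2) * Jhat \<xi> ^ 2)"
        by (intro integrable_mult_right Jhat_square_integrable)
      show "integrable lborel h"
        by (rule Bochner_Integration.integrable_bound[OF i]) (use order_trans[OF le abs_ge_self] in \<open>auto simp: h_def intro!: AE_I2\<close>)
    qed
    then have "sqrt (real m) ^ DIM('a) * integral\<^sup>L lborel h \<le> sqrt (real m) ^ DIM('a) * (q ^ (m - 2) * S)"
      by (intro mult_left_mono) (auto simp: S_def)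
    then show ?thesis using m by (subst (asm) sqrt_rescale) (auto simp: eq mult.assoc)
  qed
  have lim: "(\<lambda>m. (LINT \<eta>|lborel. \<bar>inner (Suc m) \<eta> - G \<eta>\<bar>) + (sqrt (real (Suc m)) ^ DIM('a) * q ^ (Suc m - 2)) * S) \<longlonglongrightarrow> 0 + 0"
    using i1 by (intro tendsto_add tendsto_mult_left_zero LIMSEQ_Suc[OF geometric_beats_power] q) simp
  have "(\<lambda>m. llt_error (Suc m)) \<longlonglongrightarrow> 0"
  proof (rule Lim_null_comparison[OF _ lim[unfolded add_0_left]])
    show "\<forall>\<^sub>F m in sequentially. norm (llt_error (Suc m)) \<le> (LINT \<eta>|lborel. \<bar>inner (Suc m) \<eta> - G \<eta>\<bar>) + (sqrt (real (Suc m)) ^ DIM('a) * q ^ (Suc m - 2)) * S"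
      using eventually_ge_at_top[of 1]
    proof eventually_elim
      case (elim m)
      have i: "integrable lborel (rescaled_char (Suc m))" "integrable lborel (inner (Suc m))"
        using elim by (auto intro!: rescaled_char_integrable inner_int)
      have "llt_error (Suc m) \<le> (LINT \<eta>|lborel. \<bar>inner (Suc m) \<eta> - G \<eta>\<bar> + \<bar>rescaled_char (Suc m) \<eta> - inner (Suc m) \<eta>\<bar>)"
        unfolding llt_error_def G_def[symmetric]
        by (intro integral_mono integrable_abs Bochner_Integration.integrable_add Bochner_Integration.integrable_diff i G) auto
      also have "\<dots> = (LINT \<eta>|lborel. \<bar>inner (Suc m) \<eta> - G \<eta>\<bar>) + (LINT \<eta>|lborel. \<bar>rescaled_char (Suc m) \<eta> - inner (Suc m) \<eta>\<bar>)"
        by (intro Bochner_Integration.integral_add integrable_abs Bochner_Integration.integrable_diff i G)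
      also have "\<dots> \<le> (LINT \<eta>|lborel. \<bar>inner (Suc m) \<eta> - G \<eta>\<bar>) + (sqrt (real (Suc m)) ^ DIM('a) * q ^ (Suc m - 2)) * S"
        using tail[of "Suc m"] elim by simp
      finally show ?case by (simp add: llt_error_def)
    qed
  qed
  then show ?thesis by (simp only: filterlim_sequentially_Suc)
qed

text \<open>Fourier inversion after \<open>\<xi> = \<eta> / \<surd>m\<close>, both for the walk and for the Gaussian.\<close>

theorem local_limit_theorem:
  assumes n: "n \<ge> 1"
  shows "\<bar>sqrt (real (Suc n)) ^ DIM('a) * kpow n z
      - exp (- (norm z)\<^sup>2 / (4 * \<alpha> * real (Suc n))) / (4 * pi * \<alpha>) powr (real DIM('a) / 2)\<bar>
    \<le> llt_error (Suc n) / (2 * pi) ^ DIM('a)"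
proof -
  define m where "m = Suc n"
  have m: "m > 0" "m \<ge> 2" using n by (auto simp: m_def)
  let ?y = "(1 / sqrt (real m)) *\<^sub>R z"
  let ?G = "\<lambda>\<eta>::'a. exp (- \<alpha> * (norm \<eta>)\<^sup>2)"
  let ?K = "(2 * pi) ^ DIM('a)" and ?E = "exp (- (norm z)\<^sup>2 / (4 * \<alpha> * real m))"
  have A: "?K * (sqrt (real m) ^ DIM('a) * kpow n z) = (LINT \<eta>|lborel. rescaled_char m \<eta> * cos (\<eta> \<bullet> ?y))"
  proof -
    have "?K * (sqrt (real m) ^ DIM('a) * kpow n z) = sqrt (real m) ^ DIM('a) * (LINT \<xi>|lborel. Jhat \<xi> ^ m * cos (\<xi> \<bullet> z))"
      using fourier_inversion[OF n, of z] by (simp add: m_def)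
    also have "\<dots> = (LINT \<eta>|lborel. rescaled_char m \<eta> * cos (\<eta> \<bullet> ?y))"
      by (subst sqrt_rescale) (use m in \<open>auto simp: rescaled_char_def\<close>)
    finally show ?thesis .
  qed
  have B: "(LINT \<eta>|lborel. ?G \<eta> * cos (\<eta> \<bullet> ?y)) = ?K * (?E / (4 * pi * \<alpha>) powr (real DIM('a) / 2))"
  proof -
    have "(pi / \<alpha>) powr (real DIM('a) / 2) * (4 * pi * \<alpha>) powr (real DIM('a) / 2) = ((2 * pi) ^ 2) powr (real DIM('a) / 2)"
      using \<alpha>_pos by (subst powr_mult[symmetric]) (auto simp: power2_eq_square mult_ac)
    also have "\<dots> = ?K"
      using powr_powr[of "2 * pi" 2 "real DIM('a) / 2"] powr_realpow[of "2 * pi" "DIM('a)"] by (simp add: powr_numeral)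
    finally have K: "(pi / \<alpha>) powr (real DIM('a) / 2) = ?K / (4 * pi * \<alpha>) powr (real DIM('a) / 2)"
      using \<alpha>_pos by (simp add: field_simps)
    have "- (norm ?y)\<^sup>2 / (4 * \<alpha>) = - (norm z)\<^sup>2 / (4 * \<alpha> * real m)" using m by (simp add: power_divide)
    then show ?thesis using gaussian_character(2)[OF \<alpha>_pos, of ?y] by (simp add: K)
  qed
  have iG: "integrable lborel ?G" by (rule gaussian_integral[OF \<alpha>_pos])
  have icos: "bounded_borel (\<lambda>\<eta>::'a. cos (\<eta> \<bullet> ?y))" by (rule bounded_borelI[where C=1]) auto
  note ir = rescaled_char_integrable[OF m(2)]
  have "?K * (sqrt (real m) ^ DIM('a) * kpow n z - ?E / (4 * pi * \<alpha>) powr (real DIM('a) / 2))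
     = (LINT \<eta>|lborel. (rescaled_char m \<eta> - ?G \<eta>) * cos (\<eta> \<bullet> ?y))"
    unfolding right_diff_distrib A B[symmetric] left_diff_distrib
    by (intro Bochner_Integration.integral_diff[symmetric] integrable_mult_bounded ir iG icos)
  also have "\<bar>\<dots>\<bar> \<le> 1 * llt_error m"
    unfolding llt_error_def
    by (rule integral_mult_bounded_le) (use ir iG in auto)
  finally have "?K * \<bar>sqrt (real m) ^ DIM('a) * kpow n z - ?E / (4 * pi * \<alpha>) powr (real DIM('a) / 2)\<bar> \<le> llt_error m"
    by (simp add: abs_mult)
  then show ?thesis by (simp add: m_def pos_le_divide_eq mult.commute)
qed

end

section \<open>Free and killed walks\<close>

abbreviation mass :: "('a::euclidean_space \<Rightarrow> real) \<Rightarrow> real" where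
  "mass f \<equiv> LINT x|lborel. f x"

abbreviation pairing :: "('a::euclidean_space \<Rightarrow> real) \<Rightarrow> ('a \<Rightarrow> real) \<Rightarrow> real" where
  "pairing f g \<equiv> LINT x|lborel. f x * g x"

text \<open>The nonnegative densities against which the solution is tested near a point.  The radius is fixed in
  advance, so that limits can be uniform over all test functions of unit mass.\<close>

definition test_function :: "real \<Rightarrow> ('a::euclidean_space \<Rightarrow> real) \<Rightarrow> bool" where
  "test_function r g \<longleftrightarrow> integrable lborel g \<and> bounded_borel g \<and> (\<forall>x. g x \<ge> 0) \<and> (\<forall>x. norm x > r \<longrightarrow> g x = 0)"

lemma integrable_tail_small:
  fixes f :: "'a::euclidean_space \<Rightarrow> real"
  assumes f: "integrable lborel f" and e: "e > 0"
  shows "\<exists>R\<ge>0. (LINT x|lborel. indicator {x. norm x > R} x * \<bar>f x\<bar>) \<le> e"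
proof -
  have [measurable]: "f \<in> borel_measurable borel" using f by (rule integrable_borel_meas)
  have "(\<lambda>n. LINT x|lborel. indicator {x. norm x > real n} x * \<bar>f x\<bar>) \<longlonglongrightarrow> (LINT x|(lborel::'a measure). 0)"
  proof (rule integral_dominated_convergence[where w="\<lambda>x. \<bar>f x\<bar>"])
    show "AE x in lborel. (\<lambda>n. indicator {x. norm x > real n} x * \<bar>f x\<bar>) \<longlonglongrightarrow> 0"
    proof (intro AE_I2)
      fix x :: 'a
      have "\<forall>\<^sub>F n in sequentially. norm x \<le> real n"
        using filterlim_real_sequentially by (simp add: filterlim_at_top)
      then have "\<forall>\<^sub>F n in sequentially. indicator {x. norm x > real n} x * \<bar>f x\<bar> = 0"
        by eventually_elim simp
      then show "(\<lambda>n. indicator {x. norm x > real n} x * \<bar>f x\<bar>) \<longlonglongrightarrow> 0" by (rule tendsto_eventually)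
    qed
  qed (use f in \<open>auto simp: indicator_def\<close>)
  then have "\<forall>\<^sub>F n in sequentially. (LINT x|lborel. indicator {x. norm x > real n} x * \<bar>f x\<bar>) < e"
    using e by (intro order_tendstoD(2)) auto
  then obtain n where "(LINT x|lborel. indicator {x. norm x > real n} x * \<bar>f x\<bar>) < e"
    by (auto simp: eventually_sequentially)
  then show ?thesis by (intro exI[of _ "real n"]) auto
qed

context jump_kernel
begin

text \<open>The local limit theorem bounds the scaled densities; the first step, to which it does not apply, is
  covered by the maximum of \<open>J\<close>.\<close>

lemma kpow_bound: "\<exists>C>0. \<forall>n z. sqrt (real (Suc n)) ^ DIM('a) * kpow n z \<le> C"
proof -
  have "Bseq llt_error" using llt_error_tendsto_0 by (intro convergent_imp_Bseq convergentI)
  then obtain E where E: "E > 0" "\<And>n. \<bar>llt_error n\<bar> \<le> E" by (auto simp: Bseq_def)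
  define c where "c = 1 / (4 * pi * \<alpha>) powr (real DIM('a) / 2)"
  have c: "c \<ge> 0" by (simp add: c_def)
  show ?thesis
  proof (intro exI[of _ "Jmax + E / (2 * pi) ^ DIM('a) + c"] conjI allI)
    show "Jmax + E / (2 * pi) ^ DIM('a) + c > 0" using Jmax_pos E(1) c by (auto intro!: add_pos_nonneg)
    fix n z
    show "sqrt (real (Suc n)) ^ DIM('a) * kpow n z \<le> Jmax + E / (2 * pi) ^ DIM('a) + c"
    proof (cases n)
      case 0
      then show ?thesis using J_le_Jmax[of z] E(1) c by (simp add: kpow_0 add_increasing2)
    next
      case (Suc k)
      have "exp (- (norm z)\<^sup>2 / (4 * \<alpha> * real (Suc n))) * c \<le> 1 * c"
        using \<alpha>_pos c by (intro mult_right_mono) auto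
      moreover have "llt_error (Suc n) / (2 * pi) ^ DIM('a) \<le> E / (2 * pi) ^ DIM('a)"
        using E(2)[of "Suc n"] by (intro divide_right_mono) auto
      ultimately show ?thesis
        using local_limit_theorem[of n z] Suc Jmax_pos by (simp add: c_def abs_le_iff)
    qed
  qed
qed

lemma free_sup_bound:
  "\<exists>C>0. \<forall>n\<ge>1. \<forall>f x. integrable lborel f \<longrightarrow> \<bar>(avg ^^ n) f x\<bar> \<le> C / sqrt (real n) ^ DIM('a) * (LINT y|lborel. \<bar>f y\<bar>)"
proof -
  obtain C where C: "C > 0" "\<And>n z. sqrt (real (Suc n)) ^ DIM('a) * kpow n z \<le> C"
    using kpow_bound by blast
  show ?thesis
  proof (intro exI[of _ C] conjI allI impI)
    fix n :: nat and f :: "'a \<Rightarrow> real" and x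
    assume n: "1 \<le> n" and f: "integrable lborel f"
    then obtain k where k: "n = Suc k" by (cases n) auto
    have [measurable]: "f \<in> borel_measurable borel" using f by (rule integrable_borel_meas)
    have "\<bar>LINT y|lborel. f y * kpow k (x - y)\<bar> \<le> C / sqrt (real n) ^ DIM('a) * (LINT y|lborel. \<bar>f y\<bar>)"
    proof (rule integral_mult_bounded_le[OF f])
      show "AE y in lborel. \<bar>kpow k (x - y)\<bar> \<le> C / sqrt (real n) ^ DIM('a)"
        using C(2)[of k] by (auto simp: k kpow_nonneg pos_le_divide_eq mult.commute)
    qed measurable
    then show "\<bar>(avg ^^ n) f x\<bar> \<le> C / sqrt (real n) ^ DIM('a) * (LINT y|lborel. \<bar>f y\<bar>)"
      unfolding k avg_iterate_kernel[OF f] by (simp add: mult.commute)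
  qed (rule C(1))
qed

text \<open>Comparison with the free walk is used for integrable densities and for bounded survival functions.\<close>

definition tame :: "('a \<Rightarrow> real) \<Rightarrow> bool" where
  "tame f \<longleftrightarrow> bounded_borel f \<or> integrable lborel f"

lemma tame_averageable: "tame f \<Longrightarrow> averageable f"
  by (auto simp: tame_def averageable_bounded averageable_integrable)

lemma tame_iter: "S \<in> sets borel \<Longrightarrow> tame f \<Longrightarrow> tame ((step S ^^ n) f)"
  by (auto simp: tame_def iter_bounded_borel iter_integrable)

lemma step_abs_le_avg:
  assumes S: "S \<in> sets borel" and f: "tame f" and g: "tame g" and le: "AE x in lborel. \<bar>f x\<bar> \<le> g x"
  shows "\<bar>step S f x\<bar> \<le> avg g x"
proof -
  have 1: "averageable (\<lambda>y. indicator S y * f y)"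
    by (intro averageable_indicator S tame_averageable f)
  have "\<bar>avg (\<lambda>y. indicator S y * f y) x\<bar> \<le> (LINT y|lborel. \<bar>J (x - y) * (indicator S y * f y)\<bar>)"
    unfolding avg_def by (rule integral_abs_bound)
  also have "\<dots> \<le> avg g x"
    unfolding avg_def
  proof (rule integral_mono_AE)
    show "integrable lborel (\<lambda>y. \<bar>J (x - y) * (indicator S y * f y)\<bar>)"
      using 1 by (intro integrable_abs) (simp add: averageable_def)
    show "integrable lborel (\<lambda>y. J (x - y) * g y)"
      using tame_averageable[OF g] by (simp add: averageable_def)
    show "AE y in lborel. \<bar>J (x - y) * (indicator S y * f y)\<bar> \<le> J (x - y) * g y"
      using le by eventually_elim (auto simp: abs_mult J_nonneg indicator_def intro!: mult_left_mono)
  qed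
  finally show ?thesis by (auto simp: step_def indicator_def)
qed

text \<open>Each step improves an inequality almost everywhere to one that holds everywhere.\<close>

lemma iter_abs_le_free:
  assumes S: "S \<in> sets borel" and f: "tame f" and g: "tame g" and le: "AE x in lborel. \<bar>f x\<bar> \<le> g x"
  shows "\<bar>(step S ^^ Suc n) f x\<bar> \<le> (avg ^^ Suc n) g x"
proof (induction n arbitrary: x)
  case 0
  then show ?case using step_abs_le_avg[OF assms] by simp
next
  case (Suc n)
  have "tame ((avg ^^ Suc n) g)" using tame_iter[of UNIV g "Suc n"] g by (simp add: step_UNIV)
  from step_abs_le_avg[OF S tame_iter[OF S f, of "Suc n"] this AE_I2[OF Suc]]
  show ?case by simp
qed

lemma iter_le_free:
  assumes S: "S \<in> sets borel" and f: "tame f" "\<And>x. f x \<ge> 0"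
  shows "(step S ^^ n) f x \<le> (avg ^^ n) f x"
proof (cases n)
  case (Suc k)
  then show ?thesis using iter_abs_le_free[OF S f(1) f(1), of k x] f(2) by simp
qed simp

lemma avg_iter_const: "(avg ^^ n) (\<lambda>_. c) = (\<lambda>_. c)"
  by (induction n) (auto simp: avg_const)

lemma free_mass: "integrable lborel f \<Longrightarrow> mass ((avg ^^ n) f) = mass f"
  using iter_symmetric[of UNIV f "\<lambda>_. 1" n] by (simp add: step_UNIV avg_iter_const bounded_borel_const)

lemma killed_mass:
  "S \<in> sets borel \<Longrightarrow> integrable lborel f \<Longrightarrow>
    mass ((step S ^^ n) f) = (LINT x|lborel. f x * (step S ^^ n) (\<lambda>_. 1) x)"
  using iter_symmetric[of S f "\<lambda>_. 1" n] by (simp add: bounded_borel_const)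

text \<open>The killed density lies below the free one, and the free walk preserves mass: the \<open>L\<^sup>1\<close> distance is
  just the mass that has been killed.\<close>

lemma lost_mass:
  assumes S: "S \<in> sets borel" and f: "integrable lborel f" "\<And>x. f x \<ge> 0"
  shows "(LINT x|lborel. \<bar>(avg ^^ n) f x - (step S ^^ n) f x\<bar>) = mass f - mass ((step S ^^ n) f)"
proof -
  have "(LINT x|lborel. \<bar>(avg ^^ n) f x - (step S ^^ n) f x\<bar>) = (LINT x|lborel. (avg ^^ n) f x - (step S ^^ n) f x)"
    using iter_le_free[OF S _ f(2)] f(1) by (simp add: tame_def)
  also have "\<dots> = mass f - mass ((step S ^^ n) f)"
    using iter_integrable[of UNIV f n] iter_integrable[OF S f(1), of n] f by (simp add: step_UNIV free_mass)
  finally show ?thesis .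
qed

text \<open>The two products differ by \<open>(B\<^sup>m - A\<^sup>m) f\<close> paired with \<open>B\<^sup>m\<^sup>' g\<close>, plus \<open>A\<^sup>m f\<close> paired with
  \<open>(B\<^sup>m\<^sup>' - A\<^sup>m\<^sup>') g\<close>.  In each term the difference is measured in \<open>L\<^sup>1\<close> by the lost mass, and the other
  factor in the supremum norm by the decay of the free walk.\<close>

lemma killed_vs_free:
  assumes C: "\<And>n f x. n \<ge> 1 \<Longrightarrow> integrable lborel f \<Longrightarrow>
      \<bar>(avg ^^ n) f x\<bar> \<le> C / sqrt (real n) ^ DIM('a) * (LINT y|lborel. \<bar>f y\<bar>)"
    and S: "S \<in> sets borel"
    and f: "integrable lborel f" "\<And>x. f x \<ge> 0"
    and g: "integrable lborel g" "bounded_borel g" "\<And>x. g x \<ge> 0"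
    and m: "m \<ge> 1" "m' \<ge> 1"
  shows "\<bar>pairing f ((avg ^^ (m + m')) g) - pairing f ((step S ^^ (m + m')) g)\<bar>
     \<le> C / sqrt (real m') ^ DIM('a) * mass g * (mass f - mass ((step S ^^ m) f))
       + C / sqrt (real m) ^ DIM('a) * mass f * (mass g - mass ((step S ^^ m') g))"
proof -
  let ?Bf = "(avg ^^ m) f" and ?Af = "(step S ^^ m) f" and ?Bg = "(avg ^^ m') g" and ?Ag = "(step S ^^ m') g"
  have tame: "tame f" "tame g" using f g by (auto simp: tame_def)
  have bdd: "bounded_borel ?Bg" "bounded_borel ?Ag"
    using iter_bounded_borel[of UNIV g m'] iter_bounded_borel[OF S g(2), of m'] g by (auto simp: step_UNIV)
  have int: "integrable lborel ?Bf" "integrable lborel ?Af" "integrable lborel ?Bg" "integrable lborel ?Ag"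
    using iter_integrable[of UNIV] iter_integrable[OF S] f g by (auto simp: step_UNIV)
  have Bfg: "pairing f ((avg ^^ (m + m')) g) = pairing ?Bf ?Bg"
    using iter_symmetric[of UNIV f ?Bg m] bdd f by (simp add: step_UNIV funpow_add)
  have Afg: "pairing f ((step S ^^ (m + m')) g) = pairing ?Af ?Ag"
    using iter_symmetric[of S f ?Ag m] bdd f S by (simp add: funpow_add)
  have split: "pairing ?Bf ?Bg - pairing ?Af ?Ag =
      (LINT x|lborel. (?Bf x - ?Af x) * ?Bg x) + (LINT x|lborel. (?Bg x - ?Ag x) * ?Af x)"
  proof -
    note i = integrable_mult_bounded[OF int(1) bdd(1)] integrable_mult_bounded[OF int(2) bdd(1)]
      integrable_mult_bounded[OF int(2) bdd(2)]
    have "(LINT x|lborel. (?Bf x - ?Af x) * ?Bg x) = pairing ?Bf ?Bg - pairing ?Af ?Bg"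
      using i by (simp add: left_diff_distrib)
    moreover have "(LINT x|lborel. (?Bg x - ?Ag x) * ?Af x) = pairing ?Af ?Bg - pairing ?Af ?Ag"
      using i by (simp add: left_diff_distrib right_diff_distrib mult.commute)
    ultimately show ?thesis by simp
  qed
  have "\<bar>LINT x|lborel. (?Bf x - ?Af x) * ?Bg x\<bar>
      \<le> C / sqrt (real m') ^ DIM('a) * mass g * (LINT x|lborel. \<bar>?Bf x - ?Af x\<bar>)"
    using C[OF m(2) g(1)] g int bdd by (intro integral_mult_bounded_le) (auto dest: bounded_borel_meas)
  moreover have "\<bar>LINT x|lborel. (?Bg x - ?Ag x) * ?Af x\<bar>
      \<le> C / sqrt (real m) ^ DIM('a) * mass f * (LINT x|lborel. \<bar>?Bg x - ?Ag x\<bar>)"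
  proof (intro integral_mult_bounded_le AE_I2)
    fix x
    have "\<bar>?Af x\<bar> \<le> ?Bf x"
      using iter_le_free[OF S tame(1) f(2)] iter_nonneg[of f m S x] f by simp
    then show "\<bar>?Af x\<bar> \<le> C / sqrt (real m) ^ DIM('a) * mass f"
      using C[OF m(1) f(1), of x] f by simp
  qed (use int in \<open>auto dest: integrable_borel_meas\<close>)
  ultimately show ?thesis
    unfolding Bfg Afg split lost_mass[OF S f] lost_mass[OF S g(1,3)] by linarith
qed

lemma step_support:
  assumes "\<And>x. norm x > r \<Longrightarrow> f x = 0" "norm x > r + 1"
  shows "step S f x = 0"
proof -
  have z: "J (x - y) * (indicator S y * f y) = 0" for y
    using assms J_support[of "x - y"] norm_triangle_ineq2[of x y] by (cases "norm y > r") auto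
  show ?thesis by (simp only: step_def avg_def z) simp
qed

lemma iter_support:
  assumes "\<And>x. norm x > r \<Longrightarrow> f x = 0" "norm x > r + real n"
  shows "(step S ^^ n) f x = 0"
  using assms(2)
proof (induction n arbitrary: x)
  case (Suc n)
  then show ?case by (auto intro!: step_support[of "r + real n"])
qed (simp add: assms(1))

text \<open>On a fixed ball the Gaussian profile of the local limit theorem is asymptotically flat.\<close>

lemma kpow_locally_uniform:
  assumes e: "e > 0"
  defines "c \<equiv> 1 / (4 * pi * \<alpha>) powr (real DIM('a) / 2)"
  shows "\<forall>\<^sub>F n in sequentially. \<forall>z. norm z \<le> R \<longrightarrow> \<bar>sqrt (real (Suc n)) ^ DIM('a) * kpow n z - c\<bar> \<le> e"
proof -
  have c: "c > 0" using \<alpha>_pos by (simp add: c_def)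
  have "(\<lambda>n. llt_error (Suc n) / (2 * pi) ^ DIM('a)) \<longlonglongrightarrow> 0 / (2 * pi) ^ DIM('a)"
    by (intro tendsto_divide tendsto_const LIMSEQ_Suc[OF llt_error_tendsto_0]) simp
  then have 1: "\<forall>\<^sub>F n in sequentially. llt_error (Suc n) / (2 * pi) ^ DIM('a) < e / 2"
    using e by (intro order_tendstoD(2)[of _ 0]) auto
  have "(\<lambda>n. c * (1 - exp (- R\<^sup>2 / (4 * \<alpha> * real (Suc n))))) \<longlonglongrightarrow> c * (1 - exp 0)"
    using LIMSEQ_Suc[OF lim_const_over_n[of "- R\<^sup>2 / (4 * \<alpha>)"]]
    by (intro tendsto_intros) (simp only: divide_divide_eq_left)
  then have 2: "\<forall>\<^sub>F n in sequentially. c * (1 - exp (- R\<^sup>2 / (4 * \<alpha> * real (Suc n)))) < e / 2"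
    using e by (intro order_tendstoD(2)[of _ "c * (1 - exp 0)"]) auto
  show ?thesis using 1 2 eventually_ge_at_top[of 1]
  proof eventually_elim
    case (elim n)
    show ?case
    proof (intro allI impI)
      fix z :: 'a assume z: "norm z \<le> R"
      have "(norm z)\<^sup>2 \<le> R\<^sup>2" using z by (intro power_mono) auto
      then have "(norm z)\<^sup>2 / (4 * \<alpha> * real (Suc n)) \<le> R\<^sup>2 / (4 * \<alpha> * real (Suc n))"
        using \<alpha>_pos by (intro divide_right_mono) auto
      then have "exp (- R\<^sup>2 / (4 * \<alpha> * real (Suc n))) \<le> exp (- (norm z)\<^sup>2 / (4 * \<alpha> * real (Suc n)))" by simp
      then have "c * (1 - exp (- (norm z)\<^sup>2 / (4 * \<alpha> * real (Suc n)))) \<le> c * (1 - exp (- R\<^sup>2 / (4 * \<alpha> * real (Suc n))))"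
        using c by (intro mult_left_mono) auto
      moreover have "0 \<le> c * (1 - exp (- (norm z)\<^sup>2 / (4 * \<alpha> * real (Suc n))))"
        using c \<alpha>_pos by (intro mult_nonneg_nonneg) auto
      moreover have "\<bar>sqrt (real (Suc n)) ^ DIM('a) * kpow n z - c * exp (- (norm z)\<^sup>2 / (4 * \<alpha> * real (Suc n)))\<bar> < e / 2"
        using order.strict_trans1[OF local_limit_theorem[OF elim(3), of z] elim(1)] by (simp add: c_def)
      ultimately show "\<bar>sqrt (real (Suc n)) ^ DIM('a) * kpow n z - c\<bar> \<le> e"
        using elim(2) by (simp add: right_diff_distrib abs_if split: if_splits)
    qed
  qed
qed

text \<open>The tail of \<open>f\<close> outside a large ball is absorbed by the uniform bound on the densities; within the
  ball all differences \<open>x - y\<close> stay bounded and the density is nearly constant.\<close>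

lemma free_pairing_limit:
  assumes f: "integrable lborel f" "\<And>x. f x \<ge> 0" and e: "e > 0"
  defines "c \<equiv> 1 / (4 * pi * \<alpha>) powr (real DIM('a) / 2)"
  shows "\<forall>\<^sub>F n in sequentially. \<forall>g. test_function r g \<longrightarrow>
     \<bar>sqrt (real n) ^ DIM('a) * pairing f ((avg ^^ n) g) - c * mass f * mass g\<bar>
      \<le> e * mass g"
proof -
  have [measurable]: "f \<in> borel_measurable borel" using f(1) by (rule integrable_borel_meas)
  obtain C where C: "C > 0" "\<And>n z. sqrt (real (Suc n)) ^ DIM('a) * kpow n z \<le> C"
    using kpow_bound by blast
  have c: "c \<ge> 0" by (simp add: c_def)
  define F where "F = mass f"
  have F: "F \<ge> 0" unfolding F_def by (intro Bochner_Integration.integral_nonneg f)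
  \<comment> \<open>\<open>e1\<close> controls the density within the ball and \<open>e2\<close> the tail of \<open>f\<close>; each contributes \<open>e / 2\<close>.\<close>
  define e1 where "e1 = e / (2 * (F + 1))"
  define e2 where "e2 = e / (2 * (C + c))"
  have e1: "e1 > 0" "e1 * F \<le> e / 2" using e F by (auto simp: e1_def field_simps)
  have e2: "e2 > 0" "(C + c) * e2 = e / 2" using e C c by (auto simp: e2_def field_simps)
  obtain R where R: "R \<ge> 0" "(LINT x|lborel. indicator {x. norm x > R} x * \<bar>f x\<bar>) \<le> e2"
    using integrable_tail_small[OF f(1) e2(1)] by blast
  have "\<forall>\<^sub>F n in sequentially. \<forall>z. norm z \<le> R + r \<longrightarrow> \<bar>sqrt (real (Suc n)) ^ DIM('a) * kpow n z - c\<bar> \<le> e1"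
    unfolding c_def by (rule kpow_locally_uniform[OF e1(1)])
  then have "\<forall>\<^sub>F n in sequentially. \<forall>g. test_function r g \<longrightarrow>
     \<bar>sqrt (real (Suc n)) ^ DIM('a) * pairing f ((avg ^^ Suc n) g) - c * F * mass g\<bar>
      \<le> e * mass g"
  proof eventually_elim
    case (elim n)
    show ?case
    proof (intro allI impI)
      fix g :: "'a \<Rightarrow> real"
      assume tg: "test_function r g"
      then have g: "integrable lborel g" "\<forall>x. g x \<ge> 0" "\<forall>x. norm x > r \<longrightarrow> g x = 0"
        by (auto simp: test_function_def)
      have [measurable]: "g \<in> borel_measurable borel" using g(1) by (rule integrable_borel_meas)
      define k where "k z = sqrt (real (Suc n)) ^ DIM('a) * kpow n z - c" for z
      define G where "G = mass g"
      have G: "G \<ge> 0" unfolding G_def by (intro Bochner_Integration.integral_nonneg) (use g in auto)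
      have [measurable]: "k \<in> borel_measurable borel" unfolding k_def[abs_def] by measurable
      have kC: "\<bar>k z\<bar> \<le> C + c" for z
        using C(2)[of n z] c mult_nonneg_nonneg[OF _ kpow_nonneg, of "sqrt (real (Suc n)) ^ DIM('a)" n z]
        by (auto simp: k_def abs_le_iff intro: order_trans)
      define h where "h x = (LINT y|lborel. g y * k (x - y))" for x
      have hC: "\<bar>h x\<bar> \<le> (C + c) * G" for x
        using integral_mult_bounded_le[OF g(1), of "\<lambda>y. k (x - y)" "C + c"] kC g(2) by (simp add: h_def G_def)
      have he: "\<bar>h x\<bar> \<le> e1 * G" if "norm x \<le> R" for x
      proof -
        have "h x = (LINT y|lborel. g y * (k (x - y) * indicator {y. norm y \<le> r} y))"
          unfolding h_def by (intro Bochner_Integration.integral_cong) (use g(3) in \<open>auto simp: indicator_def\<close>)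
        also have "\<bar>\<dots>\<bar> \<le> e1 * (LINT y|lborel. \<bar>g y\<bar>)"
        proof (intro integral_mult_bounded_le g AE_I2)
          fix y
          have "norm (x - y) \<le> R + r" if "norm y \<le> r"
            using norm_triangle_ineq4[of x y] that \<open>norm x \<le> R\<close> by simp
          then show "\<bar>k (x - y) * indicator {y. norm y \<le> r} y\<bar> \<le> e1"
            using elim e1(1) by (auto simp: k_def indicator_def)
        qed measurable
        finally show ?thesis using g(2) by (simp add: G_def)
      qed
      have h: "bounded_borel h"
        by (rule bounded_borelI[OF _ hC]) (unfold h_def[abs_def], measurable)
      have hx: "sqrt (real (Suc n)) ^ DIM('a) * (avg ^^ Suc n) g x - c * G = h x" for x
      proof -
        have "integrable lborel (\<lambda>y. g y * kpow n (x - y))"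
          using kpow_bounded_borel[of n]
          by (intro integrable_mult_bounded g) (auto simp: bounded_borel_def)
        then have "h x = sqrt (real (Suc n)) ^ DIM('a) * (LINT y|lborel. g y * kpow n (x - y)) - c * G"
          using g(1) by (simp add: h_def k_def right_diff_distrib mult.left_commute[of "g _"] G_def mult.commute[of _ c])
        then show ?thesis by (simp only: avg_iterate_kernel[OF g(1)] mult.commute[of "g _"])
      qed
      have bg: "integrable lborel (\<lambda>x. f x * (avg ^^ Suc n) g x)"
      proof (rule integrable_mult_bounded[OF f(1)])
        have eq: "(avg ^^ Suc n) g = (\<lambda>x. (h x - (- (c * G))) * (1 / sqrt (real (Suc n)) ^ DIM('a)))"
          using hx by (auto simp: field_simps simp del: funpow.simps)
        show "bounded_borel ((avg ^^ Suc n) g)"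
          unfolding eq by (intro bounded_borel_mult bounded_borel_diff h bounded_borel_const)
      qed
      have "sqrt (real (Suc n)) ^ DIM('a) * pairing f ((avg ^^ Suc n) g) - c * F * G
        = (LINT x|lborel. sqrt (real (Suc n)) ^ DIM('a) * (f x * (avg ^^ Suc n) g x) - c * G * f x)"
        unfolding Bochner_Integration.integral_diff[OF integrable_mult_right[OF bg] integrable_mult_right[OF f(1)]]
          integral_mult_right_zero F_def by (simp only: mult_ac)
      also have "\<dots> = pairing f h"
        by (intro Bochner_Integration.integral_cong) (auto simp: hx[symmetric] algebra_simps simp del: funpow.simps)
      also have "\<bar>\<dots>\<bar> \<le> (LINT x|lborel. \<bar>f x * h x\<bar>)" by (rule integral_abs_bound)
      also have "\<dots> \<le> (LINT x|lborel. e1 * G * f x + (C + c) * G * (indicator {x. norm x > R} x * \<bar>f x\<bar>))"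
      proof (rule integral_mono)
        show "integrable lborel (\<lambda>x. \<bar>f x * h x\<bar>)"
          by (intro integrable_abs integrable_mult_bounded f h)
        show "integrable lborel (\<lambda>x. e1 * G * f x + (C + c) * G * (indicator {x. norm x > R} x * \<bar>f x\<bar>))"
          using f(1) by (intro Bochner_Integration.integrable_add integrable_mult_right integrable_indicator_times integrable_abs) auto
        fix x
        show "\<bar>f x * h x\<bar> \<le> e1 * G * f x + (C + c) * G * (indicator {x. norm x > R} x * \<bar>f x\<bar>)"
        proof (cases "norm x \<le> R")
          case True
          have "f x * \<bar>h x\<bar> \<le> f x * (e1 * G)" by (intro mult_left_mono he True f)
          then show ?thesis using True f(2)[of x] by (simp add: abs_mult mult_ac)
        next
          case False
          have "f x * \<bar>h x\<bar> \<le> f x * ((C + c) * G)" by (intro mult_left_mono hC f)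
          moreover have "0 \<le> e1 * G * f x" using e1 G f by simp
          ultimately show ?thesis using False f(2)[of x] by (simp add: abs_mult mult_ac)
        qed
      qed
      also have "\<dots> = e1 * G * F + (C + c) * G * (LINT x|lborel. indicator {x. norm x > R} x * \<bar>f x\<bar>)"
        using f(1) by (subst Bochner_Integration.integral_add)
          (auto simp: F_def intro!: integrable_mult_right integrable_indicator_times[OF _ integrable_abs, simplified])
      also have "\<dots> \<le> e1 * G * F + (C + c) * G * e2"
        using C c G R by (intro add_left_mono mult_left_mono) auto
      also have "\<dots> = (e1 * F + (C + c) * e2) * G" by (simp add: algebra_simps)
      also have "\<dots> \<le> e * G" using e1(2) e2(2) G by (intro mult_right_mono) auto
      finally show "\<bar>sqrt (real (Suc n)) ^ DIM('a) * pairing f ((avg ^^ Suc n) g) - c * F * mass g\<bar>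
          \<le> e * mass g" by (simp only: G_def)
    qed
  qed
  then show ?thesis
    unfolding F_def by (subst eventually_sequentially_Suc[symmetric]) simp
qed

end

section \<open>The local limit theorem for the killed walk\<close>

lemma sqrt_half_ratio:
  assumes "2 \<le> (n::nat)" "n \<le> 3 * m"
  shows "sqrt (real n) ^ N / sqrt (real m) ^ N \<le> 2 ^ N"
proof -
  have m: "m > 0" using assms by auto
  have "sqrt (real n) \<le> sqrt (4 * real m)" using assms by (intro real_sqrt_le_mono) auto
  also have "\<dots> = 2 * sqrt (real m)" by (simp add: real_sqrt_mult)
  finally have "sqrt (real n) ^ N \<le> (2 * sqrt (real m)) ^ N" by (intro power_mono) auto
  then show ?thesis using m by (simp add: power_mult_distrib pos_divide_le_eq)
qed

text \<open>The stationary problem after a choice of representatives: \<open>\<phi>\<close> is a fixed point of the killed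
  operator at every point, and tends to 1 at infinity.\<close>

locale killed_walk = jump_kernel J for J :: "'a::euclidean_space \<Rightarrow> real" +
  fixes \<Omega> :: "'a set" and \<phi> :: "'a \<Rightarrow> real"
  assumes \<Omega>_sets: "\<Omega> \<in> sets borel"
    and \<phi>_bounded: "bounded_borel \<phi>"
    and \<phi>_fixed: "step \<Omega> \<phi> = \<phi>"
    and \<phi>_at_infinity: "e > 0 \<Longrightarrow> \<exists>R. AE x in lborel. norm x \<ge> R \<longrightarrow> \<bar>\<phi> x - 1\<bar> < e"
begin

lemma \<phi>_iter: "(step \<Omega> ^^ n) \<phi> = \<phi>"
  by (induction n) (auto simp: \<phi>_fixed)

lemma iter_diff:
  assumes S: "S \<in> sets borel" and f: "bounded_borel f" and g: "bounded_borel g"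
  shows "(step S ^^ n) (\<lambda>x. f x - g x) = (\<lambda>x. (step S ^^ n) f x - (step S ^^ n) g x)"
proof (induction n)
  case (Suc n)
  then show ?case
    using step_diff[OF S averageable_bounded averageable_bounded, OF iter_bounded_borel[OF S f, of n] iter_bounded_borel[OF S g, of n]]
    by auto
qed simp

text \<open>Survival probabilities decrease to a solution of the stationary problem.  Uniformity, and the fact
  that this solution is \<open>\<phi>\<close>, come from one estimate: \<open>1 - \<phi>\<close> is dominated by a small constant \<open>e / 2\<close>
  plus a multiple of the indicator of a ball.  The constant is preserved by averaging, and the free walk
  disperses the rest.\<close>

theorem survival_tendsto_\<phi>:
  assumes e: "e > 0"
  shows "\<forall>\<^sub>F n in sequentially. \<forall>x. \<bar>(step \<Omega> ^^ n) (\<lambda>_. 1) x - \<phi> x\<bar> \<le> e"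
proof -
  obtain P where P: "P \<ge> 0" "\<And>x. \<bar>\<phi> x\<bar> \<le> P" using bounded_borelE[OF \<phi>_bounded] by blast
  obtain R where R: "AE x in lborel. norm x \<ge> R \<longrightarrow> \<bar>\<phi> x - 1\<bar> < e / 2" using \<phi>_at_infinity[of "e / 2"] e by auto
  obtain C where C: "C > 0" "\<And>n f x. n \<ge> 1 \<Longrightarrow> integrable lborel f \<Longrightarrow>
      \<bar>(avg ^^ n) f x\<bar> \<le> C / sqrt (real n) ^ DIM('a) * (LINT y|lborel. \<bar>f y\<bar>)"
    using free_sup_bound by blast
  \<comment> \<open>\<open>|1 - \<phi>| \<le> 1 + P\<close> everywhere; the sign of \<open>h\<close> lets \<open>g\<close> be a difference, as in \<open>iter_diff\<close>.\<close>
  define h where "h x = - ((1 + P) * indicator (cball 0 R) x)" for x :: 'a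
  define g where "g x = e / 2 - h x" for x :: 'a
  have h: "bounded_borel h" "integrable lborel h"
  proof -
    show "bounded_borel h"
      by (rule bounded_borelI[where C="1 + P"]) (use P in \<open>auto simp: h_def[abs_def] indicator_def\<close>)
    show "integrable lborel h"
      unfolding h_def[abs_def]
      using emeasure_compact_finite[of "cball (0::'a) R"]
      by (intro Bochner_Integration.integrable_minus integrable_mult_right integrable_real_indicator) (auto simp: infinity_ennreal_def)
  qed
  have g: "bounded_borel g" unfolding g_def[abs_def] by (intro bounded_borel_diff bounded_borel_const h)
  have w: "bounded_borel (\<lambda>x. 1 - \<phi> x)" by (intro bounded_borel_diff bounded_borel_const \<phi>_bounded)
  have wg: "AE x in lborel. \<bar>1 - \<phi> x\<bar> \<le> g x"
    using R
  proof eventually_elim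
    case (elim x)
    have "\<bar>1 - \<phi> x\<bar> \<le> 1 + P" using P(2)[of x] by linarith
    then show ?case using elim P e by (cases "norm x \<ge> R") (auto simp: g_def h_def indicator_def abs_minus_commute)
  qed
  have gn: "(avg ^^ n) g = (\<lambda>x. e / 2 - (avg ^^ n) h x)" for n
    using iter_diff[of UNIV "\<lambda>_. e / 2" h n] h
    by (simp add: g_def[abs_def] step_UNIV avg_iter_const bounded_borel_const)
  have "(\<lambda>n. C / sqrt (real n) ^ DIM('a) * (LINT y|lborel. \<bar>h y\<bar>)) \<longlonglongrightarrow> 0"
  proof (intro tendsto_mult_left_zero)
    have "filterlim (\<lambda>n. sqrt (real n)) at_top sequentially" by real_asymp
    then have "filterlim (\<lambda>n. sqrt (real n) ^ DIM('a)) at_top sequentially"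
      by (rule filterlim_pow_at_top[rotated]) simp
    then show "(\<lambda>n. C / sqrt (real n) ^ DIM('a)) \<longlonglongrightarrow> 0"
      by (intro real_tendsto_divide_at_top[OF tendsto_const])
  qed
  then have "\<forall>\<^sub>F n in sequentially. C / sqrt (real n) ^ DIM('a) * (LINT y|lborel. \<bar>h y\<bar>) < e / 2"
    using e by (intro order_tendstoD(2)[of _ 0]) auto
  then show ?thesis using eventually_ge_at_top[of 1]
  proof eventually_elim
    case (elim n)
    show ?case
    proof
      fix x
      obtain k where k: "n = Suc k" using elim(2) by (cases n) auto
      have "(step \<Omega> ^^ n) (\<lambda>_. 1) x - \<phi> x = (step \<Omega> ^^ n) (\<lambda>x. 1 - \<phi> x) x"
        using iter_diff[OF \<Omega>_sets bounded_borel_const[of 1] \<phi>_bounded, of n] by (simp add: \<phi>_iter)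
      also have "\<bar>\<dots>\<bar> \<le> (avg ^^ n) g x"
        unfolding k by (rule iter_abs_le_free[OF \<Omega>_sets _ _ wg]) (use w g in \<open>auto simp: tame_def\<close>)
      also have "\<dots> \<le> e / 2 + e / 2"
        unfolding gn using C(2)[OF elim(2) h(2), of x] elim(1) by linarith
      finally show "\<bar>(step \<Omega> ^^ n) (\<lambda>_. 1) x - \<phi> x\<bar> \<le> e" by simp
    qed
  qed
qed

text \<open>The walk makes \<open>T\<close> killed steps, \<open>n\<close> free steps and again \<open>T\<close> killed steps.  With \<open>T\<close> so large that
  the survival probabilities are \<open>\<delta>\<close>-close to \<open>\<phi>\<close>, the following errors are all of order \<open>\<delta>\<close>: the
  local limit theorem (1), the restoration of the killing in the \<open>n\<close> middle steps, which are split in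
  half (2), and the replacement of the surviving masses by \<open>\<langle>f, \<phi>\<rangle>\<close> and \<open>\<langle>g, \<phi>\<rangle>\<close> (3).\<close>

lemma killed_limit_approximate:
  assumes f: "integrable lborel f" "\<And>x. f x \<ge> 0" and P: "P \<ge> 0" "\<And>x. \<bar>\<phi> x\<bar> \<le> P"
  defines "c \<equiv> 1 / (4 * pi * \<alpha>) powr (real DIM('a) / 2)"
  shows "\<exists>K>0. \<forall>\<delta>>0. \<exists>T. \<forall>\<^sub>F n in sequentially. \<forall>g. test_function r g \<longrightarrow>
     \<bar>sqrt (real n) ^ DIM('a) * pairing f ((step \<Omega> ^^ (n + 2 * T)) g) - c * pairing f \<phi> * pairing g \<phi>\<bar>
      \<le> \<delta> * K * mass g"
proof -
  obtain C where C: "C > 0" "\<And>n f x. n \<ge> 1 \<Longrightarrow> integrable lborel f \<Longrightarrow>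
      \<bar>(avg ^^ n) f x\<bar> \<le> C / sqrt (real n) ^ DIM('a) * (LINT y|lborel. \<bar>f y\<bar>)"
    using free_sup_bound by blast
  have c: "c \<ge> 0" by (simp add: c_def)
  define F where "F = mass f"
  define M where "M = pairing f \<phi>"
  have F: "F \<ge> 0" unfolding F_def by (intro Bochner_Integration.integral_nonneg f)
  have M: "\<bar>M\<bar> \<le> P * F"
    using integral_mult_bounded_le[OF f(1), of \<phi> P] P f(2) bounded_borel_meas[OF \<phi>_bounded] by (simp add: M_def F_def)
  define K where "K = 1 + 4 * 2 ^ DIM('a) * C * F + c * F + c * P * F"
  have K: "K > 0" using C F c P by (auto simp: K_def intro!: add_pos_nonneg mult_nonneg_nonneg)
  have "\<exists>T. \<forall>\<^sub>F n in sequentially. \<forall>g. test_function r g \<longrightarrow>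
     \<bar>sqrt (real n) ^ DIM('a) * pairing f ((step \<Omega> ^^ (n + 2 * T)) g) - c * M * pairing g \<phi>\<bar>
      \<le> \<delta> * K * mass g" if \<delta>: "\<delta> > 0" for \<delta>
  proof -
    obtain T where T: "\<And>k x. k \<ge> T \<Longrightarrow> \<bar>(step \<Omega> ^^ k) (\<lambda>_. 1) x - \<phi> x\<bar> \<le> \<delta>"
      using survival_tendsto_\<phi>[OF \<delta>] unfolding eventually_sequentially by blast
    have mass: "\<bar>mass ((step \<Omega> ^^ k) g) - pairing g \<phi>\<bar> \<le> \<delta> * mass g"
      if k: "k \<ge> T" and g: "integrable lborel g" "\<And>x. g x \<ge> 0" for g k
    proof -
      have b: "bounded_borel ((step \<Omega> ^^ k) (\<lambda>_. 1))" by (intro iter_bounded_borel \<Omega>_sets bounded_borel_const)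
      have "mass ((step \<Omega> ^^ k) g) - pairing g \<phi>
        = (LINT x|lborel. g x * ((step \<Omega> ^^ k) (\<lambda>_. 1) x - \<phi> x))"
        using integrable_mult_bounded[OF g(1) b] integrable_mult_bounded[OF g(1) \<phi>_bounded]
        by (simp add: killed_mass[OF \<Omega>_sets g(1)] right_diff_distrib)
      also have "\<bar>\<dots>\<bar> \<le> \<delta> * (LINT x|lborel. \<bar>g x\<bar>)"
        using T[OF k] b \<phi>_bounded
        by (intro integral_mult_bounded_le g) (auto dest: bounded_borel_meas)
      finally show ?thesis using g(2) by simp
    qed
    have loss: "mass ((step \<Omega> ^^ T) g) - (LINT x|lborel. (step \<Omega> ^^ m) ((step \<Omega> ^^ T) g) x) \<le> 2 * \<delta> * mass g"
      if g: "integrable lborel g" "\<And>x. g x \<ge> 0" for g m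
    proof -
      have "\<bar>mass ((step \<Omega> ^^ T) g) - pairing g \<phi>\<bar> \<le> \<delta> * mass g"
        by (rule mass) (use g in auto)
      moreover have "\<bar>(LINT x|lborel. (step \<Omega> ^^ (m + T)) g x) - pairing g \<phi>\<bar> \<le> \<delta> * mass g"
        by (rule mass) (use g in auto)
      ultimately show ?thesis by (simp add: funpow_add)
    qed
    have contract: "mass ((step \<Omega> ^^ T) g) \<le> mass g" if g: "integrable lborel g" "\<And>x. g x \<ge> 0" for g
    proof -
      have "(LINT x|lborel. \<bar>(avg ^^ T) g x - (step \<Omega> ^^ T) g x\<bar>) \<ge> 0" by simp
      then show ?thesis unfolding lost_mass[OF \<Omega>_sets g] by simp
    qed
    let ?f = "(step \<Omega> ^^ T) f"
    have f': "integrable lborel ?f" "\<And>x. ?f x \<ge> 0"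
      by (auto intro!: iter_integrable \<Omega>_sets f iter_nonneg)
    define F' where "F' = mass ?f"
    have F': "F' \<ge> 0" "F' \<le> F" "\<bar>F' - M\<bar> \<le> \<delta> * F"
      using contract[OF f] mass[of T f] f by (auto simp: F'_def F_def M_def intro!: Bochner_Integration.integral_nonneg f')
    show ?thesis
    proof (intro exI[of _ T])
      show "\<forall>\<^sub>F n in sequentially. \<forall>g. test_function r g \<longrightarrow>
         \<bar>sqrt (real n) ^ DIM('a) * pairing f ((step \<Omega> ^^ (n + 2 * T)) g) - c * M * pairing g \<phi>\<bar>
          \<le> \<delta> * K * mass g"
        using free_pairing_limit[OF f' \<delta>, of "r + real T"] eventually_ge_at_top[of 2]
      proof eventually_elim
        case (elim n)
        show ?case
        proof (intro allI impI)
          fix g :: "'a \<Rightarrow> real"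
          assume tg: "test_function r g"
          then have g: "integrable lborel g" "bounded_borel g" "\<forall>x. g x \<ge> 0" "\<forall>x. norm x > r \<longrightarrow> g x = 0"
            by (auto simp: test_function_def)
          let ?g = "(step \<Omega> ^^ T) g"
          let ?s = "sqrt (real n) ^ DIM('a)"
          have g': "integrable lborel ?g" "bounded_borel ?g" "\<And>x. ?g x \<ge> 0" "\<And>x. norm x > r + real T \<Longrightarrow> ?g x = 0"
            using g by (auto intro!: iter_integrable iter_bounded_borel \<Omega>_sets iter_nonneg intro: iter_support[where r=r])
          define G where "G = mass g"
          define G' where "G' = mass ?g"
          define m_g where "m_g = pairing g \<phi>"
          have G': "G' \<ge> 0" "G' \<le> G" "\<bar>G' - m_g\<bar> \<le> \<delta> * G"
            using contract[of g] mass[of T g] g by (auto simp: G'_def G_def m_g_def intro!: Bochner_Integration.integral_nonneg g')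
          define X where "X = pairing ?f ((avg ^^ n) ?g)"
          define Y where "Y = pairing ?f ((step \<Omega> ^^ n) ?g)"
          have Y: "Y = pairing f ((step \<Omega> ^^ (n + 2 * T)) g)"
          proof -
            have "Y = (LINT x|lborel. f x * (step \<Omega> ^^ T) ((step \<Omega> ^^ n) ?g) x)"
              unfolding Y_def by (intro iter_symmetric \<Omega>_sets f iter_bounded_borel g')
            also have "(step \<Omega> ^^ T) ((step \<Omega> ^^ n) ?g) = (step \<Omega> ^^ (T + (n + T))) g"
              by (simp add: funpow_add)
            finally show ?thesis by (simp add: mult_2 add_ac)
          qed
          have 1: "\<bar>?s * X - c * F' * G'\<bar> \<le> \<delta> * G"
          proof -
            have "\<bar>?s * X - c * F' * G'\<bar> \<le> \<delta> * G'"
              using elim(1) g' by (simp add: test_function_def X_def F'_def G'_def c_def)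
            also have "\<dots> \<le> \<delta> * G" using G' \<delta> by (intro mult_left_mono) auto
            finally show ?thesis .
          qed
          have 2: "\<bar>?s * X - ?s * Y\<bar> \<le> 4 * 2 ^ DIM('a) * C * F * (\<delta> * G)"
          proof -
            define m where "m = n div 2"
            define m' where "m' = n - m"
            have m: "m \<ge> 1" "m' \<ge> 1" "n \<le> 3 * m" "n \<le> 3 * m'" "m + m' = n"
              using elim(2) by (auto simp: m_def m'_def)
            have s: "?s / sqrt (real m) ^ DIM('a) \<le> 2 ^ DIM('a)" "?s / sqrt (real m') ^ DIM('a) \<le> 2 ^ DIM('a)"
              using sqrt_half_ratio elim(2) m by auto
            have "\<bar>X - Y\<bar> \<le> C / sqrt (real m') ^ DIM('a) * G' * (F' - mass ((step \<Omega> ^^ m) ?f))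
               + C / sqrt (real m) ^ DIM('a) * F' * (G' - mass ((step \<Omega> ^^ m') ?g))"
              using killed_vs_free[OF C(2) \<Omega>_sets f' g'(1-3) m(1,2)] by (simp add: X_def Y_def F'_def G'_def m(5))
            also have "\<dots> \<le> C / sqrt (real m') ^ DIM('a) * G * (2 * \<delta> * F) + C / sqrt (real m) ^ DIM('a) * F * (2 * \<delta> * G)"
            proof -
              have "F' - mass ((step \<Omega> ^^ m) ?f) \<le> 2 * \<delta> * F" "G' - mass ((step \<Omega> ^^ m') ?g) \<le> 2 * \<delta> * G"
                using loss[OF f] loss[of g] g by (auto simp: F'_def F_def G'_def G_def)
              moreover have "0 \<le> F' - mass ((step \<Omega> ^^ m) ?f)" "0 \<le> G' - mass ((step \<Omega> ^^ m') ?g)"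
                unfolding F'_def G'_def lost_mass[OF \<Omega>_sets f', symmetric] lost_mass[OF \<Omega>_sets g'(1,3), symmetric] by auto
              ultimately show ?thesis
                using C(1) G' F' F by (intro add_mono mult_mono) auto
            qed
            finally have "?s * \<bar>X - Y\<bar> \<le> ?s * (C / sqrt (real m') ^ DIM('a) * G * (2 * \<delta> * F) + C / sqrt (real m) ^ DIM('a) * F * (2 * \<delta> * G))"
              by (intro mult_left_mono) auto
            also have "\<dots> = (?s / sqrt (real m') ^ DIM('a) + ?s / sqrt (real m) ^ DIM('a)) * (2 * C * F * (\<delta> * G))"
              by (simp add: algebra_simps)
            also have "\<dots> \<le> (2 ^ DIM('a) + 2 ^ DIM('a)) * (2 * C * F * (\<delta> * G))"
              using s C F G' \<delta> by (intro mult_right_mono add_mono) auto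
            finally show ?thesis by (simp add: abs_mult flip: right_diff_distrib)
          qed
          have 3: "\<bar>c * F' * G' - c * M * m_g\<bar> \<le> c * F * (\<delta> * G) + c * P * F * (\<delta> * G)"
          proof -
            have tri: "\<bar>(F' - M) * G' + M * (G' - m_g)\<bar> \<le> \<bar>F' - M\<bar> * \<bar>G'\<bar> + \<bar>M\<bar> * \<bar>G' - m_g\<bar>"
              by (rule order_trans[OF abs_triangle_ineq]) (simp add: abs_mult)
            have "c * F' * G' - c * M * m_g = c * ((F' - M) * G' + M * (G' - m_g))" by (simp add: algebra_simps)
            also have "\<bar>\<dots>\<bar> \<le> c * (\<bar>F' - M\<bar> * \<bar>G'\<bar> + \<bar>M\<bar> * \<bar>G' - m_g\<bar>)"
              using mult_left_mono[OF tri c] c by (simp only: abs_mult[of c] abs_of_nonneg)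
            also have "\<dots> \<le> c * ((\<delta> * F) * G + (P * F) * (\<delta> * G))"
              using c G' F' M F P \<delta> by (intro mult_left_mono add_mono mult_mono) auto
            finally show ?thesis by (simp add: algebra_simps)
          qed
          have "\<bar>?s * Y - c * M * m_g\<bar> \<le> \<delta> * G + 4 * 2 ^ DIM('a) * C * F * (\<delta> * G) + (c * F * (\<delta> * G) + c * P * F * (\<delta> * G))"
            using 1 2 3 by linarith
          also have "\<dots> = \<delta> * K * G" by (simp add: K_def algebra_simps)
          finally show "\<bar>?s * pairing f ((step \<Omega> ^^ (n + 2 * T)) g) - c * M * pairing g \<phi>\<bar>
              \<le> \<delta> * K * mass g" unfolding Y G_def m_g_def .
        qed
      qed
    qed
  qed
  then show ?thesis using K unfolding M_def by blast
qed

text \<open>It remains to absorb the shift by \<open>2 T\<close> into the normalization, as the ratio of the two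
  normalizing factors tends to 1.\<close>

theorem killed_local_limit:
  assumes f: "integrable lborel f" "\<And>x. f x \<ge> 0" and e: "e > 0"
  defines "c \<equiv> 1 / (4 * pi * \<alpha>) powr (real DIM('a) / 2)"
  shows "\<forall>\<^sub>F n in sequentially. \<forall>g. test_function r g \<longrightarrow>
     \<bar>sqrt (real (Suc n)) ^ DIM('a) * pairing f ((step \<Omega> ^^ n) g) - c * pairing f \<phi> * pairing g \<phi>\<bar>
      \<le> e * mass g"
proof -
  obtain P where P: "P \<ge> 0" "\<And>x. \<bar>\<phi> x\<bar> \<le> P" using bounded_borelE[OF \<phi>_bounded] by blast
  define M where "M = c * pairing f \<phi>"
  obtain K where K: "K > 0" "\<And>\<delta>. \<delta> > 0 \<Longrightarrow> \<exists>T. \<forall>\<^sub>F n in sequentially. \<forall>g. test_function r g \<longrightarrow>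
     \<bar>sqrt (real n) ^ DIM('a) * pairing f ((step \<Omega> ^^ (n + 2 * T)) g) - M * pairing g \<phi>\<bar>
      \<le> \<delta> * K * mass g"
    using killed_limit_approximate[OF f P, of r] unfolding M_def c_def by blast
  \<comment> \<open>The total error is \<open>\<delta> * L\<close>: one \<open>K\<close> from the approximation, the rest from the factor \<open>\<rho>\<close>.\<close>
  define L where "L = 2 * K + \<bar>M\<bar> * P"
  have L: "L > 0" using K(1) P(1) by (auto simp: L_def intro!: add_pos_nonneg)
  define \<delta> where "\<delta> = min 1 (e / L)"
  have \<delta>: "\<delta> > 0" "\<delta> \<le> 1" "\<delta> * L \<le> e" using e L by (auto simp: \<delta>_def min_def field_simps)
  obtain T where T: "\<forall>\<^sub>F n in sequentially. \<forall>g. test_function r g \<longrightarrow>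
     \<bar>sqrt (real n) ^ DIM('a) * pairing f ((step \<Omega> ^^ (n + 2 * T)) g) - M * pairing g \<phi>\<bar>
      \<le> \<delta> * K * mass g"
    using K(2)[OF \<delta>(1)] by blast
  \<comment> \<open>The \<open>N\<close>-th power of \<open>\<rho>\<close> converts one normalization into the other.\<close>
  define \<rho> where "\<rho> n = sqrt (real (Suc (n + 2 * T))) / sqrt (real n)" for n
  have "\<rho> \<longlonglongrightarrow> 1" unfolding \<rho>_def by real_asymp
  then have "(\<lambda>n. \<rho> n ^ DIM('a)) \<longlonglongrightarrow> 1 ^ DIM('a)" by (rule tendsto_power)
  then have "\<forall>\<^sub>F n in sequentially. dist (\<rho> n ^ DIM('a)) (1 ^ DIM('a)) < \<delta>"
    using \<delta>(1) by (rule tendstoD)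
  with T have "\<forall>\<^sub>F n in sequentially. \<forall>g. test_function r g \<longrightarrow>
     \<bar>sqrt (real (Suc (n + 2 * T))) ^ DIM('a) * pairing f ((step \<Omega> ^^ (n + 2 * T)) g) - M * pairing g \<phi>\<bar>
      \<le> e * mass g"
    using eventually_ge_at_top[of 1]
  proof eventually_elim
    case (elim n)
    show ?case
    proof (intro allI impI)
      fix g :: "'a \<Rightarrow> real"
      assume tg: "test_function r g"
      then have g: "integrable lborel g" "bounded_borel g" "\<forall>x. g x \<ge> 0" "\<forall>x. norm x > r \<longrightarrow> g x = 0"
        by (auto simp: test_function_def)
      define X where "X = sqrt (real n) ^ DIM('a) * pairing f ((step \<Omega> ^^ (n + 2 * T)) g)"
      define G where "G = mass g"
      define m_g where "m_g = pairing g \<phi>"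
      have G: "G \<ge> 0" unfolding G_def by (intro Bochner_Integration.integral_nonneg) (use g in auto)
      have m_g: "\<bar>m_g\<bar> \<le> P * G"
        using integral_mult_bounded_le[OF g(1), of \<phi> P] P g(3) bounded_borel_meas[OF \<phi>_bounded] by (simp add: m_g_def G_def)
      have X: "\<bar>X - M * m_g\<bar> \<le> \<delta> * K * G" using elim(1) tg by (simp add: X_def m_g_def G_def)
      have \<rho>X: "sqrt (real (Suc (n + 2 * T))) ^ DIM('a) * pairing f ((step \<Omega> ^^ (n + 2 * T)) g) = \<rho> n ^ DIM('a) * X"
        using elim(3) by (simp add: \<rho>_def X_def power_divide)
      have "\<bar>M * m_g\<bar> \<le> \<bar>M\<bar> * (P * G)" unfolding abs_mult by (intro mult_left_mono m_g) auto
      moreover have "\<delta> * K * G \<le> 1 * K * G" using \<delta> K(1) G by (intro mult_right_mono) auto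
      ultimately have XB: "\<bar>X\<bar> \<le> (\<bar>M\<bar> * P + K) * G" using X by (simp add: algebra_simps)
      have "\<bar>\<rho> n ^ DIM('a) * X - M * m_g\<bar> = \<bar>(\<rho> n ^ DIM('a) - 1) * X + (X - M * m_g)\<bar>"
        by (simp add: algebra_simps)
      also have "\<dots> \<le> \<bar>\<rho> n ^ DIM('a) - 1\<bar> * \<bar>X\<bar> + \<bar>X - M * m_g\<bar>"
        by (rule order_trans[OF abs_triangle_ineq]) (simp add: abs_mult)
      also have "\<dots> \<le> \<delta> * ((\<bar>M\<bar> * P + K) * G) + \<delta> * K * G"
        using elim(2) \<delta> XB X by (intro add_mono mult_mono) (auto simp: dist_real_def)
      also have "\<dots> = \<delta> * L * G" by (simp add: L_def algebra_simps)
      also have "\<dots> \<le> e * G" using \<delta>(3) G by (intro mult_right_mono) auto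
      finally show "\<bar>sqrt (real (Suc (n + 2 * T))) ^ DIM('a) * pairing f ((step \<Omega> ^^ (n + 2 * T)) g) - M * pairing g \<phi>\<bar>
          \<le> e * mass g" unfolding \<rho>X m_g_def G_def .
    qed
  qed
  from this[unfolded eventually_sequentially_seg[of "\<lambda>n. \<forall>g. test_function r g \<longrightarrow>
     \<bar>sqrt (real (Suc n)) ^ DIM('a) * pairing f ((step \<Omega> ^^ n) g) - M * pairing g \<phi>\<bar>
      \<le> e * mass g" "2 * T"]]
  show ?thesis unfolding M_def .
qed

end

section \<open>Poisson averages\<close>

text \<open>The expectation of \<open>h\<close> under the Poisson distribution of mean \<open>t\<close>.\<close>

definition poisson_mean :: "real \<Rightarrow> (nat \<Rightarrow> real) \<Rightarrow> real" where
  "poisson_mean t h = (\<Sum>n. exp (- t) * t ^ n / fact n * h n)"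

lemma poisson_weight_sums: "(\<lambda>n. exp (- t) * t ^ n / fact n :: real) sums 1"
proof -
  have "(\<lambda>n. exp (- t) * (t ^ n /\<^sub>R fact n)) sums (exp (- t) * exp t)"
    by (intro sums_mult exp_converges)
  then show ?thesis by (simp add: divide_inverse mult_ac flip: exp_add)
qed

lemma poisson_weight_nonneg: "t \<ge> 0 \<Longrightarrow> exp (- t) * t ^ n / fact n \<ge> (0::real)"
  by simp

lemma poisson_summable:
  fixes h :: "nat \<Rightarrow> real"
  assumes t: "t \<ge> 0" and h: "Bseq h"
  shows "summable (\<lambda>n. exp (- t) * t ^ n / fact n * h n)"
proof -
  obtain K where K: "\<And>n. \<bar>h n\<bar> \<le> K" using h by (auto simp: Bseq_def)
  show ?thesis
  proof (rule summable_comparison_test')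
    show "summable (\<lambda>n. exp (- t) * t ^ n / fact n * K)"
      using poisson_weight_sums[of t] by (intro summable_mult2) (rule sums_summable)
    show "norm (exp (- t) * t ^ n / fact n * h n) \<le> exp (- t) * t ^ n / fact n * K" for n
      using K[of n] poisson_weight_nonneg[OF t, of n] t
      by (auto simp: abs_mult intro!: mult_left_mono divide_right_mono)
  qed
qed

lemma poisson_mean_mono:
  assumes "t \<ge> 0" "Bseq h" "Bseq k" "\<And>n. h n \<le> k n"
  shows "poisson_mean t h \<le> poisson_mean t k"
  unfolding poisson_mean_def
  by (intro suminf_le poisson_summable assms mult_left_mono poisson_weight_nonneg)

lemma poisson_mean_add:
  "t \<ge> 0 \<Longrightarrow> Bseq h \<Longrightarrow> Bseq k \<Longrightarrow> poisson_mean t (\<lambda>n. h n + k n) = poisson_mean t h + poisson_mean t k"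
  unfolding poisson_mean_def distrib_left by (intro suminf_add[symmetric] poisson_summable)

lemma poisson_mean_cmult:
  "t \<ge> 0 \<Longrightarrow> Bseq h \<Longrightarrow> poisson_mean t (\<lambda>n. c * h n) = c * poisson_mean t h"
  unfolding poisson_mean_def
  using suminf_mult[OF poisson_summable, of t h c] by (simp add: mult_ac)

lemma Bseq_cmult:
  fixes h :: "nat \<Rightarrow> real"
  assumes "Bseq h" shows "Bseq (\<lambda>n. c * h n)"
proof -
  obtain K where "\<And>n. \<bar>h n\<bar> \<le> K" using assms by (auto simp: Bseq_def)
  then show ?thesis by (intro BseqI'[where K="\<bar>c\<bar> * K"]) (auto simp: abs_mult intro!: mult_left_mono)
qed

lemma Bseq_plus:
  fixes h k :: "nat \<Rightarrow> real"
  assumes "Bseq h" "Bseq k" shows "Bseq (\<lambda>n. h n + k n)"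
proof -
  obtain K where K: "\<And>n. \<bar>h n\<bar> \<le> K" using assms(1) by (auto simp: Bseq_def)
  obtain L where L: "\<And>n. \<bar>k n\<bar> \<le> L" using assms(2) by (auto simp: Bseq_def)
  show ?thesis
  proof (rule BseqI'[where K="K + L"])
    show "norm (h n + k n) \<le> K + L" for n
      using abs_triangle_ineq[of "h n" "k n"] K[of n] L[of n] by simp
  qed
qed

lemma Bseq_fin_support: "Bseq (\<lambda>n::nat. if n < k then c else 0 :: real)"
  by (rule BseqI'[where K="\<bar>c\<bar>"]) simp

lemma Bseq_le:
  fixes h k :: "nat \<Rightarrow> real"
  assumes "Bseq k" "\<And>n. \<bar>h n\<bar> \<le> k n" shows "Bseq h"
proof -
  obtain K where K: "\<And>n. \<bar>k n\<bar> \<le> K" using assms(1) by (auto simp: Bseq_def)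
  show ?thesis
  proof (rule BseqI'[where K=K])
    show "norm (h n) \<le> K" for n using assms(2)[of n] K[of n] by simp
  qed
qed

lemma poisson_mean_abs_diff_le:
  assumes t: "t \<ge> 0" and h: "Bseq h" "Bseq k" "Bseq d" and le: "\<And>n. \<bar>h n - k n\<bar> \<le> d n"
  shows "\<bar>poisson_mean t h - poisson_mean t k\<bar> \<le> poisson_mean t d"
proof -
  have "poisson_mean t h \<le> poisson_mean t (\<lambda>n. k n + d n)"
    by (intro poisson_mean_mono t h Bseq_plus) (use le in \<open>auto simp: abs_le_iff algebra_simps\<close>)
  moreover have "poisson_mean t k \<le> poisson_mean t (\<lambda>n. h n + d n)"
    by (intro poisson_mean_mono t h Bseq_plus) (use le in \<open>auto simp: abs_le_iff algebra_simps\<close>)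
  ultimately show ?thesis by (simp add: poisson_mean_add t h abs_le_iff)
qed

lemma poisson_mean_initial_segment:
  "((\<lambda>t. t ^ j * poisson_mean t (\<lambda>n. if n < k then 1 else 0)) \<longlongrightarrow> 0) at_top"
proof -
  have eq: "t ^ j * poisson_mean t (\<lambda>n. if n < k then 1 else 0) = (\<Sum>n<k. t ^ (j + n) / exp t * (1 / fact n))" for t
  proof -
    have "poisson_mean t (\<lambda>n. if n < k then 1 else 0) = (\<Sum>n<k. exp (- t) * t ^ n / fact n * (if n < k then 1 else 0))"
      unfolding poisson_mean_def by (rule suminf_finite) auto
    also have "\<dots> = (\<Sum>n<k. exp (- t) * t ^ n / fact n)" by (intro sum.cong) auto
    finally show ?thesis by (simp add: sum_distrib_left power_add exp_minus field_simps)
  qed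
  have "((\<lambda>t::real. \<Sum>n<k. t ^ (j + n) / exp t * (1 / fact n)) \<longlongrightarrow> (\<Sum>n<k. 0 * (1 / fact n))) at_top"
    by (rule tendsto_sum, rule tendsto_mult[OF tendsto_power_div_exp_0 tendsto_const])
  then show ?thesis unfolding eq by simp
qed

text \<open>The factor \<open>t ^ j * n! / (n + j)!\<close> shifts the Poisson weights by \<open>j\<close>, so that only the first \<open>j\<close>
  of them are missing.\<close>

lemma poisson_mean_falling:
  assumes t: "t \<ge> 0"
  shows "poisson_mean t (\<lambda>n. t ^ j * (fact n / fact (n + j))) = 1 - poisson_mean t (\<lambda>n. if n < j then 1 else 0)"
proof -
  let ?w = "\<lambda>n. exp (- t) * t ^ n / fact n"
  have "poisson_mean t (\<lambda>n. t ^ j * (fact n / fact (n + j))) = (\<Sum>n. ?w (n + j))"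
    unfolding poisson_mean_def by (intro suminf_cong) (simp add: power_add field_simps)
  also have "\<dots> = (\<Sum>n. ?w n) - (\<Sum>n<j. ?w n)"
    using poisson_weight_sums[of t] by (intro suminf_minus_initial_segment) (rule sums_summable)
  also have "(\<Sum>n. ?w n) = 1" using poisson_weight_sums[of t] by (rule sums_unique[symmetric])
  also have "(\<Sum>n<j. ?w n) = poisson_mean t (\<lambda>n. if n < j then 1 else 0)"
  proof -
    have "poisson_mean t (\<lambda>n. if n < j then 1 else 0) = (\<Sum>n<j. ?w n * (if n < j then 1 else 0))"
      unfolding poisson_mean_def by (rule suminf_finite) auto
    then show ?thesis by simp
  qed
  finally show ?thesis .
qed

lemma rising_power_ratio: "(\<lambda>n. fact (n + j) / (fact n * (real n + 1) ^ j)) \<longlonglongrightarrow> 1"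
proof (induction j)
  case (Suc j)
  have "(\<lambda>n. (fact (n + j) / (fact n * (real n + 1) ^ j)) * ((real n + real j + 1) / (real n + 1))) \<longlonglongrightarrow> 1 * 1"
    by (intro tendsto_mult Suc) real_asymp
  then show ?case by (simp add: mult_ac add_ac)
qed simp

lemma divide_ge_1_le: "x \<ge> 0 \<Longrightarrow> y \<ge> 1 \<Longrightarrow> x / y \<le> x" for x y :: real
  using divide_left_mono[of 1 y x] by simp

lemma Bseq_inverse_power:
  assumes "t \<ge> 0" shows "Bseq (\<lambda>n. (t / (real n + 1)) ^ j)"
proof (rule BseqI'[where K="t ^ j"])
  fix n
  have "(t / (real n + 1)) ^ j \<le> t ^ j" using assms by (intro power_mono divide_ge_1_le) auto
  then show "norm ((t / (real n + 1)) ^ j) \<le> t ^ j" using assms by simp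
qed

text \<open>The ratio of \<open>1 / (n + 1) ^ j\<close> and \<open>n! / (n + j)!\<close> tends to 1, and any fixed number of initial terms
  is exponentially small.\<close>

lemma poisson_inverse_moments: "((\<lambda>t. poisson_mean t (\<lambda>n. (t / (real n + 1)) ^ j)) \<longlongrightarrow> 1) at_top"
proof (rule tendstoI)
  fix e :: real assume "e > 0"
  define \<delta> where "\<delta> = min (e / 4) 1"
  have \<delta>: "\<delta> > 0" "\<delta> \<le> e / 4" "\<delta> \<le> 1" using \<open>e > 0\<close> by (auto simp: \<delta>_def)
  have "\<forall>\<^sub>F n in sequentially. fact (n + j) / (fact n * (real n + 1) ^ j) < 1 + \<delta>"
    using rising_power_ratio \<delta>(1) by (intro order_tendstoD) auto
  then obtain k where k: "\<And>n. n \<ge> k \<Longrightarrow> fact (n + j) / (fact n * (real n + 1) ^ j) < 1 + \<delta>"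
    unfolding eventually_sequentially by blast
  let ?I = "\<lambda>k n::nat. if n < k then 1 else 0 :: real"
  have "\<forall>\<^sub>F t in at_top. t ^ 0 * poisson_mean t (?I j) < \<delta>" "\<forall>\<^sub>F t in at_top. t ^ j * poisson_mean t (?I k) < \<delta>"
    using \<delta>(1) by (intro order_tendstoD(2)[OF poisson_mean_initial_segment]; simp)+
  then show "\<forall>\<^sub>F t in at_top. dist (poisson_mean t (\<lambda>n. (t / (real n + 1)) ^ j)) 1 < e"
    using eventually_gt_at_top[of 0]
  proof eventually_elim
    case (elim t)
    then have t: "t \<ge> 0" "t > 0" by auto
    let ?X = "\<lambda>n. (t / (real n + 1)) ^ j" and ?Y = "\<lambda>n. t ^ j * (fact n / fact (n + j))"
    have YX: "?Y n \<le> ?X n" for n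
    proof -
      have "(fact n :: real) * (real n + 1) ^ j \<le> fact (n + j)"
      proof (induction j)
        case (Suc j)
        have "(fact n :: real) * (real n + 1) ^ Suc j = (real n + 1) * (fact n * (real n + 1) ^ j)" by simp
        also have "\<dots> \<le> (real n + real j + 1) * fact (n + j)" using Suc by (intro mult_mono) auto
        finally show ?case by (simp add: add_ac)
      qed simp
      then have "(fact n :: real) / fact (n + j) \<le> 1 / (real n + 1) ^ j"
        by (simp add: field_simps)
      then have "t ^ j * (fact n / fact (n + j)) \<le> t ^ j * (1 / (real n + 1) ^ j)"
        using t by (intro mult_left_mono) auto
      then show ?thesis by (simp add: power_divide)
    qed
    have BX: "Bseq ?X" using t(1) by (rule Bseq_inverse_power)
    have BY: "Bseq ?Y" by (rule Bseq_le[OF BX]) (use YX t in \<open>simp add: abs_of_nonneg\<close>)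
    have XY: "?X n \<le> (1 + \<delta>) * ?Y n + t ^ j * ?I k n" for n
    proof (cases "n < k")
      case True
      have "t / (real n + 1) \<le> t" using t by (intro divide_ge_1_le) auto
      then have "?X n \<le> t ^ j" using t by (intro power_mono) auto
      moreover have "0 \<le> (1 + \<delta>) * ?Y n" using t \<delta> by (intro mult_nonneg_nonneg) auto
      ultimately show ?thesis using True by simp
    next
      case False
      then have "fact (n + j) / (fact n * (real n + 1) ^ j) \<le> 1 + \<delta>" using k[of n] by simp
      then have "1 / (real n + 1) ^ j \<le> (1 + \<delta>) * (fact n / fact (n + j))"
        by (simp add: divide_le_eq le_divide_eq mult_ac)
      then have "t ^ j * (1 / (real n + 1) ^ j) \<le> t ^ j * ((1 + \<delta>) * (fact n / fact (n + j)))"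
        using t by (intro mult_left_mono) auto
      then show ?thesis using False by (simp add: power_divide mult_ac)
    qed
    have Y1: "poisson_mean t ?Y = 1 - poisson_mean t (?I j)" by (rule poisson_mean_falling[OF t(1)])
    have I0: "poisson_mean t (?I k) \<ge> 0" for k
      unfolding poisson_mean_def using poisson_weight_nonneg[OF t(1)]
      by (intro suminf_nonneg poisson_summable t Bseq_fin_support) auto
    have pY: "poisson_mean t ?Y \<le> 1" "poisson_mean t ?Y \<ge> 1 - \<delta>"
      unfolding Y1 using I0[of j] elim(1) by simp_all
    have low: "poisson_mean t ?Y \<le> poisson_mean t ?X" by (intro poisson_mean_mono t BX BY YX)
    have "poisson_mean t ?X \<le> poisson_mean t (\<lambda>n. (1 + \<delta>) * ?Y n + t ^ j * ?I k n)"
      by (intro poisson_mean_mono t BX Bseq_plus Bseq_cmult BY Bseq_fin_support XY)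
    also have "\<dots> = (1 + \<delta>) * poisson_mean t ?Y + t ^ j * poisson_mean t (?I k)"
      by (simp only: poisson_mean_add poisson_mean_cmult t(1) BY Bseq_cmult Bseq_fin_support)
    also have "\<dots> \<le> (1 + \<delta>) * 1 + \<delta>"
      using \<delta> pY(1) elim(2) by (intro add_mono mult_left_mono) auto
    finally have "poisson_mean t ?X \<le> 1 + 2 * \<delta>" by simp
    moreover have "1 - \<delta> \<le> poisson_mean t ?X" using order_trans[OF pY(2) low] .
    ultimately show ?case using \<delta> \<open>e > 0\<close> by (auto simp: dist_real_def abs_le_iff abs_less_iff)
  qed
qed

text \<open>Half-integer powers: \<open>X = (t / (n + 1))\<^sup>N\<^sup>/\<^sup>2\<close> satisfies
  \<open>|X - 1| \<le> |X\<^sup>2 - 1| \<le> \<eta> + (X\<^sup>2 - 1)\<^sup>2 / \<eta>\<close>, and the expectation of \<open>(X\<^sup>2 - 1)\<^sup>2\<close> tends to \<open>1 - 2 + 1 = 0\<close> by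
  the integer case.\<close>

lemma poisson_inverse_sqrt_moments:
  "((\<lambda>t. poisson_mean t (\<lambda>n. (sqrt t / sqrt (real n + 1)) ^ N)) \<longlongrightarrow> 1) at_top"
proof -
  define m where "m j t = poisson_mean t (\<lambda>n. (t / (real n + 1)) ^ j)" for j t
  have m: "(m j \<longlongrightarrow> 1) at_top" for j unfolding m_def by (rule poisson_inverse_moments)
  have "((\<lambda>t. poisson_mean t (\<lambda>n. (sqrt t / sqrt (real n + 1)) ^ N) - m 0 t) \<longlongrightarrow> 0) at_top"
  proof (rule tendstoI)
    fix e :: real assume e: "e > 0"
    define \<eta> where "\<eta> = e / 3"
    have \<eta>: "\<eta> > 0" using e by (simp add: \<eta>_def)
    have "((\<lambda>t. \<eta> * m 0 t + (1 / \<eta>) * (m (2 * N) t + ((- 2) * m N t + m 0 t))) \<longlongrightarrow> \<eta> * 1 + (1 / \<eta>) * (1 + ((- 2) * 1 + 1))) at_top"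
      by (intro tendsto_intros m)
    moreover have "\<eta> * 1 + (1 / \<eta>) * (1 + ((- 2) * 1 + 1)) < e" using e by (simp add: \<eta>_def)
    ultimately have "\<forall>\<^sub>F t in at_top. \<eta> * m 0 t + (1 / \<eta>) * (m (2 * N) t + ((- 2) * m N t + m 0 t)) < e"
      by (rule order_tendstoD(2))
    then show "\<forall>\<^sub>F t in at_top. dist (poisson_mean t (\<lambda>n. (sqrt t / sqrt (real n + 1)) ^ N) - m 0 t) 0 < e"
      using eventually_ge_at_top[of 0]
    proof eventually_elim
      case (elim t)
      define X where "X n = (sqrt t / sqrt (real n + 1)) ^ N" for n :: nat
      define Z where "Z j n = (t / (real n + 1)) ^ j" for j and n :: nat
      have X: "X n \<ge> 0" "(X n)\<^sup>2 = Z N n" for n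
        using elim(2) by (simp_all add: X_def Z_def power_divide flip: power_mult) (simp add: mult.commute[of N] power_mult)
      have Z: "Z 0 n = 1" "Z (2 * N) n = (Z N n)\<^sup>2" for n
        by (simp_all add: Z_def power_mult mult.commute[of 2])
      have BZ: "Bseq (\<lambda>n. Z j n)" for j unfolding Z_def using elim(2) by (rule Bseq_inverse_power)
      \<comment> \<open>The constant 1 is written as \<open>Z 0\<close>, so that all expectations are instances of \<open>m\<close>.\<close>
      define D where "D n = \<eta> * Z 0 n + (1 / \<eta>) * (Z (2 * N) n + ((- 2) * Z N n + Z 0 n))" for n
      have BD: "Bseq D" unfolding D_def by (intro Bseq_plus Bseq_cmult BZ)
      have XD: "\<bar>X n - Z 0 n\<bar> \<le> D n" for n
      proof -
        have "\<bar>X n - 1\<bar> * 1 \<le> \<bar>X n - 1\<bar> * \<bar>X n + 1\<bar>" using X(1)[of n] by (intro mult_left_mono) auto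
        also have "\<dots> = \<bar>Z N n - 1\<bar>"
          unfolding X(2)[symmetric] abs_mult[symmetric] by (simp add: power2_eq_square algebra_simps)
        also have "\<dots> \<le> (\<eta>\<^sup>2 + (Z N n - 1)\<^sup>2) / \<eta>"
        proof -
          have "0 \<le> \<eta> * \<bar>Z N n - 1\<bar>" using \<eta> by simp
          then have "\<eta> * \<bar>Z N n - 1\<bar> \<le> \<eta>\<^sup>2 + (Z N n - 1)\<^sup>2"
            using sum_squares_bound[of \<eta> "\<bar>Z N n - 1\<bar>"] by simp
          then show ?thesis using \<eta> by (simp add: pos_le_divide_eq mult.commute)
        qed
        also have "\<dots> = D n" unfolding D_def Z using \<eta> by (simp add: power2_eq_square field_simps)
        finally show ?thesis by (simp add: Z)
      qed
      have BX: "Bseq X"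
        by (rule Bseq_le[OF Bseq_plus[OF BD BZ[of 0]]]) (use XD X(1) in \<open>auto simp: abs_le_iff algebra_simps\<close>)
      have "\<bar>poisson_mean t X - poisson_mean t (Z 0)\<bar> \<le> poisson_mean t D"
        by (rule poisson_mean_abs_diff_le[OF elim(2) BX BZ BD XD])
      also have "poisson_mean t D = \<eta> * poisson_mean t (Z 0) + (1 / \<eta>) * (poisson_mean t (Z (2 * N)) + ((- 2) * poisson_mean t (Z N) + poisson_mean t (Z 0)))"
        unfolding D_def by (simp only: poisson_mean_add poisson_mean_cmult elim(2) BZ Bseq_plus Bseq_cmult)
      finally show ?case using elim(1) by (simp add: X_def[abs_def] Z_def[abs_def] m_def dist_real_def)
    qed
  qed
  from tendsto_add[OF this m[of 0]] show ?thesis by simp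
qed

text \<open>An Abelian theorem: decay of a sequence at rate \<open>n\<^sup>-\<^sup>N\<^sup>/\<^sup>2\<close> passes to its Poisson means.  The scale \<open>G\<close>
  is quantified inside, because the limit has to be uniform over test functions \<open>g\<close> of mass \<open>G\<close>.
  The first \<open>n0\<close> terms, of which only a bound is known, have exponentially small weight.\<close>

theorem poisson_abelian:
  fixes N n0 :: nat
  assumes e: "e > 0" and BL: "B \<ge> 0" "L \<ge> 0"
  shows "\<forall>\<^sub>F t in at_top. \<forall>b l G. G \<ge> 0 \<longrightarrow> (\<forall>n. \<bar>b n\<bar> \<le> B * G) \<longrightarrow> \<bar>l\<bar> \<le> L * G \<longrightarrow>
     (\<forall>n\<ge>n0. \<bar>sqrt (real (Suc n)) ^ N * b n - l\<bar> \<le> e * G) \<longrightarrow>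
     \<bar>sqrt t ^ N * poisson_mean t b - l\<bar> \<le> 3 * e * G"
proof -
  define m where "m j t = poisson_mean t (\<lambda>n. (sqrt t / sqrt (real n + 1)) ^ j)" for j t
  have m: "(m j \<longlongrightarrow> 1) at_top" for j unfolding m_def by (rule poisson_inverse_sqrt_moments)
  let ?I = "\<lambda>n. if n < n0 then 1 else 0 :: real"
  have I: "((\<lambda>t. sqrt t ^ N * poisson_mean t ?I) \<longlongrightarrow> 0) at_top"
  proof (rule Lim_null_comparison)
    show "\<forall>\<^sub>F t in at_top. norm (sqrt t ^ N * poisson_mean t ?I) \<le> t ^ N * poisson_mean t ?I"
      using eventually_ge_at_top[of 1]
    proof eventually_elim
      case (elim t)
      have "poisson_mean t ?I \<ge> 0"
        unfolding poisson_mean_def using elim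
        by (intro suminf_nonneg poisson_summable Bseq_fin_support) auto
      moreover have "sqrt t ^ N \<le> t ^ N"
      proof (rule power_mono)
        have "sqrt t * 1 \<le> sqrt t * sqrt t" using elim by (intro mult_left_mono) auto
        then show "sqrt t \<le> t" using elim by simp
      qed (use elim in auto)
      ultimately show ?case using elim by (simp add: abs_mult mult_right_mono)
    qed
  qed (rule poisson_mean_initial_segment)
  have "((\<lambda>t. e * m N t + ((B + L) * (sqrt t ^ N * poisson_mean t ?I) + L * \<bar>m N t - 1\<bar>)) \<longlongrightarrow> e * 1 + ((B + L) * 0 + L * \<bar>1 - 1\<bar>)) at_top"
    by (intro tendsto_intros m I)
  moreover have "e * 1 + ((B + L) * 0 + L * \<bar>1 - 1\<bar>) < 3 * e" using e by simp
  ultimately have "\<forall>\<^sub>F t in at_top. e * m N t + ((B + L) * (sqrt t ^ N * poisson_mean t ?I) + L * \<bar>m N t - 1\<bar>) < 3 * e"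
    by (rule order_tendstoD(2))
  then show ?thesis using eventually_ge_at_top[of 1]
  proof eventually_elim
    case (elim t)
    then have t: "t \<ge> 0" by simp
    show ?case
    proof (intro allI impI)
      fix b :: "nat \<Rightarrow> real" and l G :: real
      assume G: "G \<ge> 0" and b: "\<forall>n. \<bar>b n\<bar> \<le> B * G" and l: "\<bar>l\<bar> \<le> L * G"
        and lim: "\<forall>n\<ge>n0. \<bar>sqrt (real (Suc n)) ^ N * b n - l\<bar> \<le> e * G"
      define X where "X n = (sqrt t / sqrt (real n + 1)) ^ N" for n :: nat
      have X: "0 \<le> X n" "X n \<le> sqrt t ^ N" for n
        using t by (auto simp: X_def intro!: power_mono divide_ge_1_le)
      have BX: "Bseq X" by (rule BseqI'[where K="sqrt t ^ N"]) (use X in auto)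
      have Bb: "Bseq b" by (rule BseqI'[where K="B * G"]) (use b in auto)
      define D where "D n = e * G * X n + (B + L) * G * sqrt t ^ N * ?I n" for n
      have BD: "Bseq D" unfolding D_def by (intro Bseq_plus Bseq_cmult BX Bseq_fin_support)
      have le: "\<bar>sqrt t ^ N * b n - l * X n\<bar> \<le> D n" for n
      proof (cases "n < n0")
        case True
        have "\<bar>sqrt t ^ N * b n - l * X n\<bar> \<le> sqrt t ^ N * \<bar>b n\<bar> + \<bar>l\<bar> * X n"
          using abs_triangle_ineq4[of "sqrt t ^ N * b n" "l * X n"] X(1)[of n] t by (simp add: abs_mult)
        also have "\<dots> \<le> sqrt t ^ N * (B * G) + (L * G) * sqrt t ^ N"
          using b l X[of n] BL G t by (intro add_mono mult_left_mono mult_mono) auto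
        also have "\<dots> \<le> D n" using True X(1)[of n] e G by (simp add: D_def algebra_simps)
        finally show ?thesis .
      next
        case False
        have "sqrt t ^ N * b n - l * X n = X n * (sqrt (real (Suc n)) ^ N * b n - l)"
          by (simp add: X_def power_divide right_diff_distrib add.commute)
        then have "\<bar>sqrt t ^ N * b n - l * X n\<bar> = X n * \<bar>sqrt (real (Suc n)) ^ N * b n - l\<bar>"
          using X(1)[of n] by (simp add: abs_mult)
        also have "\<dots> \<le> X n * (e * G)" using lim False X(1)[of n] by (intro mult_left_mono) auto
        finally show ?thesis using False by (simp add: D_def mult_ac)
      qed
      have "\<bar>poisson_mean t (\<lambda>n. sqrt t ^ N * b n) - poisson_mean t (\<lambda>n. l * X n)\<bar> \<le> poisson_mean t D"
        by (intro poisson_mean_abs_diff_le t Bseq_cmult Bb BX BD le)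
      also have "poisson_mean t D = e * G * m N t + (B + L) * G * sqrt t ^ N * poisson_mean t ?I"
        unfolding D_def by (simp only: poisson_mean_add poisson_mean_cmult t BX Bseq_cmult Bseq_fin_support) (simp add: m_def X_def)
      finally have 1: "\<bar>sqrt t ^ N * poisson_mean t b - l * m N t\<bar> \<le> e * G * m N t + (B + L) * G * sqrt t ^ N * poisson_mean t ?I"
        by (simp add: poisson_mean_cmult t Bb BX) (simp add: m_def X_def)
      have 2: "\<bar>l * m N t - l\<bar> \<le> L * G * \<bar>m N t - 1\<bar>"
      proof -
        have "\<bar>l * m N t - l\<bar> = \<bar>l\<bar> * \<bar>m N t - 1\<bar>" by (simp add: right_diff_distrib flip: abs_mult)
        also have "\<dots> \<le> L * G * \<bar>m N t - 1\<bar>" by (intro mult_right_mono l) simp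
        finally show ?thesis .
      qed
      have "\<bar>sqrt t ^ N * poisson_mean t b - l\<bar>
        \<le> (e * m N t + ((B + L) * (sqrt t ^ N * poisson_mean t ?I) + L * \<bar>m N t - 1\<bar>)) * G"
        using 1 2 by (simp add: algebra_simps)
      also have "\<dots> \<le> 3 * e * G" using elim(1) G by (intro mult_right_mono) auto
      finally show "\<bar>sqrt t ^ N * poisson_mean t b - l\<bar> \<le> 3 * e * G" .
    qed
  qed
qed

section \<open>The evolution problem in weak form\<close>

text \<open>The functions \<open>exp t * m n t\<close> are successive derivatives of each other, and Taylor expansion at 0
  gives the Poisson weights.  The equation holds only for \<open>t > 0\<close>, so the initial values are recovered
  by continuity.\<close>

lemma poisson_representation:
  fixes m :: "nat \<Rightarrow> real \<Rightarrow> real" and c :: "nat \<Rightarrow> real"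
  assumes cont: "\<And>n. continuous_on {0..} (m n)"
    and eq: "\<And>n t. t > 0 \<Longrightarrow> ((\<lambda>s. m (Suc n) s - m n s) has_integral (m n t - c n)) {0..t}"
    and bound: "\<And>n s. s \<in> {0..b} \<Longrightarrow> \<bar>m n s\<bar> \<le> U"
    and b: "b > 0"
  shows "m 0 b = poisson_mean b c"
proof -
  have cb: "continuous_on {0..b} (\<lambda>s. m (Suc n) s - m n s)" for n
    by (intro continuous_on_diff continuous_on_subset[OF cont]) auto
  have m_int: "m n t = c n + integral {0..t} (\<lambda>s. m (Suc n) s - m n s)" if "t > 0" for n t
    using integral_unique[OF eq[OF that]] by simp
  have D0: "((\<lambda>u. c n + integral {0..u} (\<lambda>s. m (Suc n) s - m n s)) has_vector_derivative (m (Suc n) t - m n t)) (at t within {0..b})"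
    if "t \<in> {0..b}" for n t
    using integral_has_vector_derivative[OF cb that] by (auto intro!: derivative_eq_intros)
  have m0: "m n 0 = c n" for n
  proof -
    have "((\<lambda>u. c n + integral {0..u} (\<lambda>s. m (Suc n) s - m n s)) \<longlongrightarrow> c n + integral {0..0} (\<lambda>s. m (Suc n) s - m n s)) (at 0 within {0..b})"
      using has_vector_derivative_continuous[OF D0[of 0 n]] b by (simp add: continuous_within)
    then have "((\<lambda>u. c n + integral {0..u} (\<lambda>s. m (Suc n) s - m n s)) \<longlongrightarrow> c n) (at 0 within {0..b})"
      by simp
    then have "(m n \<longlongrightarrow> c n) (at 0 within {0..b})"
      by (rule Lim_transform_eventually) (use m_int in \<open>auto simp: eventually_at_filter intro!: always_eventually\<close>)
    moreover have "(m n \<longlongrightarrow> m n 0) (at 0 within {0..b})"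
      using continuous_on_subset[OF cont[of n], of "{0..b}"] b by (auto simp: continuous_on_def)
    moreover have "at 0 within {0..b} \<noteq> bot"
      using b by (simp add: trivial_limit_within)
    ultimately show ?thesis by (metis tendsto_unique)
  qed
  have Dm: "(m n has_vector_derivative (m (Suc n) t - m n t)) (at t within {0..b})" if t: "t \<in> {0..b}" for n t
  proof (rule has_vector_derivative_transform[OF t _ D0[OF t]])
    show "m n x = c n + integral {0..x} (\<lambda>s. m (Suc n) s - m n s)" if "x \<in> {0..b}" for x
      using that m_int[of x n] m0[of n] by (cases "x = 0") auto
  qed
  define W where "W n t = exp t * m n t" for n t
  have DW: "(W n has_vector_derivative W (Suc n) t) (at t within {0..b})" if "0 \<le> t" "t \<le> b" for n t
    unfolding W_def
    using that Dm[of t n] by (auto intro!: derivative_eq_intros simp: has_real_derivative_iff_has_vector_derivative[symmetric] algebra_simps)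
  have rem: "\<bar>W 0 b - (\<Sum>i<p. b ^ i / fact i * c i)\<bar> \<le> (b ^ (p - 1) / fact (p - 1)) * (exp b * U * b)" if p: "p > 0" for p
  proof -
    let ?i = "\<lambda>x. ((b - x) ^ (p - 1) / fact (p - 1)) *\<^sub>R W p x"
    have "W 0 b - (\<Sum>i<p. b ^ i / fact i * c i) = integral {0..b} ?i"
      using Taylor_integral[where Df=W and f="W 0" and a=0 and b=b, OF p refl DW] b by (simp add: W_def m0)
    also have "norm \<dots> \<le> integral {0..b} (\<lambda>_. (b ^ (p - 1) / fact (p - 1)) * (exp b * U))"
    proof (rule integral_norm_bound_integral)
      show "?i integrable_on {0..b}"
        using Taylor_integrable[where Df=W and f="W 0" and a=0 and b=b, OF p refl DW] b by simp
      show "norm (?i x) \<le> (b ^ (p - 1) / fact (p - 1)) * (exp b * U)" if x: "x \<in> {0..b}" for x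
      proof -
        have "\<bar>(b - x) ^ (p - 1) / fact (p - 1)\<bar> \<le> b ^ (p - 1) / fact (p - 1)"
          using x by (auto intro!: divide_right_mono power_mono)
        moreover have "\<bar>W p x\<bar> \<le> exp b * U"
          unfolding W_def abs_mult using x bound[OF x, of p] by (intro mult_mono) auto
        ultimately show ?thesis
          unfolding real_norm_def real_scaleR_def abs_mult using b by (intro mult_mono) auto
      qed
    qed auto
    finally show ?thesis using b by (simp add: mult_ac)
  qed
  have "(\<lambda>p. (b ^ p / fact p) * (exp b * U * b)) \<longlonglongrightarrow> 0"
    using summable_LIMSEQ_zero[OF summable_exp[of b]] by (intro tendsto_mult_left_zero) (simp add: divide_inverse mult.commute)
  then have "(\<lambda>p. W 0 b - (\<Sum>i<Suc p. b ^ i / fact i * c i)) \<longlonglongrightarrow> 0"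
  proof (rule Lim_null_comparison[rotated], intro always_eventually allI)
    show "norm (W 0 b - (\<Sum>i<Suc p. b ^ i / fact i * c i)) \<le> (b ^ p / fact p) * (exp b * U * b)" for p
      using rem[of "Suc p"] by (simp del: sum.lessThan_Suc)
  qed
  then have "(\<lambda>p. \<Sum>i<Suc p. b ^ i / fact i * c i) \<longlonglongrightarrow> W 0 b"
    using tendsto_diff[OF tendsto_const[of "W 0 b"]] by fastforce
  then have "(\<lambda>i. b ^ i / fact i * c i) sums W 0 b"
    unfolding sums_def by (rule LIMSEQ_imp_Suc)
  then have "(\<lambda>i. exp (- b) * (b ^ i / fact i * c i)) sums (exp (- b) * W 0 b)"
    by (rule sums_mult)
  then have "(\<lambda>i. exp (- b) * b ^ i / fact i * c i) sums m 0 b"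
    by (simp add: W_def mult.assoc[symmetric] flip: exp_add)
  then show ?thesis unfolding poisson_mean_def by (rule sums_unique)
qed

lemma borel_representative:
  fixes f :: "'a::euclidean_space \<Rightarrow> real"
  assumes "f \<in> borel_measurable lebesgue"
  obtains g where "g \<in> borel_measurable borel" "AE x in lborel. f x = g x"
  using completion_ex_borel_measurable_real[OF assms] by auto

lemma bounded_borel_lebesgue: "bounded_borel f \<Longrightarrow> f \<in> borel_measurable lebesgue"
  by (intro measurable_completion) (auto dest: bounded_borel_meas)

lemma lebesgue_integrable_mult_bounded:
  fixes f :: "'a::euclidean_space \<Rightarrow> real"
  assumes f: "integrable lebesgue f" and g: "bounded_borel g"
  shows "integrable lebesgue (\<lambda>x. f x * g x)"
proof -
  obtain C where C: "C \<ge> 0" "\<And>x. \<bar>g x\<bar> \<le> C" using g by (rule bounded_borelE) blast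
  show ?thesis
  proof (rule Bochner_Integration.integrable_bound[OF integrable_mult_left[OF integrable_abs[OF f], of C]])
    show "(\<lambda>x. f x * g x) \<in> borel_measurable lebesgue"
      by (intro borel_measurable_times borel_measurable_integrable[OF f] bounded_borel_lebesgue g)
  qed (use C in \<open>auto simp: abs_mult intro!: mult_left_mono\<close>)
qed

lemma lebesgue_integral_mult_bounded_le:
  fixes f :: "'a::euclidean_space \<Rightarrow> real"
  assumes f: "integrable lebesgue f" and g: "bounded_borel g" "\<And>x. \<bar>g x\<bar> \<le> C"
  shows "\<bar>LINT x|lebesgue. f x * g x\<bar> \<le> C * (LINT x|lebesgue. \<bar>f x\<bar>)"
proof -
  have "\<bar>LINT x|lebesgue. f x * g x\<bar> \<le> (LINT x|lebesgue. \<bar>f x * g x\<bar>)" by (rule integral_abs_bound)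
  also have "\<dots> \<le> (LINT x|lebesgue. \<bar>f x\<bar> * C)"
    using f g by (intro integral_mono integrable_abs lebesgue_integrable_mult_bounded integrable_mult_left)
      (auto simp: abs_mult intro!: mult_left_mono)
  finally show ?thesis by (simp add: mult.commute)
qed

text \<open>Pairing with a bounded function maps the \<open>L\<^sup>1\<close>-valued Riemann sums to real ones.\<close>

lemma L1_integral_pairing:
  assumes F: "has_L1_integral f F a b" and \<psi>: "bounded_borel \<psi>"
  shows "((\<lambda>s. LINT x|lebesgue. f s x * \<psi> x) has_integral (LINT x|lebesgue. F x * \<psi> x)) {a..b}"
  unfolding has_integral_real
proof (intro allI impI)
  fix e :: real assume e: "e > 0"
  obtain C where C: "C \<ge> 0" "\<And>x. \<bar>\<psi> x\<bar> \<le> C" using \<psi> by (rule bounded_borelE) blast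
  have "e / (C + 1) > 0" using e C by simp
  from F[unfolded has_L1_integral_def, THEN conjunct2, THEN conjunct2, rule_format, OF this]
  obtain \<gamma> where \<gamma>: "gauge \<gamma>" "\<And>D. D tagged_division_of {a..b} \<Longrightarrow> \<gamma> fine D \<Longrightarrow>
      L1_dist (\<lambda>x. \<Sum>(s, k)\<in>D. measure lborel k * f s x) F < e / (C + 1)"
    by auto
  have fint: "integrable lebesgue (f s)" if "s \<in> {a..b}" for s using F that by (auto simp: has_L1_integral_def)
  have Fint: "integrable lebesgue F" using F by (auto simp: has_L1_integral_def)
  show "\<exists>\<gamma>. gauge \<gamma> \<and> (\<forall>D. D tagged_division_of {a..b} \<and> \<gamma> fine D \<longrightarrow>
      norm ((\<Sum>(s, k)\<in>D. measure lborel k *\<^sub>R (LINT x|lebesgue. f s x * \<psi> x)) - (LINT x|lebesgue. F x * \<psi> x)) < e)"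
  proof (intro exI[of _ \<gamma>] conjI allI impI)
    fix D assume D: "D tagged_division_of {a..b} \<and> \<gamma> fine D"
    have tag: "s \<in> {a..b}" if "(s, k) \<in> D" for s k
      using D that tagged_division_ofD(2,3)[of D "{a..b}" s k] by auto
    define S where "S x = (\<Sum>(s, k)\<in>D. measure lborel k * f s x)" for x
    have fp: "integrable lebesgue (f (fst p))" if "p \<in> D" for p
      using fint[OF tag, of "fst p" "snd p"] that by simp
    have Sint: "integrable lebesgue S"
      unfolding S_def[abs_def] by (intro Bochner_Integration.integrable_sum) (auto intro!: integrable_mult_right fint tag)
    have "(\<Sum>(s, k)\<in>D. measure lborel k *\<^sub>R (LINT x|lebesgue. f s x * \<psi> x)) = (\<Sum>p\<in>D. LINT x|lebesgue. measure lborel (snd p) * (f (fst p) x * \<psi> x))"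
      by (intro sum.cong) auto
    also have "\<dots> = (LINT x|lebesgue. (\<Sum>p\<in>D. measure lborel (snd p) * (f (fst p) x * \<psi> x)))"
      by (intro Bochner_Integration.integral_sum[symmetric] integrable_mult_right lebesgue_integrable_mult_bounded \<psi> fp)
    also have "\<dots> = (LINT x|lebesgue. S x * \<psi> x)"
      by (simp add: S_def sum_distrib_right case_prod_unfold mult.assoc)
    finally have "(\<Sum>(s, k)\<in>D. measure lborel k *\<^sub>R (LINT x|lebesgue. f s x * \<psi> x)) - (LINT x|lebesgue. F x * \<psi> x)
      = (LINT x|lebesgue. (S x - F x) * \<psi> x)"
      using lebesgue_integrable_mult_bounded[OF Sint \<psi>] lebesgue_integrable_mult_bounded[OF Fint \<psi>]
      by (simp add: left_diff_distrib)
    also have "norm \<dots> \<le> C * L1_dist S F"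
      unfolding L1_dist_def real_norm_def
      by (intro lebesgue_integral_mult_bounded_le \<psi> C Bochner_Integration.integrable_diff Sint Fint)
    also have "\<dots> \<le> C * (e / (C + 1))"
      using \<gamma>(2)[of D] D C by (intro mult_left_mono) (auto simp: S_def[abs_def])
    also have "\<dots> < e" using e C by (simp add: pos_divide_less_eq)
    finally show "norm ((\<Sum>(s, k)\<in>D. measure lborel k *\<^sub>R (LINT x|lebesgue. f s x * \<psi> x)) - (LINT x|lebesgue. F x * \<psi> x)) < e" .
  qed (rule \<gamma>(1))
qed

lemma L1_continuous_functional:
  assumes u: "L1_continuous_on {0..} u"
    and \<Phi>: "\<And>f g. integrable lebesgue f \<Longrightarrow> integrable lebesgue g \<Longrightarrow> \<bar>\<Phi> f - \<Phi> g\<bar> \<le> C * L1_dist f g"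
  shows "continuous_on {0..} (\<lambda>t. \<Phi> (u t) :: real)"
  unfolding continuous_on_def
proof
  fix t :: real assume t: "t \<in> {0..}"
  have ui: "integrable lebesgue (u s)" if "s \<ge> 0" for s using u that by (auto simp: L1_continuous_on_def)
  have lim: "((\<lambda>s. C * L1_dist (u s) (u t)) \<longlongrightarrow> 0) (at t within {0..})"
    using u t by (intro tendsto_mult_right_zero) (auto simp: L1_continuous_on_def)
  have "((\<lambda>s. \<Phi> (u s) - \<Phi> (u t)) \<longlongrightarrow> 0) (at t within {0..})"
    by (rule Lim_null_comparison[OF _ lim]) (use \<Phi> ui t in \<open>auto simp: eventually_at_filter\<close>)
  then show "((\<lambda>t. \<Phi> (u t)) \<longlongrightarrow> \<Phi> (u t)) (at t within {0..})" by (simp add: LIM_zero_iff)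
qed

lemma L1_continuous_pairing:
  assumes u: "L1_continuous_on {0..} u" and \<psi>: "bounded_borel \<psi>"
  shows "continuous_on {0..} (\<lambda>t. LINT x|lebesgue. u t x * \<psi> x)"
proof -
  obtain C where C: "C \<ge> 0" "\<And>x. \<bar>\<psi> x\<bar> \<le> C" using \<psi> by (rule bounded_borelE) blast
  show ?thesis
  proof (rule L1_continuous_functional[OF u, where \<Phi>="\<lambda>f. LINT x|lebesgue. f x * \<psi> x" and C=C])
    fix f g :: "'a \<Rightarrow> real" assume i: "integrable lebesgue f" "integrable lebesgue g"
    have "(LINT x|lebesgue. f x * \<psi> x) - (LINT x|lebesgue. g x * \<psi> x) = (LINT x|lebesgue. (f x - g x) * \<psi> x)"
      using i[THEN lebesgue_integrable_mult_bounded, OF \<psi>] by (simp add: left_diff_distrib)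
    then show "\<bar>(LINT x|lebesgue. f x * \<psi> x) - (LINT x|lebesgue. g x * \<psi> x)\<bar> \<le> C * L1_dist f g"
      unfolding L1_dist_def
      using lebesgue_integral_mult_bounded_le[OF Bochner_Integration.integrable_diff[OF i] \<psi> C(2)] by simp
  qed
qed

lemma L1_continuous_bounded:
  assumes u: "L1_continuous_on {0..} u"
  obtains U where "\<And>s. s \<in> {0..b} \<Longrightarrow> (LINT x|lebesgue. \<bar>u s x\<bar>) \<le> U"
proof -
  have "continuous_on {0..} (\<lambda>t. LINT x|lebesgue. \<bar>u t x\<bar>)"
  proof (rule L1_continuous_functional[OF u, where \<Phi>="\<lambda>f. LINT x|lebesgue. \<bar>f x\<bar>" and C=1])
    fix f g :: "'a \<Rightarrow> real" assume i: "integrable lebesgue f" "integrable lebesgue g"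
    have "(LINT x|lebesgue. \<bar>f x\<bar>) - (LINT x|lebesgue. \<bar>g x\<bar>) = (LINT x|lebesgue. \<bar>f x\<bar> - \<bar>g x\<bar>)"
      using i by simp
    also have "\<bar>\<dots>\<bar> \<le> (LINT x|lebesgue. \<bar>\<bar>f x\<bar> - \<bar>g x\<bar>\<bar>)" by (rule integral_abs_bound)
    also have "\<dots> \<le> 1 * L1_dist f g"
      unfolding L1_dist_def mult_1 using i by (intro integral_mono) auto
    finally show "\<bar>(LINT x|lebesgue. \<bar>f x\<bar>) - (LINT x|lebesgue. \<bar>g x\<bar>)\<bar> \<le> 1 * L1_dist f g" .
  qed
  then have "continuous_on {0..b} (\<lambda>t. LINT x|lebesgue. \<bar>u t x\<bar>)" by (rule continuous_on_subset) auto
  then have "bounded ((\<lambda>t. LINT x|lebesgue. \<bar>u t x\<bar>) ` {0..b})"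
    by (intro compact_imp_bounded compact_continuous_image) auto
  then obtain U where "\<forall>y\<in>(\<lambda>t. LINT x|lebesgue. \<bar>u t x\<bar>) ` {0..b}. norm y \<le> U" unfolding bounded_iff by blast
  then show thesis by (intro that[of U]) auto
qed

lemma lebesgue_integral_eq_lborel:
  fixes f g :: "'a::euclidean_space \<Rightarrow> real"
  assumes "f \<in> borel_measurable lebesgue" "g \<in> borel_measurable borel" "AE x in lborel. f x = g x"
  shows "(LINT x|lebesgue. f x) = mass g"
proof -
  have "(LINT x|lebesgue. f x) = (LINT x|lebesgue. g x)"
    using assms by (intro integral_cong_AE) (auto simp: AE_completion_iff intro: measurable_completion)
  also have "\<dots> = mass g" using assms(2) by (intro integral_completion) simp
  finally show ?thesis .
qed

lemma lebesgue_integrable_iff_lborel: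
  fixes f g :: "'a::euclidean_space \<Rightarrow> real"
  assumes "f \<in> borel_measurable lebesgue" "g \<in> borel_measurable borel" "AE x in lborel. f x = g x"
  shows "integrable lebesgue f \<longleftrightarrow> integrable lborel g"
proof -
  have "integrable lebesgue f \<longleftrightarrow> integrable lebesgue g"
    using assms by (intro integrable_cong_AE) (auto simp: AE_completion_iff intro: measurable_completion)
  also have "\<dots> \<longleftrightarrow> integrable lborel g" using assms(2) by (intro integrable_completion) simp
  finally show ?thesis .
qed

context jump_kernel
begin

lemma convolution_eq_avg:
  assumes f: "f \<in> borel_measurable lebesgue" and g[measurable]: "g \<in> borel_measurable borel"
    and fg: "AE x in lborel. f x = g x"
  shows "Defs.convolution J f x = avg g x"
  unfolding Defs.convolution_def avg_def
proof (rule lebesgue_integral_eq_lborel)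
  show "(\<lambda>y. J (x - y) * f y) \<in> borel_measurable lebesgue"
    by (intro borel_measurable_times bounded_borel_lebesgue J_bounded_borel f)
  show "AE y in lborel. J (x - y) * f y = J (x - y) * g y" using fg by eventually_elim simp
qed measurable

text \<open>Symmetry moves the jump operator to the test function; as \<open>f\<close> and \<open>\<psi>\<close> vanish in the hole, the
  operator may be replaced by the killed one.\<close>

lemma generator_pairing:
  assumes f: "integrable lebesgue f" and Lf: "integrable lebesgue (\<lambda>x. Defs.convolution J f x - f x)"
    and \<Omega>: "\<Omega> \<in> sets borel" and f0: "AE x in lebesgue. x \<notin> \<Omega> \<longrightarrow> f x = 0"
    and \<psi>: "bounded_borel \<psi>" "\<And>x. x \<notin> \<Omega> \<Longrightarrow> \<psi> x = 0"
  shows "(LINT x|lebesgue. (Defs.convolution J f x - f x) * \<psi> x)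
      = (LINT x|lebesgue. f x * step \<Omega> \<psi> x) - (LINT x|lebesgue. f x * \<psi> x)"
proof -
  have fm: "f \<in> borel_measurable lebesgue" using f by simp
  obtain g where g[measurable]: "g \<in> borel_measurable borel" and fg: "AE x in lborel. f x = g x"
    using borel_representative[OF fm] .
  have gi: "integrable lborel g" using lebesgue_integrable_iff_lborel[OF fm g fg] f by simp
  have [measurable]: "\<psi> \<in> borel_measurable borel" "step \<Omega> \<psi> \<in> borel_measurable borel" "avg g \<in> borel_measurable borel"
    using \<psi> \<Omega> by (auto intro: bounded_borel_meas step_meas avg_meas g)
  have b: "bounded_borel (step \<Omega> \<psi>)" by (intro step_bounded_borel \<Omega> \<psi>)
  have pair: "(LINT x|lebesgue. f x * k x) = pairing g k" if k: "bounded_borel k" for k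
  proof (rule lebesgue_integral_eq_lborel)
    show "(\<lambda>x. f x * k x) \<in> borel_measurable lebesgue" by (intro borel_measurable_times fm bounded_borel_lebesgue k)
    show "(\<lambda>x. g x * k x) \<in> borel_measurable borel" using k by (auto intro: borel_measurable_times bounded_borel_meas)
    show "AE x in lborel. f x * k x = g x * k x" using fg by eventually_elim simp
  qed
  have "(LINT x|lebesgue. (Defs.convolution J f x - f x) * \<psi> x) = (LINT x|lborel. (avg g x - g x) * \<psi> x)"
  proof (rule lebesgue_integral_eq_lborel)
    show "(\<lambda>x. (Defs.convolution J f x - f x) * \<psi> x) \<in> borel_measurable lebesgue"
      by (intro borel_measurable_times borel_measurable_integrable[OF Lf] bounded_borel_lebesgue \<psi>)
    show "AE x in lborel. (Defs.convolution J f x - f x) * \<psi> x = (avg g x - g x) * \<psi> x"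
      using fg by eventually_elim (simp add: convolution_eq_avg[OF fm g fg])
  qed measurable
  also have "\<dots> = (LINT x|lborel. avg g x * \<psi> x) - (LINT x|lborel. g x * \<psi> x)"
    using integrable_mult_bounded[OF avg_integrable[OF gi] \<psi>(1)] integrable_mult_bounded[OF gi \<psi>(1)]
    by (simp add: left_diff_distrib)
  also have "(LINT x|lborel. avg g x * \<psi> x) = (LINT x|lborel. g x * avg \<psi> x)"
    by (intro avg_symmetric gi \<psi>)
  also have "\<dots> = (LINT x|lborel. g x * step \<Omega> \<psi> x)"
  proof (rule integral_cong_AE)
    have \<psi>\<Omega>: "(\<lambda>y. indicator \<Omega> y * \<psi> y) = \<psi>"
    proof
      show "indicator \<Omega> y * \<psi> y = \<psi> y" for y using \<psi>(2)[of y] by (cases "y \<in> \<Omega>") auto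
    qed
    have st: "step \<Omega> \<psi> x = indicator \<Omega> x * avg \<psi> x" for x by (simp only: step_def \<psi>\<Omega>)
    have "AE x in lborel. x \<notin> \<Omega> \<longrightarrow> f x = 0" using f0 by (simp add: AE_completion_iff)
    with fg show "AE x in lborel. g x * avg \<psi> x = g x * step \<Omega> \<psi> x"
      by eventually_elim (auto simp: st indicator_def)
    show "(\<lambda>x. g x * avg \<psi> x) \<in> borel_measurable lborel"
      using avg_bounded_borel[OF \<psi>(1)] by (auto dest: bounded_borel_meas)
  qed measurable
  finally show ?thesis by (simp add: pair b \<psi>(1))
qed

text \<open>The pairings of \<open>u\<close> with \<open>A\<^sup>n \<psi>\<close>, \<open>n = 0, 1, \<dots>\<close>, satisfy a closed system of ordinary
  differential equations.  This determines the solution, without a construction of the semigroup.\<close>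

theorem solution_pairing:
  assumes \<H>: "\<H> \<in> sets borel" and u: "nonlocal_solution J \<H> u\<^sub>0 u"
    and u0: "integrable lebesgue u\<^sub>0" and \<psi>: "bounded_borel \<psi>" "\<And>x. x \<in> \<H> \<Longrightarrow> \<psi> x = 0" and b: "b > 0"
  shows "(LINT x|lebesgue. u b x * \<psi> x) = poisson_mean b (\<lambda>n. LINT x|lebesgue. u\<^sub>0 x * (step (- \<H>) ^^ n) \<psi> x)"
proof -
  let ?\<Omega> = "- \<H>"
  let ?\<psi> = "\<lambda>n. (step ?\<Omega> ^^ n) \<psi>"
  have \<Omega>: "?\<Omega> \<in> sets borel" using \<H> by (rule borel_comp)
  have u_cont: "L1_continuous_on {0..} u" using u by (simp add: nonlocal_solution_def)
  have \<psi>n: "bounded_borel (?\<psi> n)" "\<And>x. x \<notin> ?\<Omega> \<Longrightarrow> ?\<psi> n x = 0" for n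
  proof -
    show "bounded_borel (?\<psi> n)" by (intro iter_bounded_borel \<Omega> \<psi>)
    show "\<And>x. x \<notin> ?\<Omega> \<Longrightarrow> ?\<psi> n x = 0" using \<psi>(2) by (cases n) (auto simp: step_def)
  qed
  obtain C where C: "C \<ge> 0" "\<And>x. \<bar>\<psi> x\<bar> \<le> C" using \<psi>(1) by (rule bounded_borelE) blast
  have \<psi>C: "\<bar>?\<psi> n x\<bar> \<le> C" for n x
  proof (induction n arbitrary: x)
    case (Suc n)
    have "\<bar>step ?\<Omega> (?\<psi> n) x\<bar> \<le> C"
      by (rule step_bound[OF \<Omega>]) (use Suc bounded_borel_meas[OF \<psi>n(1)] in auto)
    then show ?case by simp
  qed (simp add: C)
  have ui: "integrable lebesgue (u s)" if "s \<ge> 0" for s using u_cont that by (auto simp: L1_continuous_on_def)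
  obtain U where U: "\<And>s. s \<in> {0..b} \<Longrightarrow> (LINT x|lebesgue. \<bar>u s x\<bar>) \<le> U"
    using L1_continuous_bounded[OF u_cont] by blast
  have "(\<lambda>n t. LINT x|lebesgue. u t x * ?\<psi> n x) 0 b = poisson_mean b (\<lambda>n. LINT x|lebesgue. u\<^sub>0 x * ?\<psi> n x)"
  proof (rule poisson_representation)
    show "continuous_on {0..} (\<lambda>t. LINT x|lebesgue. u t x * ?\<psi> n x)" for n
      by (rule L1_continuous_pairing[OF u_cont \<psi>n(1)])
    show "\<bar>LINT x|lebesgue. u s x * ?\<psi> n x\<bar> \<le> C * U" if s: "s \<in> {0..b}" for n s
    proof -
      have "\<bar>LINT x|lebesgue. u s x * ?\<psi> n x\<bar> \<le> C * (LINT x|lebesgue. \<bar>u s x\<bar>)"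
        using s by (intro lebesgue_integral_mult_bounded_le ui \<psi>n \<psi>C) auto
      also have "\<dots> \<le> C * U" using U[OF s] C by (intro mult_left_mono) auto
      finally show ?thesis .
    qed
    show "((\<lambda>s. (LINT x|lebesgue. u s x * ?\<psi> (Suc n) x) - (LINT x|lebesgue. u s x * ?\<psi> n x)) has_integral
        (LINT x|lebesgue. u t x * ?\<psi> n x) - (LINT x|lebesgue. u\<^sub>0 x * ?\<psi> n x)) {0..t}" if t: "t > 0" for n t
    proof -
      obtain F where F: "has_L1_integral (\<lambda>s x. Defs.convolution J (u s) x - u s x) F 0 t"
        and uF: "AE x in lebesgue. x \<in> ?\<Omega> \<longrightarrow> u t x = u\<^sub>0 x + F x"
        using u t by (auto simp: nonlocal_solution_def)
      have Fi: "integrable lebesgue F" using F by (simp add: has_L1_integral_def)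
      have "(LINT x|lebesgue. u t x * ?\<psi> n x) = (LINT x|lebesgue. u\<^sub>0 x * ?\<psi> n x + F x * ?\<psi> n x)"
      proof (rule integral_cong_AE)
        show "(\<lambda>x. u t x * ?\<psi> n x) \<in> borel_measurable lebesgue"
          using lebesgue_integrable_mult_bounded[OF ui \<psi>n(1)] t by simp
        show "(\<lambda>x. u\<^sub>0 x * ?\<psi> n x + F x * ?\<psi> n x) \<in> borel_measurable lebesgue"
          using lebesgue_integrable_mult_bounded[OF u0 \<psi>n(1), of n] lebesgue_integrable_mult_bounded[OF Fi \<psi>n(1), of n]
          by (auto intro: borel_measurable_add)
        show "AE x in lebesgue. u t x * ?\<psi> n x = u\<^sub>0 x * ?\<psi> n x + F x * ?\<psi> n x"
          using uF
        proof eventually_elim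
          case (elim x)
          then show ?case using \<psi>n(2)[of x n] by (cases "x \<in> ?\<Omega>") (auto simp: distrib_right)
        qed
      qed
      also have "\<dots> = (LINT x|lebesgue. u\<^sub>0 x * ?\<psi> n x) + (LINT x|lebesgue. F x * ?\<psi> n x)"
        by (intro Bochner_Integration.integral_add lebesgue_integrable_mult_bounded u0 Fi \<psi>n)
      finally have diff: "(LINT x|lebesgue. u t x * ?\<psi> n x) - (LINT x|lebesgue. u\<^sub>0 x * ?\<psi> n x) = (LINT x|lebesgue. F x * ?\<psi> n x)"
        by simp
      show ?thesis
        unfolding diff
      \<comment> \<open>The solution need not vanish in the hole at time 0, which is a single point.\<close>
      proof (rule has_integral_spike_finite[OF _ _ L1_integral_pairing[OF F \<psi>n(1)[of n]]])
        fix s assume s: "s \<in> {0..t} - {0}"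
        have "AE x in lebesgue. x \<in> \<H> \<longrightarrow> u s x = 0" using u s by (auto simp: nonlocal_solution_def)
        then have u0s: "AE x in lebesgue. x \<notin> ?\<Omega> \<longrightarrow> u s x = 0" by simp
        have "integrable lebesgue (\<lambda>x. Defs.convolution J (u s) x - u s x)" using F s by (simp add: has_L1_integral_def)
        from generator_pairing[OF _ this \<Omega> u0s \<psi>n(1)[of n] \<psi>n(2)] s ui
        show "(LINT x|lebesgue. u s x * ?\<psi> (Suc n) x) - (LINT x|lebesgue. u s x * ?\<psi> n x)
            = (LINT x|lebesgue. (Defs.convolution J (u s) x - u s x) * ?\<psi> n x)" by simp
      qed simp
    qed
  qed (rule b)
  then show ?thesis by simp
qed

end

section \<open>The stationary solution and the long-time limit\<close>

text \<open>Testing with the indicators of the sets where \<open>h \<ge> e\<close> or \<open>- h \<ge> e\<close> shows that both are null sets.\<close>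

lemma small_on_bounded_set_by_duality:
  fixes h :: "'a::euclidean_space \<Rightarrow> real"
  assumes h: "integrable lborel h" and S: "S \<in> sets borel" "bounded S" and e: "e > 0"
    and small: "\<And>E. E \<in> sets borel \<Longrightarrow> E \<subseteq> S \<Longrightarrow> \<bar>LINT x|lborel. h x * indicator E x\<bar> \<le> e / 2 * measure lborel E"
  shows "AE x in lborel. x \<in> S \<longrightarrow> \<bar>h x\<bar> < e"
proof -
  have [measurable]: "h \<in> borel_measurable borel" "S \<in> sets borel"
    using h S by (auto dest: integrable_borel_meas)
  have null: "AE x in lborel. x \<notin> E" if E: "E \<in> sets borel" "E \<subseteq> S" and s: "\<And>x. x \<in> E \<Longrightarrow> s * h x \<ge> e" "\<bar>s\<bar> = 1" for E s
  proof -
    have fin: "emeasure lborel E < \<infinity>" by (rule emeasure_bounded_finite[OF bounded_subset[OF S(2) E(2)]])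
    have i: "integrable lborel (\<lambda>x. s * (h x * indicator E x))"
      by (intro integrable_mult_right integrable_mult_bounded h bounded_borel_indicator E)
    have "e * measure lborel E = (LINT x|lborel. e * indicator E x)" by simp
    also have "\<dots> \<le> (LINT x|lborel. s * (h x * indicator E x))"
      using fin E s by (intro integral_mono i integrable_mult_right integrable_real_indicator) (auto simp: indicator_def infinity_ennreal_def)
    also have "\<dots> \<le> \<bar>s\<bar> * \<bar>LINT x|lborel. h x * indicator E x\<bar>" by (simp flip: abs_mult)
    also have "\<dots> \<le> e / 2 * measure lborel E" using small[OF E] s by simp
    finally have "measure lborel E \<le> 0" using e by (simp add: field_simps)
    then have "measure lborel E = 0" using measure_nonneg[of lborel E] by linarith
    then have "emeasure lborel E = 0" using fin by (simp add: emeasure_eq_ennreal_measure)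
    then show ?thesis using E(1) by (intro AE_not_in) (auto simp: null_sets_def)
  qed
  have "AE x in lborel. x \<notin> {x \<in> S. h x \<ge> e}" by (rule null[where s=1]) auto
  moreover have "AE x in lborel. x \<notin> {x \<in> S. - h x \<ge> e}" by (rule null[where s="-1"]) auto
  ultimately show ?thesis by eventually_elim (auto simp: abs_less_iff not_le)
qed

text \<open>One application of the killed operator to a Borel version of \<open>\<phi>\<close> gives a version that satisfies the
  equation at every point.  It is bounded: \<open>\<phi>\<close> is at most 2 outside a ball, and inside the ball the
  integral of \<open>\<phi>\<close> is finite and the kernel is bounded.\<close>

lemma (in jump_kernel) stationary_representative:
  assumes \<H>: "\<H> \<in> sets borel" and \<phi>: "stationary_solution J \<H> \<phi>"
  obtains \<phi>' where "killed_walk J (- \<H>) \<phi>'" "AE x in lborel. \<phi> x = \<phi>' x" "\<phi> \<in> borel_measurable lebesgue"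
proof -
  let ?\<Omega> = "- \<H>"
  have \<Omega>[measurable]: "?\<Omega> \<in> sets borel" using \<H> by (rule borel_comp)
  have loc: "set_integrable lebesgue K \<phi>" if "compact K" for K
    using \<phi> that by (simp add: stationary_solution_def locally_integrable_def)
  have \<phi>m: "\<phi> \<in> borel_measurable lebesgue"
  proof (rule borel_measurable_LIMSEQ_real)
    show "(\<lambda>x. indicator (cball 0 (real n)) x *\<^sub>R \<phi> x) \<in> borel_measurable lebesgue" for n
      using loc[of "cball 0 (real n)"] by (simp add: set_integrable_def)
    fix x :: 'a
    have "\<forall>\<^sub>F n in sequentially. norm x \<le> real n"
      using filterlim_real_sequentially by (simp add: filterlim_at_top)
    then have "\<forall>\<^sub>F n in sequentially. indicator (cball 0 (real n)) x *\<^sub>R \<phi> x = \<phi> x"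
      by eventually_elim simp
    then show "(\<lambda>n. indicator (cball 0 (real n)) x *\<^sub>R \<phi> x) \<longlonglongrightarrow> \<phi> x" by (rule tendsto_eventually)
  qed
  obtain g where g[measurable]: "g \<in> borel_measurable borel" and \<phi>g: "AE x in lborel. \<phi> x = g x"
    using borel_representative[OF \<phi>m] .
  have hole: "AE x in lborel. x \<in> \<H> \<longrightarrow> \<phi> x = 0"
    using \<phi> by (simp add: stationary_solution_def AE_completion_iff)
  have step_cong: "step ?\<Omega> k x = step ?\<Omega> g x" if k[measurable]: "k \<in> borel_measurable borel" and "AE x in lborel. k x = g x" for k x
  proof -
    have "avg (\<lambda>y. indicator ?\<Omega> y * k y) x = avg (\<lambda>y. indicator ?\<Omega> y * g y) x"
      unfolding avg_def by (intro integral_cong_AE) (use that(2) in \<open>auto elim!: eventually_mono\<close>)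
    then show ?thesis by (simp only: step_def)
  qed
  define \<phi>' where "\<phi>' = step ?\<Omega> g"
  have [measurable]: "\<phi>' \<in> borel_measurable borel" unfolding \<phi>'_def by (intro step_meas \<Omega> g)
  have \<phi>'g: "AE x in lborel. \<phi>' x = g x"
  proof -
    have conv: "Defs.convolution J \<phi> x = avg (\<lambda>y. indicator ?\<Omega> y * g y) x" for x
    proof (rule convolution_eq_avg[OF \<phi>m])
      show "AE y in lborel. \<phi> y = indicator ?\<Omega> y * g y"
        using \<phi>g hole by eventually_elim (auto simp: indicator_def)
    qed measurable
    have "AE x in lborel. x \<in> ?\<Omega> \<longrightarrow> Defs.convolution J \<phi> x = \<phi> x"
      using \<phi> by (simp add: stationary_solution_def AE_completion_iff)
    then show ?thesis using \<phi>g hole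
    proof eventually_elim
      case (elim x)
      then show ?case by (cases "x \<in> ?\<Omega>") (simp_all only: \<phi>'_def step_def conv, auto)
    qed
  qed
  have \<phi>\<phi>': "AE x in lborel. \<phi> x = \<phi>' x" using \<phi>g \<phi>'g by eventually_elim simp
  have lim: "\<exists>R. AE x in lborel. norm x \<ge> R \<longrightarrow> \<bar>\<phi>' x - 1\<bar> < e" if e: "e > 0" for e
  proof -
    obtain R where R: "AE x in lborel. norm x \<ge> R \<longrightarrow> \<bar>\<phi> x - 1\<bar> < e"
      using \<phi>[unfolded stationary_solution_def, THEN conjunct2, THEN conjunct2, THEN conjunct2, rule_format, OF e]
      unfolding AE_completion_iff by auto
    have "AE x in lborel. norm x \<ge> R \<longrightarrow> \<bar>\<phi>' x - 1\<bar> < e" using R \<phi>\<phi>' by eventually_elim simp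
    then show ?thesis ..
  qed
  have bdd: "bounded_borel \<phi>'"
  proof -
    obtain R where R: "AE x in lborel. norm x \<ge> R \<longrightarrow> \<bar>\<phi>' x - 1\<bar> < 1" using lim[of 1] by auto
    define L where "L y = indicator (cball 0 R) y * \<bar>g y\<bar>" for y
    have L: "integrable lborel L"
    proof -
      have "integrable lebesgue (\<lambda>x. \<bar>indicator (cball 0 R) x *\<^sub>R \<phi> x\<bar>)"
        using loc[of "cball 0 R"] by (intro integrable_abs) (simp add: set_integrable_def)
      moreover have "integrable lebesgue (\<lambda>x. \<bar>indicator (cball 0 R) x *\<^sub>R \<phi> x\<bar>) \<longleftrightarrow> integrable lborel L"
      proof (rule lebesgue_integrable_iff_lborel)
        show "(\<lambda>x. \<bar>indicator (cball 0 R) x *\<^sub>R \<phi> x\<bar>) \<in> borel_measurable lebesgue"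
          using loc[of "cball 0 R"] by (intro borel_measurable_abs) (simp add: set_integrable_def)
        show "L \<in> borel_measurable borel" unfolding L_def[abs_def]
          by (intro borel_measurable_times borel_measurable_indicator borel_measurable_abs g) auto
        show "AE x in lborel. \<bar>indicator (cball 0 R) x *\<^sub>R \<phi> x\<bar> = L x"
          using \<phi>g by eventually_elim (auto simp: L_def abs_mult)
      qed
      ultimately show ?thesis by simp
    qed
    have dom: "AE y in lborel. \<bar>J (x - y) * (indicator ?\<Omega> y * g y)\<bar> \<le> 2 * J (x - y) + Jmax * L y" for x
      using R \<phi>'g
    proof eventually_elim
      case (elim y)
      have "\<bar>J (x - y) * (indicator ?\<Omega> y * g y)\<bar> \<le> J (x - y) * \<bar>g y\<bar>"
        by (auto simp: abs_mult J_nonneg indicator_def)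
      also have "\<dots> \<le> 2 * J (x - y) + Jmax * L y"
      proof (cases "norm y \<ge> R")
        case True
        then have "\<bar>g y\<bar> \<le> 2" using elim by auto
        then have "J (x - y) * \<bar>g y\<bar> \<le> J (x - y) * 2" by (intro mult_left_mono J_nonneg)
        moreover have "0 \<le> Jmax * L y" using Jmax_pos by (simp add: L_def)
        ultimately show ?thesis by simp
      next
        case False
        then have "J (x - y) * \<bar>g y\<bar> \<le> Jmax * L y"
          using J_le_Jmax by (auto simp: L_def intro!: mult_right_mono)
        then show ?thesis using J_nonneg[of "x - y"] by simp
      qed
      finally show ?case .
    qed
    have "\<bar>\<phi>' x\<bar> \<le> 2 + Jmax * mass L" for x
    proof -
      have i: "integrable lborel (\<lambda>y. 2 * J (x - y) + Jmax * L y)"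
        using J_translate_integrable L by simp
      have i2: "integrable lborel (\<lambda>y. J (x - y) * (indicator ?\<Omega> y * g y))"
        by (rule Bochner_Integration.integrable_bound[OF i]) (use dom[of x] in \<open>auto elim!: eventually_mono\<close>)
      have "\<bar>\<phi>' x\<bar> \<le> \<bar>LINT y|lborel. J (x - y) * (indicator ?\<Omega> y * g y)\<bar>"
        unfolding \<phi>'_def step_def avg_def abs_mult by (rule mult_left_le_one_le) auto
      also have "\<dots> \<le> (LINT y|lborel. \<bar>J (x - y) * (indicator ?\<Omega> y * g y)\<bar>)" by (rule integral_abs_bound)
      also have "\<dots> \<le> (LINT y|lborel. 2 * J (x - y) + Jmax * L y)"
        by (intro integral_mono_AE integrable_abs i i2 dom)
      also have "\<dots> = 2 + Jmax * mass L"
        using J_translate_integrable[of x] L by (simp add: J_translate_mass)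
      finally show ?thesis .
    qed
    then show ?thesis by (intro bounded_borelI) auto
  qed
  have "killed_walk J ?\<Omega> \<phi>'"
  proof unfold_locales
    show "step ?\<Omega> \<phi>' = \<phi>'"
      using step_cong[OF _ \<phi>'g] by (auto simp: \<phi>'_def[symmetric])
  qed (use \<Omega> bdd lim in auto)
  with \<phi>\<phi>' \<phi>m show thesis by (intro that)
qed

text \<open>The uniform bound on \<open>\<langle>f, A\<^sup>n g\<rangle>\<close> required by the Abelian theorem comes from the boundedness of the
  initial datum.\<close>

lemma (in killed_walk) continuous_time_limit:
  assumes f: "integrable lborel f" "bounded_borel f" "\<And>x. f x \<ge> 0" and e: "e > 0"
  defines "c \<equiv> 1 / (4 * pi * \<alpha>) powr (real DIM('a) / 2)"
  shows "\<forall>\<^sub>F t in at_top. \<forall>g. test_function r g \<longrightarrow>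
     \<bar>sqrt t ^ DIM('a) * poisson_mean t (\<lambda>n. pairing f ((step \<Omega> ^^ n) g))
        - c * pairing f \<phi> * pairing g \<phi>\<bar> \<le> e * mass g"
proof -
  obtain P where P: "P \<ge> 0" "\<And>x. \<bar>\<phi> x\<bar> \<le> P" using bounded_borelE[OF \<phi>_bounded] by blast
  obtain B where B: "B \<ge> 0" "\<And>x. \<bar>f x\<bar> \<le> B" using bounded_borelE[OF f(2)] by blast
  define M where "M = c * pairing f \<phi>"
  have e3: "e / 3 > 0" using e by simp
  obtain n0 where n0: "\<And>n g. n \<ge> n0 \<Longrightarrow> test_function r g \<Longrightarrow>
     \<bar>sqrt (real (Suc n)) ^ DIM('a) * pairing f ((step \<Omega> ^^ n) g) - M * pairing g \<phi>\<bar>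
      \<le> e / 3 * mass g"
    using killed_local_limit[OF f(1,3) e3, of r] unfolding eventually_sequentially M_def c_def by blast
  have "0 \<le> \<bar>M\<bar> * P" using P by simp
  from poisson_abelian[OF e3 B(1) this, of n0 "DIM('a)"]
  show ?thesis
  proof eventually_elim
    case (elim t)
    show ?case
    proof (intro allI impI)
      fix g :: "'a \<Rightarrow> real"
      assume tg: "test_function r g"
      then have g: "integrable lborel g" "bounded_borel g" "\<forall>x. g x \<ge> 0" "\<forall>x. norm x > r \<longrightarrow> g x = 0"
        by (auto simp: test_function_def)
      define b where "b n = pairing f ((step \<Omega> ^^ n) g)" for n
      define G where "G = mass g"
      define l where "l = M * pairing g \<phi>"
      have G: "G \<ge> 0" unfolding G_def by (intro Bochner_Integration.integral_nonneg) (use g in auto)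
      have "\<bar>b n\<bar> \<le> B * G" for n
      proof -
        have fn: "\<bar>(step \<Omega> ^^ n) f x\<bar> \<le> B" for x
        proof (induction n arbitrary: x)
          case (Suc n)
          have "\<bar>step \<Omega> ((step \<Omega> ^^ n) f) x\<bar> \<le> B"
            by (rule step_bound[OF \<Omega>_sets])
               (use Suc bounded_borel_meas[OF iter_bounded_borel[OF \<Omega>_sets f(2)]] in auto)
          then show ?case by simp
        qed (simp add: B)
        have "b n = pairing g ((step \<Omega> ^^ n) f)"
          using iter_symmetric[OF \<Omega>_sets f(1) g(2), of n] by (simp add: b_def mult.commute)
        also have "\<bar>\<dots>\<bar> \<le> B * (LINT x|lborel. \<bar>g x\<bar>)"
          using fn bounded_borel_meas[OF iter_bounded_borel[OF \<Omega>_sets f(2)]] by (intro integral_mult_bounded_le g) auto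
        finally show ?thesis using g(3) by (simp add: G_def)
      qed
      moreover have "\<bar>l\<bar> \<le> \<bar>M\<bar> * P * G"
      proof -
        have "\<bar>pairing g \<phi>\<bar> \<le> P * G"
          using integral_mult_bounded_le[OF g(1), of \<phi> P] P g(3) bounded_borel_meas[OF \<phi>_bounded] by (simp add: G_def)
        then show ?thesis unfolding l_def abs_mult mult.assoc by (intro mult_left_mono) auto
      qed
      moreover have "\<forall>n\<ge>n0. \<bar>sqrt (real (Suc n)) ^ DIM('a) * b n - l\<bar> \<le> e / 3 * G"
        using n0 tg unfolding b_def l_def G_def by blast
      ultimately have "\<bar>sqrt t ^ DIM('a) * poisson_mean t b - l\<bar> \<le> 3 * (e / 3) * G"
        using elim G by blast
      then show "\<bar>sqrt t ^ DIM('a) * poisson_mean t (\<lambda>n. pairing f ((step \<Omega> ^^ n) g))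
        - c * pairing f \<phi> * pairing g \<phi>\<bar> \<le> e * mass g"
        by (simp add: b_def[abs_def] l_def M_def G_def)
    qed
  qed
qed

theorem corollary6p1:
  fixes \<H> :: "'a::euclidean_space set"
    and J u\<^sub>0 \<phi> :: "'a \<Rightarrow> real"
    and u :: "real \<Rightarrow> 'a \<Rightarrow> real"
  assumes dim: "DIM('a) \<ge> 3"
    and hole: "open \<H>" "bounded \<H>" "smooth_boundary \<H>" "0 \<in> \<H>"
    and J_nonneg: "\<And>x. J x \<ge> 0"
    and J_smooth: "smooth_on UNIV J"
    and J_radial: "\<And>x y. norm x = norm y \<Longrightarrow> J x = J y"
    and J_support: "closure {x. J x \<noteq> 0} \<subseteq> cball 0 1"
    and J_zero: "J 0 > 0"
    and J_mass: "(LINT x|lebesgue. J x) = 1"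
    and u0_nonneg: "AE x in lebesgue. u\<^sub>0 x \<ge> 0"
    and u0_L1: "integrable lebesgue u\<^sub>0"
    and u0_Linf: "essentially_bounded u\<^sub>0"
    and u0_hole: "AE x in lebesgue. x \<in> \<H> \<longrightarrow> u\<^sub>0 x = 0"
    and u_solution: "nonlocal_solution J \<H> u\<^sub>0 u"
    and phi_solution: "stationary_solution J \<H> \<phi>"
  shows "\<forall>K. compact K \<longrightarrow>
    ae_uniform_limit K
      (\<lambda>t x. t powr (real DIM('a) / 2) * u t x)
      (\<lambda>x. (LINT y|lebesgue. u\<^sub>0 y * \<phi> y)
             / (4 * pi * diffusivity J) powr (real DIM('a) / 2) * \<phi> x)
      at_top"
proof -
  have J_cont: "continuous_on UNIV J"
    using J_smooth by (metis smooth_on_def k_times_cont_diff_on.simps(1))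
  then have [measurable]: "J \<in> borel_measurable borel" by (rule borel_measurable_continuous_onI)
  interpret jump_kernel J
  proof
    show "J x = 0" if "norm x > 1" for x
      using J_support closure_subset[of "{x. J x \<noteq> 0}"] that by (auto simp: subset_iff)
    show "mass J = 1"
      using J_mass by (subst (asm) integral_completion) auto
    show "J x = J y" if "norm x = norm y" for x y using that by (rule J_radial)
  qed (rule J_cont J_nonneg J_zero)+
  have \<alpha>: "diffusivity J = \<alpha>"
    unfolding diffusivity_def \<alpha>_def by (subst integral_completion) auto
  have \<H>: "\<H> \<in> sets borel" using hole(1) by auto
  obtain \<phi>' where "killed_walk J (- \<H>) \<phi>'" and \<phi>\<phi>': "AE x in lborel. \<phi> x = \<phi>' x" and \<phi>m: "\<phi> \<in> borel_measurable lebesgue"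
    using stationary_representative[OF \<H> phi_solution] .
  then interpret killed_walk J "- \<H>" \<phi>' by simp
  note [measurable] = bounded_borel_meas[OF \<phi>_bounded]
  have u0m: "u\<^sub>0 \<in> borel_measurable lebesgue" using u0_L1 by simp
  obtain B where B: "AE x in lborel. \<bar>u\<^sub>0 x\<bar> \<le> B"
    using u0_Linf by (auto simp: essentially_bounded_def AE_completion_iff)
  obtain v where v[measurable]: "v \<in> borel_measurable borel" and uv: "AE x in lborel. u\<^sub>0 x = v x"
    using borel_representative[OF u0m] .
  \<comment> \<open>A version of the initial datum that is nonnegative and bounded at every point.\<close>
  define f where "f x = max 0 (min \<bar>B\<bar> (v x))" for x
  have f_meas[measurable]: "f \<in> borel_measurable borel" unfolding f_def[abs_def] by measurable
  have uf: "AE x in lborel. u\<^sub>0 x = f x"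
    using uv B u0_nonneg[unfolded AE_completion_iff] by eventually_elim (auto simp: f_def)
  have f: "integrable lborel f" "bounded_borel f" "\<And>x. f x \<ge> 0"
  proof -
    show "integrable lborel f" using u0_L1 lebesgue_integrable_iff_lborel[OF u0m f_meas uf] by simp
    show "bounded_borel f" by (rule bounded_borelI[where C="\<bar>B\<bar>"]) (auto simp: f_def)
  qed (simp add: f_def)
  have pair: "(LINT x|lebesgue. u\<^sub>0 x * k x) = pairing f k" if k: "bounded_borel k" for k
  proof (rule lebesgue_integral_eq_lborel)
    show "(\<lambda>x. u\<^sub>0 x * k x) \<in> borel_measurable lebesgue" by (intro borel_measurable_times u0m bounded_borel_lebesgue k)
    show "(\<lambda>x. f x * k x) \<in> borel_measurable borel" using k by (auto intro: borel_measurable_times bounded_borel_meas f_meas)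
    show "AE x in lborel. u\<^sub>0 x * k x = f x * k x" using uf by eventually_elim simp
  qed
  define c where "c = 1 / (4 * pi * \<alpha>) powr (real DIM('a) / 2)"
  define M where "M = pairing f \<phi>'"
  have M: "(LINT y|lebesgue. u\<^sub>0 y * \<phi> y) = M"
    unfolding M_def
  proof (rule lebesgue_integral_eq_lborel)
    show "(\<lambda>x. u\<^sub>0 x * \<phi> x) \<in> borel_measurable lebesgue" by (intro borel_measurable_times u0m \<phi>m)
    show "AE x in lborel. u\<^sub>0 x * \<phi> x = f x * \<phi>' x" using uf \<phi>\<phi>' by eventually_elim simp
  qed measurable
  show ?thesis
  proof (intro allI impI)
    fix K :: "'a set" assume K: "compact K"
    obtain r where r: "\<And>x. x \<in> K \<Longrightarrow> norm x \<le> r" using compact_imp_bounded[OF K] by (auto simp: bounded_iff)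
    show "ae_uniform_limit K (\<lambda>t x. t powr (real DIM('a) / 2) * u t x)
      (\<lambda>x. (LINT y|lebesgue. u\<^sub>0 y * \<phi> y) / (4 * pi * diffusivity J) powr (real DIM('a) / 2) * \<phi> x) at_top"
      unfolding ae_uniform_limit_def M \<alpha>
    proof (intro allI impI)
      fix e :: real assume e: "e > 0"
      then have e2: "e / 2 > 0" by simp
      show "\<forall>\<^sub>F t in at_top. AE x in lebesgue. x \<in> K \<longrightarrow>
          dist (t powr (real DIM('a) / 2) * u t x) (M / (4 * pi * \<alpha>) powr (real DIM('a) / 2) * \<phi> x) < e"
        using continuous_time_limit[OF f e2, of r, folded c_def M_def] eventually_gt_at_top[of 0]
      proof eventually_elim
        case (elim t)
        have ut: "integrable lebesgue (u t)" "AE x in lborel. x \<in> \<H> \<longrightarrow> u t x = 0"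
          using u_solution elim(2) by (auto simp: nonlocal_solution_def L1_continuous_on_def AE_completion_iff)
        then have utm: "u t \<in> borel_measurable lebesgue" by simp
        obtain w where w[measurable]: "w \<in> borel_measurable borel" and uw: "AE x in lborel. u t x = w x"
          using borel_representative[OF utm] .
        have wi: "integrable lborel w" using ut(1) lebesgue_integrable_iff_lborel[OF utm w uw] by simp
        define T where "T = sqrt t ^ DIM('a)"
        have T: "t powr (real DIM('a) / 2) = T"
          using elim(2) by (simp add: T_def powr_half_sqrt[symmetric] powr_powr flip: powr_realpow)
        \<comment> \<open>In the hole both sides vanish, so that only its complement is tested.\<close>
        define S where "S = K - \<H>"
        have S: "S \<in> sets borel" "bounded S"
          using K \<H> compact_imp_bounded[OF K] by (auto simp: S_def borel_compact intro: bounded_subset)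
        define h where "h x = T * w x - c * M * (indicator S x * \<phi>' x)" for x
        have S\<phi>: "integrable lborel (\<lambda>x. indicator S x * \<phi>' x)"
          using emeasure_bounded_finite[OF S(2)]
          by (intro integrable_mult_bounded integrable_real_indicator \<phi>_bounded) (auto simp: S infinity_ennreal_def)
        have hi: "integrable lborel h"
          unfolding h_def by (intro Bochner_Integration.integrable_diff integrable_mult_right wi S\<phi>)
        have "AE x in lborel. x \<in> S \<longrightarrow> \<bar>h x\<bar> < e"
        proof (rule small_on_bounded_set_by_duality[OF hi S e])
          fix E assume E: "E \<in> sets borel" "E \<subseteq> S"
          let ?g = "indicator E :: 'a \<Rightarrow> real"
          have Er: "norm x \<le> r" if "x \<in> E" for x using E(2) r that by (auto simp: S_def)
          have gb: "bounded_borel ?g" by (rule bounded_borel_indicator[OF E(1)])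
          have gi: "integrable lborel ?g"
            using emeasure_bounded_finite[OF bounded_subset[OF S(2) E(2)]] E(1)
            by (intro integrable_real_indicator) (auto simp: infinity_ennreal_def)
          have "pairing w ?g = (LINT x|lebesgue. u t x * ?g x)"
          proof (rule lebesgue_integral_eq_lborel[symmetric])
            show "(\<lambda>x. u t x * ?g x) \<in> borel_measurable lebesgue"
              by (intro borel_measurable_times utm bounded_borel_lebesgue gb)
            show "(\<lambda>x. w x * ?g x) \<in> borel_measurable borel" using E(1) by measurable
            show "AE x in lborel. u t x * ?g x = w x * ?g x" using uw by eventually_elim simp
          qed
          also have "\<dots> = poisson_mean t (\<lambda>n. LINT x|lebesgue. u\<^sub>0 x * (step (- \<H>) ^^ n) ?g x)"
            using E(2) by (intro solution_pairing[OF \<H> u_solution u0_L1 gb _ elim(2)]) (auto simp: S_def indicator_def)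
          also have "\<dots> = poisson_mean t (\<lambda>n. LINT x|lborel. f x * (step (- \<H>) ^^ n) ?g x)"
            by (simp add: pair iter_bounded_borel[OF \<Omega>_sets gb])
          finally have wg: "pairing w ?g = poisson_mean t (\<lambda>n. LINT x|lborel. f x * (step (- \<H>) ^^ n) ?g x)" .
          have hg: "h x * ?g x = T * (w x * ?g x) - c * M * (?g x * \<phi>' x)" for x
            using E(2) by (auto simp: h_def indicator_def)
          have "pairing h ?g = T * pairing w ?g - c * M * pairing ?g \<phi>'"
            unfolding hg using integrable_mult_bounded[OF wi gb] integrable_mult_bounded[OF gi \<phi>_bounded] by simp
          moreover have "\<bar>T * pairing w ?g - c * M * pairing ?g \<phi>'\<bar> \<le> e / 2 * mass ?g"
            unfolding wg T_def using gi gb by (intro elim(1)[rule_format]) (auto simp: test_function_def indicator_def dest: Er)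
          ultimately show "\<bar>pairing h ?g\<bar> \<le> e / 2 * measure lborel E" by simp
        qed
        then have "AE x in lborel. x \<in> K \<longrightarrow> dist (T * u t x) (c * M * \<phi> x) < e"
          using ut(2) uw \<phi>\<phi>' phi_solution[unfolded stationary_solution_def, THEN conjunct2, THEN conjunct2, THEN conjunct1, unfolded AE_completion_iff]
        proof eventually_elim
          case (elim x)
          show ?case
          proof
            assume x: "x \<in> K"
            show "dist (T * u t x) (c * M * \<phi> x) < e"
              using elim x e by (cases "x \<in> \<H>") (auto simp: S_def h_def dist_real_def)
          qed
        qed
        then show ?case unfolding T AE_completion_iff c_def by simp
      qed
    qed
  qed
qed

end
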